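(* Let $\mathcal T$ be a periodic plane or space tiling in $\mathbb R^d$, $d\ge2$, and let $\eta:\mathcal T\to\mathbb Z$ be a function of bounded support. Then $g_\eta\in\ell^2(\mathcal T)$ if and only if $\eta\in C^j(\mathcal T)$, where $j=2$ if $d=2$, $j=1$ if $d=3,4$ and $j=0$ if $d\ge5$. In particular, with this $j$, $$\mathcal H^2(\mathcal T)=\{g_\eta:\eta\in C^j(\mathcal T)\},$$ and if $\xi\in\mathcal H^2(\mathcal T)$ then $\xi=g*(\Delta\xi)$.
   Context: **Tilings.** Let $\Lambda=M\mathbb Z^d\subset\mathbb R^d$ with $M$ non-singular. A (periodic) tiling $\mathcal T$ is a connected graph embedded in $\mathbb R^d$ which is $\Lambda$-periodic, has finitely many vertices modulo $\Lambda$, and has bounded degree; $0$ is assumed to be a vertex, so $\Lambda\subset\mathcal T$ ($\mathcal T$ also denotes the vertex set). $\Delta f(v)=\deg(v)f(v)-\sum_{(v,w)\in E}f(w)$. $\mathcal H^2(\mathcal T)$ is the set of real-valued $\xi\in\ell^2(\mathcal T)$ with $\Delta\xi\equiv0\bmod1$. **Random walk.** $P(v,w)=\deg(v,w)/\deg(v)$ is the transition kernel of simple random walk, $Y_{v,n}$ is the walk started at $v$ at step $n$, and $T_v=\min\{n\ge1:Y_{v,n}\in\Lambda\}$. **Function classes.** $C^0(\mathcal T)=\{f:\mathcal T\to\mathbb Z,\ \|f\|_1<\infty\}$; $C^1(\mathcal T)=\{f\in C^0(\mathcal T):\sum_xf(x)=0\}$; $C^2(\mathcal T)=\{f\in C^1(\mathcal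 T):\sum_xf(x)\,\mathbf E[Y_{x,T_x}]=0\}$. **Green's function.** $g_0(x)=\sum_{n\ge0}\big(\frac{P^n(0,x)}{\deg x}-\frac{P^n(0,0)}{\deg 0}\big)$ if $d=2$, and $g_0(x)=\sum_{n\ge0}\frac{P^n(0,x)}{\deg x}$ if $d\ge3$. For $v\in\Lambda$, $g_v(x)=g_0(x-v)$. For $v\notin\Lambda$, $$g_v(x)=\frac1{\deg x}\mathbf E\Big[\sum_{j=0}^{T_v-1}\mathbf 1(Y_{v,j}=x)\Big]+\mathbf E\big[g_{Y_{v,T_v}}(x)\big].$$ These satisfy $\Delta g_v=\delta_v$. For $\eta$ of bounded support, $g_\eta=g*\eta=\sum_v\eta(v)g_v$. *)

theory Defs
  imports "HOL-Probability.Probability"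
begin

section \<open>Periodic tilings\<close>

text \<open>
  A tiling is given by the matrix spanning its lattice, its vertex set and its edges; an edge is
  the arc in space that embeds it, so parallel edges are distinct arcs with the same end points and there are no loops.
\<close>

record ('n::finite) tiling =
  lattice_matrix :: "real ^ 'n ^ 'n"
  verts :: "(real ^ 'n) set"
  edges :: "(real ^ 'n) set set"

definition lattice :: "('n::finite) tiling \<Rightarrow> (real ^ 'n) set" where
  "lattice T = {lattice_matrix T *v z | z. \<forall>i. z $ i \<in> \<int>}"

definition joins :: "('n::finite) tiling \<Rightarrow> (real ^ 'n) set \<Rightarrow> real ^ 'n \<Rightarrow> real ^ 'n \<Rightarrow> bool" where
  "joins T e v w \<longleftrightarrow> e \<in> edges T \<and> v \<in> verts T \<and> w \<in> verts T \<and>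
     (\<exists>p. arc p \<and> path_image p = e \<and> pathstart p = v \<and> pathfinish p = w)"

definition incident :: "('n::finite) tiling \<Rightarrow> real ^ 'n \<Rightarrow> (real ^ 'n) set set" where
  "incident T v = {e. \<exists>w. joins T e v w}"

definition vdeg :: "('n::finite) tiling \<Rightarrow> real ^ 'n \<Rightarrow> nat" where
  "vdeg T v = card (incident T v)"

definition edge_mult :: "('n::finite) tiling \<Rightarrow> real ^ 'n \<Rightarrow> real ^ 'n \<Rightarrow> nat" where
  "edge_mult T v w = card {e. joins T e v w}"

definition embedded_graph :: "('n::finite) tiling \<Rightarrow> bool" where
  "embedded_graph T \<longleftrightarrow>
    (\<forall>e\<in>edges T. \<exists>v w. joins T e v w \<and> e \<inter> verts T = {v, w}) \<and>
    (\<forall>e\<in>edges T. \<forall>e'\<in>edges T. e \<noteq> e' \<longrightarrow> e \<inter> e' \<subseteq> verts T)"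

definition connected_graph :: "('n::finite) tiling \<Rightarrow> bool" where
  "connected_graph T \<longleftrightarrow>
    (\<forall>v\<in>verts T. \<forall>w\<in>verts T. (v, w) \<in> {(x, y). \<exists>e. joins T e x y}\<^sup>*)"

definition lattice_periodic :: "('n::finite) tiling \<Rightarrow> bool" where
  "lattice_periodic T \<longleftrightarrow>
    (\<forall>l\<in>lattice T. (+) l ` verts T = verts T \<and> (`) ((+) l) ` edges T = edges T)"

definition bounded_degree :: "('n::finite) tiling \<Rightarrow> bool" where
  "bounded_degree T \<longleftrightarrow>
    (\<exists>D. \<forall>v\<in>verts T. finite (incident T v) \<and> vdeg T v \<le> D)"

definition periodic_tiling :: "('n::finite) tiling \<Rightarrow> bool" where
  "periodic_tiling T \<longleftrightarrow>
    invertible (lattice_matrix T) \<and>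
    embedded_graph T \<and> connected_graph T \<and> lattice_periodic T \<and>
    finite (verts T // {(x, y). x \<in> verts T \<and> y \<in> verts T \<and> x - y \<in> lattice T}) \<and>
    bounded_degree T \<and>
    0 \<in> verts T"


section \<open>Functions on the vertex set\<close>

text \<open>
  Functions on the vertex set are elements of \<^term>\<open>extensional (verts T)\<close>, so that equality of
  such functions is equality on the vertices. All infinite sums over vertices are unconditional.
\<close>

definition laplacian :: "('n::finite) tiling \<Rightarrow> (real ^ 'n \<Rightarrow> real) \<Rightarrow> real ^ 'n \<Rightarrow> real" where
  "laplacian T f = (\<lambda>v\<in>verts T.
     real (vdeg T v) * f v - (\<Sum>\<^sub>\<infinity>w\<in>verts T. real (edge_mult T v w) * f w))"

definition l2_fun :: "('n::finite) tiling \<Rightarrow> (real ^ 'n \<Rightarrow> real) set" where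
  "l2_fun T = {f \<in> extensional (verts T). (\<lambda>x. (f x)\<^sup>2) summable_on verts T}"

definition harmonic_mod_1_l2 :: "('n::finite) tiling \<Rightarrow> (real ^ 'n \<Rightarrow> real) set" where
  "harmonic_mod_1_l2 T = {\<xi> \<in> l2_fun T. \<forall>v\<in>verts T. laplacian T \<xi> v \<in> \<int>}"


section \<open>Simple random walk\<close>

definition trans_prob :: "('n::finite) tiling \<Rightarrow> real ^ 'n \<Rightarrow> real ^ 'n \<Rightarrow> real" where
  "trans_prob T v w = real (edge_mult T v w) / real (vdeg T v)"

primrec trans_prob_n :: "('n::finite) tiling \<Rightarrow> nat \<Rightarrow> real ^ 'n \<Rightarrow> real ^ 'n \<Rightarrow> real" where
  "trans_prob_n T 0 v x = of_bool (v = x)"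
| "trans_prob_n T (Suc n) v x = (\<Sum>\<^sub>\<infinity>w\<in>verts T. trans_prob T v w * trans_prob_n T n w x)"

definition walk_step :: "('n::finite) tiling \<Rightarrow> real ^ 'n \<Rightarrow> (real ^ 'n) pmf" where
  "walk_step T v = embed_pmf (trans_prob T v)"

definition walk_kernel ::
    "('n::finite) tiling \<Rightarrow> real ^ 'n \<Rightarrow> nat \<Rightarrow> (nat \<Rightarrow> real ^ 'n) \<Rightarrow> (real ^ 'n) measure" where
  "walk_kernel T v n \<omega> =
     measure_pmf (if n = 0 then return_pmf v else walk_step T (\<omega> (n - 1)))"

lemma Ionescu_Tulcea_walk_kernel:
  "Ionescu_Tulcea (walk_kernel T v) (\<lambda>_. count_space UNIV)"
proof (rule Ionescu_Tulcea.intro)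
  fix i
  show "walk_kernel T v i \<in> measurable (PiM {0..<i} (\<lambda>_. count_space UNIV))
          (subprob_algebra (count_space UNIV))"
  proof (cases i)
    case 0
    then show ?thesis
      by (simp add: walk_kernel_def[abs_def] measure_pmf_in_subprob_algebra)
  next
    case (Suc k)
    have "(\<lambda>\<omega>. \<omega> k) \<in> measurable (PiM {0..<i} (\<lambda>_. count_space UNIV)) (count_space UNIV)"
      using Suc by (intro measurable_component_singleton) auto
    moreover have "(\<lambda>x. measure_pmf (walk_step T x)) \<in>
        measurable (count_space UNIV) (subprob_algebra (count_space UNIV))"
      by (auto simp: measure_pmf_in_subprob_algebra)
    ultimately have "(\<lambda>\<omega>. measure_pmf (walk_step T (\<omega> k))) \<in>
        measurable (PiM {0..<i} (\<lambda>_. count_space UNIV)) (subprob_algebra (count_space UNIV))"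
      by (rule measurable_compose)
    then show ?thesis
      using Suc by (simp add: walk_kernel_def[abs_def])
  qed
qed (auto simp: walk_kernel_def measure_pmf.prob_space_axioms)

text \<open>
  The path measure of the walk started at \<open>v\<close>; under it, the position at step \<open>n\<close> is the
  coordinate \<open>\<omega> n\<close>.
\<close>

definition walk :: "('n::finite) tiling \<Rightarrow> real ^ 'n \<Rightarrow> (nat \<Rightarrow> real ^ 'n) measure" where
  "walk T v = projective_family.lim UNIV
     (Ionescu_Tulcea.CI (walk_kernel T v) (\<lambda>_. count_space UNIV)) (\<lambda>_. count_space UNIV)"

text \<open>
  On a periodic tiling the walk returns to the lattice almost surely, so the value of
  the least-number operator on paths that never do so is irrelevant.
\<close>

definition return_time :: "('n::finite) tiling \<Rightarrow> (nat \<Rightarrow> real ^ 'n) \<Rightarrow> nat" where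
  "return_time T \<omega> = (LEAST n. 1 \<le> n \<and> \<omega> n \<in> lattice T)"

definition mean_return :: "('n::finite) tiling \<Rightarrow> real ^ 'n \<Rightarrow> real ^ 'n" where
  "mean_return T v = (\<integral>\<omega>. \<omega> (return_time T \<omega>) \<partial>walk T v)"


section \<open>Function classes\<close>

definition C0 :: "('n::finite) tiling \<Rightarrow> (real ^ 'n \<Rightarrow> int) set" where
  "C0 T = {f \<in> extensional (verts T). (\<lambda>x. \<bar>real_of_int (f x)\<bar>) summable_on verts T}"

definition C1 :: "('n::finite) tiling \<Rightarrow> (real ^ 'n \<Rightarrow> int) set" where
  "C1 T = {f \<in> C0 T. (\<Sum>\<^sub>\<infinity>x\<in>verts T. real_of_int (f x)) = 0}"

definition C2 :: "('n::finite) tiling \<Rightarrow> (real ^ 'n \<Rightarrow> int) set" where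
  "C2 T = {f \<in> C1 T. (\<Sum>\<^sub>\<infinity>x\<in>verts T. real_of_int (f x) *\<^sub>R mean_return T x) = 0}"


section \<open>Green's function\<close>

text \<open>
  The series are limits of ordered partial sums; in dimension 2 on a bipartite tiling the series
  converges only conditionally.
\<close>

definition green0 :: "('n::finite) tiling \<Rightarrow> real ^ 'n \<Rightarrow> real" where
  "green0 T x =
     (if CARD('n) = 2
      then (\<Sum>n. trans_prob_n T n 0 x / real (vdeg T x) - trans_prob_n T n 0 0 / real (vdeg T 0))
      else (\<Sum>n. trans_prob_n T n 0 x / real (vdeg T x)))"

definition green :: "('n::finite) tiling \<Rightarrow> real ^ 'n \<Rightarrow> real ^ 'n \<Rightarrow> real" where
  "green T v x =
     (if v \<in> lattice T then green0 T (x - v)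
      else 1 / real (vdeg T x) *
             (\<integral>\<omega>. (\<Sum>j<return_time T \<omega>. of_bool (\<omega> j = x)) \<partial>walk T v)
           + (\<integral>\<omega>. green0 T (x - \<omega> (return_time T \<omega>)) \<partial>walk T v))"

definition green_conv :: "('n::finite) tiling \<Rightarrow> (real ^ 'n \<Rightarrow> real) \<Rightarrow> real ^ 'n \<Rightarrow> real" where
  "green_conv T f = (\<lambda>x\<in>verts T. \<Sum>\<^sub>\<infinity>v\<in>verts T. f v * green T v x)"

end

theory Submission
  imports Defs "HOL-Library.Function_Algebras"
begin

text \<open>
  Write \<open>P\<close> for averaging over the neighbours of a vertex (\<open>avg\<close>), so that
  \<open>\<Delta> u = deg (u - P u)\<close>, and put \<open>f = \<eta> / deg\<close>. Everything is read off the partial sums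
  \<open>S_N f = (\<Sum>n<N. P^n f)\<close> (\<open>green_sum\<close>).

  \<^bold>\<open>Green's function.\<close> For all vertices \<open>v\<close>, on the lattice or off it, \<open>g_v(x)\<close> is the sum over \<open>n\<close>
  of \<open>P^n(v,x) / deg x - c_n\<close>, where \<open>c_n = P^n(0,0) / deg 0\<close> in dimension 2 and \<open>c_n = 0\<close> otherwise
  (\<open>green_eq\<close>). On the lattice this is the definition. Off the lattice, the series as a function of \<open>v\<close>
  is Lipschitz along edges and differs from its average by the point mass at \<open>x\<close>, so that stopping it
  at the return time (\<open>optional_stopping\<close>) gives the defining formula of \<open>g_v\<close>. Hence
  \<open>\<Delta> g_\<eta> = \<eta>\<close>, and \<open>g_\<eta>\<close> is the limit of \<open>S_N f - (\<Sum>\<eta>) (\<Sum>n<N. c_n)\<close> (\<open>green_conv_lim\<close>).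

  \<^bold>\<open>Necessity.\<close> Let \<open>\<xi>\<close> be square summable with \<open>\<Delta> \<xi> = \<eta>\<close> of finite support. The mean return
  position \<open>h(v) = E[Y_{v,T}]\<close> is harmonic and stays at bounded distance from \<open>v\<close>
  (\<open>mean_return_coordinates\<close>). A cutoff \<open>\<phi>_R\<close> at radius \<open>R\<close> in the coordinates \<open>h\<close> has
  \<open>\<Delta> \<phi>_R = O(R^-2)\<close> and \<open>\<Delta> (h_i \<phi>_R) = O(R^-1)\<close> on about \<open>R^d\<close> vertices. These
  Laplacians are bounded in square norm for \<open>d \<le> 4\<close> and \<open>d = 2\<close> respectively and tend to 0 pointwise,
  so their pairings with \<open>\<xi>\<close> tend to 0, while these pairings are \<open>\<Sum> \<phi>_R \<eta>\<close> and
  \<open>\<Sum> h_i \<phi>_R \<eta>\<close> (\<open>l2_laplacian_sum_zero\<close>, \<open>l2_laplacian_moment_zero\<close>). So \<open>\<eta>\<close> has the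
  vanishing moments required of \<open>C^j\<close>. Moreover \<open>S_N f = \<xi> - P^N \<xi>\<close> and \<open>P^N \<xi>\<close> tends to 0, which
  gives \<open>\<xi> = g_\<eta>\<close> (\<open>l2_integer_laplacian\<close>); finiteness of the support of an integral \<open>\<Delta> \<xi>\<close> is
  automatic.

  \<^bold>\<open>Sufficiency.\<close> It is enough that \<open>S_N f\<close> converges in square norm. Averaging over boxes gives a
  Nash inequality, hence \<open>|P^k \<delta>| = O(k^{-d/4})\<close> (\<open>heat_kernel_bound\<close>). The energy
  \<open>|u|^2 - |P u|^2\<close> of \<open>u = P^{2k} f\<close> is at most \<open>|P^k f|^2 / k\<close>, and it controls the differences of
  \<open>u\<close> along doubled lattice vectors; so each such difference improves the decay by a factor
  \<open>k^{-1/2}\<close> (\<open>decays_sdiff\<close>). For a \<open>j\<close>-fold difference of a point mass the exponent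
  \<open>d/4 + j/2\<close> exceeds 1 in each case of the theorem. Finally, by linear duality, every \<open>f\<close> whose moments
  of order below \<open>j\<close> vanish is a combination of such differences and of Laplacians of point masses, for
  which \<open>S_N\<close> telescopes (\<open>span_zero_sum\<close>, \<open>span_zero_moments\<close>).
\<close>


section \<open>Periodic networks\<close>

text \<open>
  Only the multiplicity function of a tiling matters, so the analysis is done for a symmetric weight
  \<open>c\<close> with finite range, invariant under the lattice \<open>Lat\<close>. The lower bound 1 on nonzero weights and the
  finite set of orbit representatives give uniformity of all constants.
\<close>

locale periodic_network =
  fixes V :: "(real ^ 'n::finite) set"
    and c :: "real ^ 'n \<Rightarrow> real ^ 'n \<Rightarrow> real"
    and M :: "real ^ 'n ^ 'n"
    and Lat :: "(real ^ 'n) set"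
  assumes Lat_eq: "Lat = {M *v z | z. \<forall>i. z $ i \<in> \<int>}"
    and invertible_M: "invertible M"
    and c_ge_1: "c x y \<noteq> 0 \<Longrightarrow> 1 \<le> c x y"
    and c_vertices: "c x y \<noteq> 0 \<Longrightarrow> x \<in> V"
    and c_sym: "c x y = c y x"
    and finite_c: "finite {y. c x y \<noteq> 0}"
    and V_shift: "l \<in> Lat \<Longrightarrow> x \<in> V \<Longrightarrow> x + l \<in> V"
    and c_shift: "l \<in> Lat \<Longrightarrow> c (x + l) (y + l) = c x y"
    and cover: "\<exists>F. finite F \<and> F \<subseteq> V \<and> (\<forall>x\<in>V. \<exists>y\<in>F. x - y \<in> Lat)"
    and connected: "x \<in> V \<Longrightarrow> y \<in> V \<Longrightarrow> (x, y) \<in> {(x, y). c x y \<noteq> 0}\<^sup>*"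
    and zero_V: "0 \<in> V"
begin

lemma Lat_0 [simp]: "0 \<in> Lat"
  unfolding Lat_eq by (auto intro!: exI[of _ 0])

lemma Lat_add: "l \<in> Lat \<Longrightarrow> m \<in> Lat \<Longrightarrow> l + m \<in> Lat"
proof -
  assume "l \<in> Lat" "m \<in> Lat"
  then obtain y z where "l = M *v y" "m = M *v z" "\<forall>i. y $ i \<in> \<int>" "\<forall>i. z $ i \<in> \<int>"
    unfolding Lat_eq by auto
  then have "l + m = M *v (y + z)" "\<forall>i. (y + z) $ i \<in> \<int>"
    by (auto simp: matrix_vector_right_distrib)
  then show ?thesis unfolding Lat_eq by blast
qed

lemma Lat_uminus: "l \<in> Lat \<Longrightarrow> - l \<in> Lat"
proof -
  assume "l \<in> Lat"
  then obtain y where "l = M *v y" "\<forall>i. y $ i \<in> \<int>"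
    unfolding Lat_eq by auto
  then have "- l = M *v (- y)" "\<forall>i. (- y) $ i \<in> \<int>"
    using matrix_vector_mult_scaleR[of M "-1" y] by (auto simp: scaleR_minus1_left)
  then show ?thesis unfolding Lat_eq by blast
qed

lemma Lat_diff: "l \<in> Lat \<Longrightarrow> m \<in> Lat \<Longrightarrow> l - m \<in> Lat"
  using Lat_add[of l "- m"] Lat_uminus[of m] by simp

lemma Lat_sum: "(\<And>i. i \<in> A \<Longrightarrow> f i \<in> Lat) \<Longrightarrow> sum f A \<in> Lat"
  by (induction A rule: infinite_finite_induct) (auto intro: Lat_add)

lemma Lat_of_nat: "l \<in> Lat \<Longrightarrow> of_nat k *\<^sub>R l \<in> Lat"
  by (induction k) (auto simp: scaleR_add_left intro: Lat_add)

lemma M_inj: "M *v x = M *v y \<Longrightarrow> x = y"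
  using invertible_M by (metis inj_matrix_vector_mult injD)

lemma c_vertices': "c x y \<noteq> 0 \<Longrightarrow> y \<in> V"
  using c_vertices[of y x] c_sym[of x y] by simp

lemma c_nonneg: "0 \<le> c x y"
  using c_ge_1[of x y] by fastforce

lemma Lat_subset_V: "Lat \<subseteq> V"
  using V_shift[OF _ zero_V] by auto

definition nb :: "real ^ 'n \<Rightarrow> (real ^ 'n) set" where
  "nb x = {y. c x y \<noteq> 0}"

definition deg :: "real ^ 'n \<Rightarrow> real" where
  "deg x = (\<Sum>y\<in>nb x. c x y)"

text \<open>
  Outside \<open>V\<close> there are no neighbours and the degree is 0, so an average there is 0.
\<close>

definition avg :: "(real ^ 'n \<Rightarrow> real) \<Rightarrow> real ^ 'n \<Rightarrow> real" where
  "avg u x = (\<Sum>y\<in>nb x. c x y * u y) / deg x"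

lemma finite_nb [simp]: "finite (nb x)"
  using finite_c by (simp add: nb_def)

lemma nb_V: "y \<in> nb x \<Longrightarrow> y \<in> V"
  using c_vertices' by (auto simp: nb_def)

lemma nb_sym: "y \<in> nb x \<longleftrightarrow> x \<in> nb y"
  using c_sym by (auto simp: nb_def)

text \<open>
  The lattice supplies a second vertex, which connectedness links to \<open>x\<close>.
\<close>

lemma nb_nonempty: assumes "x \<in> V" shows "nb x \<noteq> {}"
proof -
  obtain i :: 'n where True by simp
  have "axis i (1::real) \<noteq> 0" by (simp add: axis_eq_0_iff)
  then have ne: "M *v axis i 1 \<noteq> 0" using M_inj[of "axis i 1" 0] by auto
  have "M *v axis i 1 \<in> Lat" unfolding Lat_eq by (auto intro!: exI[of _ "axis i 1"] simp: axis_def)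
  then have "x + M *v axis i 1 \<in> V" using V_shift assms by blast
  then have "(x, x + M *v axis i 1) \<in> {(x, y). c x y \<noteq> 0}\<^sup>*" using connected assms by blast
  then show ?thesis using ne by (cases rule: converse_rtranclE) (auto simp: nb_def)
qed

lemma nb_outside: "x \<notin> V \<Longrightarrow> nb x = {}"
  using c_vertices by (auto simp: nb_def)

lemma deg_outside: "x \<notin> V \<Longrightarrow> deg x = 0"
  by (simp add: deg_def nb_outside)

lemma avg_outside: "x \<notin> V \<Longrightarrow> avg u x = 0"
  by (simp add: avg_def nb_outside)

lemma deg_ge_1: assumes "x \<in> V" shows "1 \<le> deg x"
proof -
  obtain y where y: "y \<in> nb x" using nb_nonempty[OF assms] by auto
  then have "1 \<le> c x y" using c_ge_1 by (auto simp: nb_def)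
  also have "\<dots> \<le> deg x" unfolding deg_def
    using y by (intro member_le_sum) (auto simp: c_nonneg)
  finally show ?thesis .
qed

lemma deg_nonneg: "0 \<le> deg x"
  unfolding deg_def by (intro sum_nonneg) (simp add: c_nonneg)

lemma deg_pos: "x \<in> V \<Longrightarrow> 0 < deg x"
  using deg_ge_1[of x] by simp

lemma nb_shift: assumes "l \<in> Lat" shows "nb (x + l) = (\<lambda>y. y + l) ` nb x"
proof -
  have "y \<in> nb (x + l) \<longleftrightarrow> y - l \<in> nb x" for y
    using c_shift[OF assms, of x "y - l"] by (simp add: nb_def)
  then show ?thesis by (force simp: image_iff)
qed

lemma sum_nb_shift: assumes "l \<in> Lat"
  shows "(\<Sum>y\<in>nb (x + l). c (x + l) y * g y) = (\<Sum>y\<in>nb x. c x y * g (y + l))"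
  unfolding nb_shift[OF assms] using c_shift[OF assms]
  by (subst sum.reindex) (auto simp: inj_on_def)

lemma deg_shift: "l \<in> Lat \<Longrightarrow> deg (x + l) = deg x"
  unfolding deg_def using sum_nb_shift[of l x "\<lambda>_. 1"] by simp

lemma avg_shift: "l \<in> Lat \<Longrightarrow> avg u (x + l) = avg (\<lambda>y. u (y + l)) x"
  unfolding avg_def by (simp add: sum_nb_shift deg_shift)

lemma sum_nb_eq: "finite A \<Longrightarrow> nb x \<inter> {y. g y \<noteq> 0} \<subseteq> A \<Longrightarrow> (\<Sum>y\<in>nb x. c x y * g y) = (\<Sum>y\<in>A. c x y * g y)"
  using finite_nb[of x] by (intro sum.mono_neutral_cong) (auto simp: nb_def simp del: finite_nb)

lemma deg_avg: "deg x * avg u x = (\<Sum>y\<in>nb x. c x y * u y)"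
  by (cases "x \<in> V") (auto simp: avg_def deg_pos nb_outside deg_outside dest: deg_pos)

lemma avg_add: "avg (\<lambda>x. u x + v x) = (\<lambda>x. avg u x + avg v x)"
  by (simp add: avg_def fun_eq_iff sum.distrib distrib_left add_divide_distrib)

lemma avg_scale: "avg (\<lambda>x. a * u x) = (\<lambda>x. a * avg u x)"
  by (simp add: avg_def fun_eq_iff sum_distrib_left mult_ac)

lemma avg_diff: "avg (\<lambda>x. u x - v x) = (\<lambda>x. avg u x - avg v x)"
  by (simp add: avg_def fun_eq_iff sum_subtractf right_diff_distrib diff_divide_distrib)

lemma avg_const: "x \<in> V \<Longrightarrow> avg (\<lambda>_. a) x = a"
  using deg_pos[of x] by (simp add: avg_def sum_distrib_right[symmetric] deg_def[symmetric])

lemma avg_cong: "(\<And>y. y \<in> V \<Longrightarrow> u y = v y) \<Longrightarrow> avg u = avg v"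
  by (auto simp: avg_def fun_eq_iff nb_V intro!: arg_cong2[of _ _ _ _ "(/)"] sum.cong)

lemma avg_abs_le: "\<bar>avg u x\<bar> \<le> avg (\<lambda>y. \<bar>u y\<bar>) x"
  unfolding avg_def using sum_abs[of "\<lambda>y. c x y * u y" "nb x"] deg_nonneg[of x]
  by (simp add: abs_mult c_nonneg divide_right_mono)

lemma avg_mono: "(\<And>y. y \<in> nb x \<Longrightarrow> u y \<le> v y) \<Longrightarrow> avg u x \<le> avg v x"
  unfolding avg_def by (intro divide_right_mono sum_mono mult_left_mono) (auto simp: c_nonneg deg_nonneg)

lemma avg_abs_bound: assumes "\<And>y. y \<in> V \<Longrightarrow> \<bar>u y\<bar> \<le> B" "x \<in> V" shows "\<bar>avg u x\<bar> \<le> B"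
  using avg_abs_le[of u x] avg_mono[of x "\<lambda>y. \<bar>u y\<bar>" "\<lambda>_. B"] avg_const[OF assms(2), of B] assms(1) nb_V
  by force

section \<open>Finitely supported functions and the degree-weighted inner product\<close>

definition supp :: "(real ^ 'n \<Rightarrow> real) \<Rightarrow> (real ^ 'n) set" where
  "supp u = {x. u x \<noteq> 0}"

definition fs :: "(real ^ 'n \<Rightarrow> real) \<Rightarrow> bool" where
  "fs u \<longleftrightarrow> finite (supp u) \<and> supp u \<subseteq> V"

text \<open>
  The sum runs over the support of the first argument only, so that the second one may be arbitrary;
  \<open>avg\<close> is self-adjoint in this asymmetric sense (\<open>ip_avg\<close>).
\<close>

definition ip :: "(real ^ 'n \<Rightarrow> real) \<Rightarrow> (real ^ 'n \<Rightarrow> real) \<Rightarrow> real" where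
  "ip u v = (\<Sum>x\<in>supp u. deg x * u x * v x)"

definition nrm :: "(real ^ 'n \<Rightarrow> real) \<Rightarrow> real" where
  "nrm u = sqrt (ip u u)"

lemma ip_eq: "finite A \<Longrightarrow> supp u \<subseteq> A \<Longrightarrow> ip u v = (\<Sum>x\<in>A. deg x * u x * v x)"
  unfolding ip_def by (intro sum.mono_neutral_left) (auto simp: supp_def)

lemma supp_avg: "supp (avg u) \<subseteq> (\<Union>y\<in>supp u. nb y)"
proof
  fix x assume "x \<in> supp (avg u)"
  then have "(\<Sum>y\<in>nb x. c x y * u y) \<noteq> 0" by (auto simp: supp_def avg_def)
  then obtain y where "y \<in> nb x" "u y \<noteq> 0" by (metis (mono_tags, lifting) sum.not_neutral_contains_not_neutral mult_zero_right)
  then show "x \<in> (\<Union>y\<in>supp u. nb y)" using nb_sym by (auto simp: supp_def)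
qed

lemma fs_avg [intro]: "fs u \<Longrightarrow> fs (avg u)"
  using finite_subset[OF supp_avg[of u]] supp_avg[of u] nb_V unfolding fs_def by auto

lemma fs_avg_pow [intro]: "fs u \<Longrightarrow> fs ((avg ^^ k) u)"
  by (induction k) auto

lemma fs_add [intro]: "fs u \<Longrightarrow> fs v \<Longrightarrow> fs (\<lambda>x. u x + v x)"
  unfolding fs_def by (rule conjI[OF finite_subset[of _ "supp u \<union> supp v"]]) (auto simp: supp_def, force?)

lemma fs_diff [intro]: "fs u \<Longrightarrow> fs v \<Longrightarrow> fs (\<lambda>x. u x - v x)"
  unfolding fs_def by (rule conjI[OF finite_subset[of _ "supp u \<union> supp v"]]) (auto simp: supp_def, force?)

lemma fs_scale [intro]: "fs u \<Longrightarrow> fs (\<lambda>x. a * u x)"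
  unfolding fs_def by (rule conjI[OF finite_subset[of _ "supp u"]]) (auto simp: supp_def)

lemma fs_zero [simp]: "fs (\<lambda>_. 0)" by (simp add: fs_def supp_def)

lemma supp_shift: "supp (\<lambda>x. u (x + l)) = (\<lambda>x. x - l) ` supp u"
  by (force simp: supp_def image_iff)

lemma fs_shift [intro]: "l \<in> Lat \<Longrightarrow> fs u \<Longrightarrow> fs (\<lambda>x. u (x + l))"
  unfolding fs_def supp_shift using V_shift[of "- l"] Lat_uminus by auto

lemma fs_mult: "fs u \<Longrightarrow> fs (\<lambda>x. u x * v x)"
  unfolding fs_def by (rule conjI[OF finite_subset[of _ "supp u"]]) (auto simp: supp_def)

lemma ip_commute: assumes "fs u" "fs v" shows "ip u v = ip v u"
  using assms ip_eq[of "supp u \<union> supp v" u v] ip_eq[of "supp u \<union> supp v" v u]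
  by (simp add: fs_def mult_ac)

lemma ip_add_right: "ip u (\<lambda>x. v x + w x) = ip u v + ip u w"
  by (simp add: ip_def sum.distrib distrib_left)

lemma ip_diff_right: "ip u (\<lambda>x. v x - w x) = ip u v - ip u w"
  by (simp add: ip_def sum_subtractf right_diff_distrib)

lemma ip_scale_right: "ip u (\<lambda>x. a * v x) = a * ip u v"
  by (simp add: ip_def sum_distrib_left mult_ac)

lemma ip_diff_left: assumes "fs u" "fs v" shows "ip (\<lambda>x. u x - v x) w = ip u w - ip v w"
  using assms ip_eq[of "supp u \<union> supp v" u w] ip_eq[of "supp u \<union> supp v" v w]
    ip_eq[of "supp u \<union> supp v" "\<lambda>x. u x - v x" w]
  by (force simp: fs_def supp_def sum_subtractf algebra_simps)

lemma ip_scale_left: assumes "fs u" shows "ip (\<lambda>x. a * u x) w = a * ip u w"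
  using assms ip_eq[of "supp u" "\<lambda>x. a * u x" w]
  by (force simp: ip_def fs_def supp_def sum_distrib_left mult_ac)

lemma ip_cong: "(\<And>x. x \<in> supp u \<Longrightarrow> v x = w x) \<Longrightarrow> ip u v = ip u w"
  by (simp add: ip_def)

lemma ip_nonneg: "0 \<le> ip u u"
  unfolding ip_def by (intro sum_nonneg) (simp add: mult.assoc deg_nonneg)

lemma nrm_sq: "(nrm u)\<^sup>2 = ip u u" by (simp add: nrm_def ip_nonneg)

lemma nrm_nonneg [simp]: "0 \<le> nrm u" by (simp add: nrm_def ip_nonneg)

text \<open>
  Both sides are the sum of \<open>c x y * u y * v x\<close> over all edges.
\<close>

lemma ip_avg: assumes "fs u" shows "ip (avg u) v = ip u (avg v)"
proof -
  define B where "B = supp u"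
  define A where "A = (\<Union>y\<in>B. nb y)"
  have fin: "finite A" "finite B" using assms by (auto simp: A_def B_def fs_def)
  have "ip (avg u) v = (\<Sum>x\<in>A. (deg x * avg u x) * v x)"
    using ip_eq[of A "avg u" v] fin supp_avg[of u] by (simp add: A_def B_def)
  also have "\<dots> = (\<Sum>x\<in>A. (\<Sum>y\<in>B. c x y * u y) * v x)"
    unfolding deg_avg using fin by (intro sum.cong refl arg_cong2[of _ _ _ _ "(*)"] sum_nb_eq) (auto simp: B_def supp_def)
  also have "\<dots> = (\<Sum>y\<in>B. \<Sum>x\<in>A. c x y * u y * v x)"
    unfolding sum_distrib_right by (rule sum.swap)
  also have "\<dots> = (\<Sum>y\<in>B. u y * (\<Sum>x\<in>A. c y x * v x))"
    by (simp add: sum_distrib_left mult_ac c_sym)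
  also have "\<dots> = (\<Sum>y\<in>B. u y * (\<Sum>x\<in>nb y. c y x * v x))"
    using fin by (intro sum.cong refl arg_cong2[of _ _ _ _ "(*)"] sum_nb_eq[symmetric]) (auto simp: A_def)
  also have "\<dots> = ip u (avg v)"
    unfolding ip_def deg_avg[symmetric] B_def by (simp add: mult_ac)
  finally show ?thesis .
qed

lemma ip_avg_pow: "fs u \<Longrightarrow> ip ((avg ^^ k) u) v = ip u ((avg ^^ k) v)"
proof (induction k arbitrary: v)
  case (Suc k)
  have "ip ((avg ^^ Suc k) u) v = ip ((avg ^^ k) u) (avg v)"
    using ip_avg[of "(avg ^^ k) u" v] Suc by auto
  also have "\<dots> = ip u ((avg ^^ k) (avg v))" using Suc by blast
  finally show ?case by (simp add: funpow_swap1)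
qed simp

lemma ip_L2: assumes "finite A" "supp u \<subseteq> A"
  shows "nrm u = L2_set (\<lambda>x. sqrt (deg x) * u x) A"
  unfolding nrm_def ip_eq[OF assms] L2_set_def
  by (simp add: power_mult_distrib deg_nonneg) (simp add: power2_eq_square mult.assoc)

lemma ip_le_L2: assumes "finite A" "supp u \<subseteq> A"
  shows "\<bar>ip u v\<bar> \<le> nrm u * L2_set (\<lambda>x. sqrt (deg x) * v x) A"
proof -
  have "\<bar>ip u v\<bar> = \<bar>\<Sum>x\<in>A. (sqrt (deg x) * u x) * (sqrt (deg x) * v x)\<bar>"
    unfolding ip_eq[OF assms] by (intro arg_cong[of _ _ abs] sum.cong refl)
      (use deg_nonneg in \<open>simp add: mult.assoc mult.left_commute\<close>)
  also have "\<dots> \<le> (\<Sum>x\<in>A. \<bar>sqrt (deg x) * u x\<bar> * \<bar>sqrt (deg x) * v x\<bar>)"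
    by (rule order_trans[OF sum_abs]) (simp add: abs_mult)
  also have "\<dots> \<le> nrm u * L2_set (\<lambda>x. sqrt (deg x) * v x) A"
    unfolding ip_L2[OF assms] by (rule L2_set_mult_ineq)
  finally show ?thesis .
qed

lemma ip_le_nrm: assumes "fs u" "fs v" shows "\<bar>ip u v\<bar> \<le> nrm u * nrm v"
  using assms ip_le_L2[of "supp u \<union> supp v" u v] ip_L2[of "supp u \<union> supp v" v]
  by (auto simp: fs_def)

lemma nrm_triangle: assumes "fs u" "fs v" shows "nrm (\<lambda>x. u x + v x) \<le> nrm u + nrm v"
proof -
  let ?A = "supp u \<union> supp v"
  have "finite ?A" using assms by (simp add: fs_def)
  moreover have "supp (\<lambda>x. u x + v x) \<subseteq> ?A" by (auto simp: supp_def)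
  ultimately show ?thesis
    using ip_L2[of ?A "\<lambda>x. u x + v x"] ip_L2[of ?A u] ip_L2[of ?A v]
      L2_set_triangle_ineq[of "\<lambda>x. sqrt (deg x) * u x" "\<lambda>x. sqrt (deg x) * v x" ?A]
    by (simp add: distrib_left)
qed

lemma nrm_shift: assumes "l \<in> Lat" shows "nrm (\<lambda>x. u (x + l)) = nrm u"
proof -
  have "ip (\<lambda>x. u (x + l)) (\<lambda>x. u (x + l)) = ip u u"
    unfolding ip_def supp_shift
    using deg_shift[OF assms, of "_ - l"] by (subst sum.reindex) (auto simp: inj_on_def)
  then show ?thesis by (simp add: nrm_def)
qed

text \<open>
  The factor \<open>1 / deg y\<close> makes \<open>pmass y\<close> represent evaluation at \<open>y\<close> (\<open>ip_pmass\<close>), so that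
  \<open>(avg ^^ n) (pmass y)\<close> is the heat kernel in its symmetric normalisation.
\<close>

definition pmass :: "real ^ 'n \<Rightarrow> real ^ 'n \<Rightarrow> real" where
  "pmass y x = (if x = y then 1 / deg y else 0)"

lemma supp_pmass: "supp (pmass y) \<subseteq> {y}" by (auto simp: supp_def pmass_def)

lemma fs_pmass [intro]: "y \<in> V \<Longrightarrow> fs (pmass y)"
  unfolding fs_def using supp_pmass[of y] finite_subset by blast

lemma ip_pmass: "y \<in> V \<Longrightarrow> ip (pmass y) v = v y"
  using ip_eq[of "{y}" "pmass y" v] supp_pmass[of y] deg_pos[of y] by (simp add: pmass_def)

lemma nrm_pmass_le: "y \<in> V \<Longrightarrow> nrm (pmass y) \<le> 1"
  using deg_ge_1[of y] by (simp add: nrm_def ip_pmass) (simp add: pmass_def)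

lemma pmass_shift: "l \<in> Lat \<Longrightarrow> pmass y (x + l) = pmass (y - l) x"
  using deg_shift[of l "y - l"] by (auto simp: pmass_def)

lemma avg_pow_shift: "l \<in> Lat \<Longrightarrow> (avg ^^ k) u (x + l) = (avg ^^ k) (\<lambda>y. u (y + l)) x"
proof (induction k arbitrary: x)
  case (Suc k)
  then have "(\<lambda>y. (avg ^^ k) u (y + l)) = (avg ^^ k) (\<lambda>y. u (y + l))" by auto
  then show ?case using avg_shift[OF \<open>l \<in> Lat\<close>, of "(avg ^^ k) u" x] by simp
qed simp

lemma avg_pow_add: "(avg ^^ k) (\<lambda>x. u x + v x) = (\<lambda>x. (avg ^^ k) u x + (avg ^^ k) v x)"
  by (induction k) (simp_all add: avg_add)
lemma avg_pow_diff: "(avg ^^ k) (\<lambda>x. u x - v x) = (\<lambda>x. (avg ^^ k) u x - (avg ^^ k) v x)"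
  by (induction k) (simp_all add: avg_diff)
lemma avg_pow_scale: "(avg ^^ k) (\<lambda>x. a * u x) = (\<lambda>x. a * (avg ^^ k) u x)"
  by (induction k) (simp_all add: avg_scale)

lemma avg_pow_abs_bound: assumes "\<And>y. y \<in> V \<Longrightarrow> \<bar>u y\<bar> \<le> B" "x \<in> V" shows "\<bar>(avg ^^ k) u x\<bar> \<le> B"
  using assms(2) by (induction k arbitrary: x) (auto intro!: avg_abs_bound assms(1))


section \<open>The two-step energy and lattice differences\<close>

text \<open>
  The Dirichlet form of two steps of the walk. With \<open>P\<^sup>2\<close> in place of \<open>P\<close> the spectrum is
  nonnegative, so that bipartite networks need no separate treatment.
\<close>

definition energy :: "(real ^ 'n \<Rightarrow> real) \<Rightarrow> real" where
  "energy u = ip u u - ip (avg u) (avg u)"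

text \<open>
  Expanding the square, the cross term and the last term combine to \<open>- deg x * (avg u x)\<^sup>2\<close>, and the first
  term sums to \<open>ip u u\<close>: the energy is the total variance of \<open>u\<close> under one step of the walk.
\<close>

lemma energy_eq:
  assumes "fs u" "finite A" "(\<Union>y\<in>supp u. nb y) \<subseteq> A"
  shows "energy u = (\<Sum>x\<in>A. \<Sum>y\<in>nb x. c x y * (u y - avg u x)\<^sup>2)"
proof -
  have sub: "supp (avg u) \<subseteq> A" using supp_avg assms(3) by blast
  have B: "finite (supp u)" using assms(1) by (simp add: fs_def)
  have "(\<Sum>x\<in>A. \<Sum>y\<in>nb x. c x y * (u y)\<^sup>2) = (\<Sum>x\<in>A. \<Sum>y\<in>supp u. c x y * (u y)\<^sup>2)"
    by (intro sum.cong refl sum_nb_eq) (use B in \<open>auto simp: supp_def\<close>)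
  also have "\<dots> = (\<Sum>y\<in>supp u. (u y)\<^sup>2 * (\<Sum>x\<in>A. c y x * 1))"
  proof -
    have "c x y * (u y)\<^sup>2 = (u y)\<^sup>2 * (c y x * 1)" for x y using c_sym[of x y] by simp
    then show ?thesis unfolding sum_distrib_left by (subst sum.swap) (simp only:)
  qed
  also have "\<dots> = (\<Sum>y\<in>supp u. (u y)\<^sup>2 * (\<Sum>x\<in>nb y. c y x * 1))"
    using assms by (intro sum.cong refl arg_cong2[of _ _ _ _ "(*)"] sum_nb_eq[symmetric]) auto
  also have "\<dots> = ip u u"
    by (simp add: ip_def deg_def[symmetric] power2_eq_square mult_ac)
  finally have 1: "(\<Sum>x\<in>A. \<Sum>y\<in>nb x. c x y * (u y)\<^sup>2) = ip u u" .
  have "(\<Sum>y\<in>nb x. c x y * (u y - avg u x)\<^sup>2)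
      = (\<Sum>y\<in>nb x. c x y * (u y)\<^sup>2) - deg x * avg u x * avg u x" for x
  proof -
    have "(\<Sum>y\<in>nb x. c x y * (u y - avg u x)\<^sup>2)
      = (\<Sum>y\<in>nb x. c x y * (u y)\<^sup>2) - 2 * avg u x * (\<Sum>y\<in>nb x. c x y * u y) + (avg u x)\<^sup>2 * deg x"
      unfolding sum_distrib_left deg_def sum_subtractf[symmetric] sum.distrib[symmetric]
      by (intro sum.cong refl) (simp add: power2_eq_square algebra_simps)
    then show ?thesis unfolding deg_avg[symmetric] by (simp add: power2_eq_square algebra_simps)
  qed
  then have "(\<Sum>x\<in>A. \<Sum>y\<in>nb x. c x y * (u y - avg u x)\<^sup>2) = ip u u - ip (avg u) (avg u)"
    using 1 ip_eq[OF assms(2) sub, of "avg u"] by (simp add: sum_subtractf)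
  then show ?thesis by (simp add: energy_def)
qed

lemma energy_nonneg: assumes "fs u" shows "0 \<le> energy u"
proof -
  have "finite (\<Union>y\<in>supp u. nb y)" using assms by (auto simp: fs_def)
  then show ?thesis using energy_eq[OF assms, of "\<Union>y\<in>supp u. nb y"]
    by (auto intro!: sum_nonneg simp: c_nonneg)
qed

text \<open>
  The terms on the left are among those of \<open>energy_eq\<close>, because nonzero weights are at least 1.
\<close>

lemma energy_edges:
  assumes u: "fs u" and xy: "c x y \<noteq> 0" and Q: "finite Q" "Q \<subseteq> Lat"
  shows "(\<Sum>l\<in>Q. (u (y + l) - avg u (x + l))\<^sup>2) \<le> energy u"
proof -
  define A where "A = (\<Union>z\<in>supp u. nb z) \<union> (\<lambda>l. x + l) ` Q"
  have A: "finite A" using u Q by (auto simp: A_def fs_def)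
  have "(\<Sum>l\<in>Q. (u (y + l) - avg u (x + l))\<^sup>2) \<le> (\<Sum>l\<in>Q. \<Sum>z\<in>nb (x + l). c (x + l) z * (u z - avg u (x + l))\<^sup>2)"
  proof (intro sum_mono)
    fix l assume "l \<in> Q"
    then have l: "c (x + l) (y + l) = c x y" using c_shift Q by auto
    have "(u (y + l) - avg u (x + l))\<^sup>2 \<le> c (x + l) (y + l) * (u (y + l) - avg u (x + l))\<^sup>2"
      using c_ge_1[OF xy] l by (simp add: mult_le_cancel_right1)
    also have "\<dots> \<le> (\<Sum>z\<in>nb (x + l). c (x + l) z * (u z - avg u (x + l))\<^sup>2)"
      using xy l by (intro member_le_sum[of _ _ "\<lambda>z. c (x + l) z * (u z - avg u (x + l))\<^sup>2"]) (auto simp: c_nonneg nb_def finite_c)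
    finally show "(u (y + l) - avg u (x + l))\<^sup>2 \<le> (\<Sum>z\<in>nb (x + l). c (x + l) z * (u z - avg u (x + l))\<^sup>2)" .
  qed
  also have "\<dots> = (\<Sum>w\<in>(\<lambda>l. x + l) ` Q. \<Sum>z\<in>nb w. c w z * (u z - avg u w)\<^sup>2)"
    by (subst sum.reindex) (auto simp: inj_on_def)
  also have "\<dots> \<le> (\<Sum>w\<in>A. \<Sum>z\<in>nb w. c w z * (u z - avg u w)\<^sup>2)"
    using A by (intro sum_mono2) (auto simp: A_def intro!: sum_nonneg simp: c_nonneg)
  also have "\<dots> = energy u"
    using energy_eq[OF u A] by (auto simp: A_def)
  finally show ?thesis .
qed

text \<open>
  Along a walk the comparison alternates between values of \<open>u\<close> and of \<open>avg u\<close>: each edge relates one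
  to the other, at the cost of one copy of the energy. After an even number of steps \<open>u\<close> is compared with
  itself.
\<close>

lemma energy_walk:
  assumes "(y, z) \<in> {(x, y). c x y \<noteq> 0} ^^ n"
  shows "\<exists>C. \<forall>u Q. fs u \<longrightarrow> finite Q \<longrightarrow> Q \<subseteq> Lat \<longrightarrow>
    (\<Sum>l\<in>Q. (u (y + l) - (if even n then u else avg u) (z + l))\<^sup>2) \<le> C * energy u"
  using assms
proof (induction n arbitrary: z)
  case 0
  then show ?case by (auto intro!: exI[of _ 0])
next
  case (Suc n)
  then obtain x where x: "(y, x) \<in> {(x, y). c x y \<noteq> 0} ^^ n" "c x z \<noteq> 0" by auto
  from Suc.IH[OF x(1)] obtain C where C: "\<And>u Q. fs u \<Longrightarrow> finite Q \<Longrightarrow> Q \<subseteq> Lat \<Longrightarrow>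
    (\<Sum>l\<in>Q. (u (y + l) - (if even n then u else avg u) (x + l))\<^sup>2) \<le> C * energy u" by auto
  show ?case
  proof (intro exI[of _ "2 * C + 2"] allI impI)
    fix u Q assume u: "fs u" and Q: "finite Q" "Q \<subseteq> Lat"
    let ?f = "\<lambda>l. (if even n then u else avg u) (x + l)"
    let ?g = "\<lambda>l. (if even (Suc n) then u else avg u) (z + l)"
    have sq: "(a - b)\<^sup>2 \<le> 2 * (a - d)\<^sup>2 + 2 * (d - b)\<^sup>2" for a b d :: real
      using sum_squares_bound[of "a - d" "d - b"] by (simp add: power2_eq_square algebra_simps)
    have "(\<Sum>l\<in>Q. (?f l - ?g l)\<^sup>2) \<le> energy u"
      using energy_edges[OF u x(2) Q] energy_edges[OF u _ Q, of z x] x(2) c_sym[of x z]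
      by (simp add: power2_commute)
    moreover have "(\<Sum>l\<in>Q. (u (y + l) - ?g l)\<^sup>2)
        \<le> (\<Sum>l\<in>Q. 2 * (u (y + l) - ?f l)\<^sup>2 + 2 * (?f l - ?g l)\<^sup>2)"
      by (intro sum_mono sq)
    ultimately have "(\<Sum>l\<in>Q. (u (y + l) - ?g l)\<^sup>2) \<le> 2 * (C * energy u) + 2 * energy u"
      using C[OF u Q] by (simp add: sum.distrib sum_distrib_left[symmetric])
    then show "(\<Sum>l\<in>Q. (u (y + l) - ?g l)\<^sup>2) \<le> (2 * C + 2) * energy u"
      by (simp add: algebra_simps)
  qed
qed

lemma walk_shift: assumes "l \<in> Lat"
  shows "(x, y) \<in> {(x, y). c x y \<noteq> 0} ^^ n \<Longrightarrow> (x + l, y + l) \<in> {(x, y). c x y \<noteq> 0} ^^ n"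
proof (induction n arbitrary: y)
  case (Suc n)
  then obtain w where w: "(x, w) \<in> {(x, y). c x y \<noteq> 0} ^^ n" "c w y \<noteq> 0" by auto
  then have "(x + l, w + l) \<in> {(x, y). c x y \<noteq> 0} ^^ n" "(w + l, y + l) \<in> {(x, y). c x y \<noteq> 0}"
    using Suc.IH c_shift[OF assms] by auto
  then show ?case by auto
qed simp

text \<open>
  A walk from \<open>x\<close> to \<open>x + l\<close> followed by its own translate by \<open>l\<close> has even length. On a bipartite
  network single lattice vectors may only be joined by odd walks, which explains the factor 2.
\<close>

lemma energy_double_shift:
  assumes x: "x \<in> V" and l: "l \<in> Lat"
  shows "\<exists>C. \<forall>u Q. fs u \<longrightarrow> finite Q \<longrightarrow> Q \<subseteq> Lat \<longrightarrow>
    (\<Sum>m\<in>Q. (u (x + m) - u (x + m + 2 *\<^sub>R l))\<^sup>2) \<le> C * energy u"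
proof -
  let ?R = "{(x, y). c x y \<noteq> 0}"
  have "(x, x + l) \<in> ?R\<^sup>*" using connected x V_shift l by blast
  then obtain n where n: "(x, x + l) \<in> ?R ^^ n" by (auto simp: rtrancl_is_UN_relpow)
  then have "(x + l, x + l + l) \<in> ?R ^^ n" by (rule walk_shift[OF l])
  with n have "(x, x + 2 *\<^sub>R l) \<in> ?R ^^ (n + n)"
    unfolding relpow_add by (auto simp: scaleR_2 add.assoc)
  from energy_walk[OF this] show ?thesis by (simp add: add.assoc add.commute[of "2 *\<^sub>R l"])
qed

text \<open>
  Differences are taken along doubled lattice vectors, which is what the two-step energy controls.
\<close>

definition sdiff :: "real ^ 'n \<Rightarrow> (real ^ 'n \<Rightarrow> real) \<Rightarrow> real ^ 'n \<Rightarrow> real" where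
  "sdiff l u x = u (x + 2 *\<^sub>R l) - u x"

lemma Lat_double: "l \<in> Lat \<Longrightarrow> 2 *\<^sub>R l \<in> Lat"
  unfolding scaleR_2 by (rule Lat_add)

lemma fs_sdiff [intro]: "l \<in> Lat \<Longrightarrow> fs u \<Longrightarrow> fs (sdiff l u)"
  using fs_diff[OF fs_shift[OF Lat_double] ] by (simp add: sdiff_def[abs_def])

lemma avg_sdiff: "l \<in> Lat \<Longrightarrow> (avg ^^ k) (sdiff l u) = sdiff l ((avg ^^ k) u)"
  unfolding sdiff_def avg_pow_diff using avg_pow_shift[of "2 *\<^sub>R l" k u] Lat_double[of l] by (auto simp: fun_eq_iff)

text \<open>
  Every vertex is a lattice translate of one of finitely many, and the sum over the translates of each of
  these is bounded by \<open>energy_double_shift\<close>.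
\<close>

lemma sdiff_energy:
  assumes l: "l \<in> Lat"
  shows "\<exists>C\<ge>0. \<forall>u. fs u \<longrightarrow> (nrm (sdiff l u))\<^sup>2 \<le> C * energy u"
proof -
  obtain F where F: "finite F" "F \<subseteq> V" "\<And>x. x \<in> V \<Longrightarrow> \<exists>y\<in>F. x - y \<in> Lat"
    using cover by auto
  have ex: "\<forall>x\<in>F. \<exists>C. \<forall>u Q. fs u \<longrightarrow> finite Q \<longrightarrow> Q \<subseteq> Lat \<longrightarrow>
    (\<Sum>m\<in>Q. (u (x + m) - u (x + m + 2 *\<^sub>R l))\<^sup>2) \<le> C * energy u"
    using energy_double_shift[OF _ l] F by blast
  then obtain C where C: "\<And>x u Q. x \<in> F \<Longrightarrow> fs u \<Longrightarrow> finite Q \<Longrightarrow> Q \<subseteq> Lat \<Longrightarrow>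
    (\<Sum>m\<in>Q. (u (x + m) - u (x + m + 2 *\<^sub>R l))\<^sup>2) \<le> C x * energy u"
    using bchoice[OF ex] by blast
  show ?thesis
  proof (intro exI[of _ "\<Sum>x\<in>F. deg x * max 0 (C x)"] conjI allI impI)
    show "0 \<le> (\<Sum>x\<in>F. deg x * max 0 (C x))"
      by (intro sum_nonneg mult_nonneg_nonneg deg_nonneg) auto
    fix u assume u: "fs u"
    let ?A = "supp (sdiff l u)"
    let ?f = "\<lambda>x. deg x * (u x - u (x + 2 *\<^sub>R l))\<^sup>2"
    have A: "finite ?A" "?A \<subseteq> V" using fs_sdiff[OF l u] by (auto simp: fs_def)
    define Q where "Q x = {m\<in>Lat. x + m \<in> ?A}" for x
    have Q: "finite (Q x)" for x
      using finite_subset[of "Q x" "(\<lambda>y. y - x) ` ?A"] A by (force simp: Q_def image_iff)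
    have "(nrm (sdiff l u))\<^sup>2 = (\<Sum>x\<in>?A. ?f x)"
      unfolding nrm_sq ip_def by (simp add: sdiff_def power2_eq_square algebra_simps)
    also have "\<dots> \<le> (\<Sum>x\<in>(\<lambda>(x, m). x + m) ` (SIGMA x:F. Q x). ?f x)"
    proof (rule sum_mono2)
      show "finite ((\<lambda>(x, m). x + m) ` (SIGMA x:F. Q x))" using F Q by auto
      show "?A \<subseteq> (\<lambda>(x, m). x + m) ` (SIGMA x:F. Q x)"
      proof
        fix x assume x: "x \<in> ?A"
        then obtain y where "y \<in> F" "x - y \<in> Lat" using F A by blast
        then show "x \<in> (\<lambda>(x, m). x + m) ` (SIGMA x:F. Q x)"
          using x by (intro image_eqI[of _ _ "(y, x - y)"]) (auto simp: Q_def)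
      qed
    qed (simp add: deg_nonneg)
    also have "\<dots> \<le> (\<Sum>p\<in>(SIGMA x:F. Q x). ?f (fst p + snd p))"
      using sum_image_le[of "SIGMA x:F. Q x" "\<lambda>x. ?f x" "\<lambda>(x, m). x + m"] F Q
      by (simp add: case_prod_unfold deg_nonneg comp_def)
    also have "\<dots> = (\<Sum>x\<in>F. \<Sum>m\<in>Q x. ?f (x + m))"
      using F Q by (subst sum.Sigma) (auto simp: case_prod_unfold)
    also have "\<dots> = (\<Sum>x\<in>F. deg x * (\<Sum>m\<in>Q x. (u (x + m) - u (x + m + 2 *\<^sub>R l))\<^sup>2))"
      unfolding sum_distrib_left by (intro sum.cong refl) (auto simp: Q_def deg_shift)
    also have "\<dots> \<le> (\<Sum>x\<in>F. deg x * (max 0 (C x) * energy u))"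
    proof (intro sum_mono mult_left_mono deg_nonneg)
      fix x assume "x \<in> F"
      then have "(\<Sum>m\<in>Q x. (u (x + m) - u (x + m + 2 *\<^sub>R l))\<^sup>2) \<le> C x * energy u"
        using C u Q by (auto simp: Q_def)
      also have "\<dots> \<le> max 0 (C x) * energy u"
        using energy_nonneg[OF u] by (intro mult_right_mono) auto
      finally show "(\<Sum>m\<in>Q x. (u (x + m) - u (x + m + 2 *\<^sub>R l))\<^sup>2) \<le> max 0 (C x) * energy u" .
    qed
    also have "\<dots> = (\<Sum>x\<in>F. deg x * max 0 (C x)) * energy u"
      by (simp add: sum_distrib_right mult.assoc)
    finally show "(nrm (sdiff l u))\<^sup>2 \<le> (\<Sum>x\<in>F. deg x * max 0 (C x)) * energy u" .
  qed
qed

text \<open>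
  The drop in energy equals \<open>|u - P\<^sup>2 u|\<^sup>2\<close>; in other words, the sequence of the squares
  \<open>|P\<^sup>k u|\<^sup>2\<close> is convex.
\<close>

lemma energy_avg_le: assumes "fs u" shows "energy (avg u) \<le> energy u"
proof -
  have v: "fs (avg u)" "fs (avg (avg u))" using assms by auto
  have "ip (avg u) (avg u) = ip u (avg (avg u))" "ip (avg (avg u)) u = ip (avg u) (avg u)"
    using ip_avg assms v by auto
  then have "energy u - energy (avg u) = ip (\<lambda>x. u x - avg (avg u) x) (\<lambda>x. u x - avg (avg u) x)"
    using assms v by (simp add: energy_def ip_diff_left ip_diff_right)
  then show ?thesis using ip_nonneg[of "\<lambda>x. u x - avg (avg u) x"] by linarith
qed

lemma nrm_avg_le: assumes "fs u" shows "nrm (avg u) \<le> nrm u"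
  using energy_nonneg[OF assms] by (simp add: energy_def nrm_def)

lemma nrm_avg_pow_mono: assumes "fs u" "j \<le> k" shows "nrm ((avg ^^ k) u) \<le> nrm ((avg ^^ j) u)"
  using assms(2)
proof (induction k rule: dec_induct)
  case (step i)
  have "nrm ((avg ^^ Suc i) u) \<le> nrm ((avg ^^ i) u)"
    using nrm_avg_le[of "(avg ^^ i) u"] assms by auto
  with step show ?case by linarith
qed simp

lemma energy_avg_pow_mono: assumes "fs u" "j \<le> k" shows "energy ((avg ^^ k) u) \<le> energy ((avg ^^ j) u)"
  using assms(2)
proof (induction k rule: dec_induct)
  case (step i)
  have "energy ((avg ^^ Suc i) u) \<le> energy ((avg ^^ i) u)"
    using energy_avg_le[of "(avg ^^ i) u"] assms by auto
  with step show ?case by linarith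
qed simp

text \<open>
  The energies of the functions \<open>P\<^sup>i u\<close> decrease and their sum over \<open>k \<le> i < 2 k\<close> telescopes to at most
  \<open>|P\<^sup>k u|\<^sup>2\<close>.
\<close>

lemma energy_decay: assumes "fs u"
  shows "real k * energy ((avg ^^ (2 * k)) u) \<le> (nrm ((avg ^^ k) u))\<^sup>2"
proof -
  let ?q = "\<lambda>i. (nrm ((avg ^^ i) u))\<^sup>2"
  have "real k * energy ((avg ^^ (2 * k)) u) = (\<Sum>i\<in>{k..<2*k}. energy ((avg ^^ (2 * k)) u))"
    by simp
  also have "\<dots> \<le> (\<Sum>i\<in>{k..<2*k}. energy ((avg ^^ i) u))"
    using assms by (intro sum_mono energy_avg_pow_mono) auto
  also have "\<dots> = (\<Sum>i\<in>{k..<2*k}. ?q i - ?q (Suc i))"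
    by (simp add: nrm_sq energy_def)
  also have "\<dots> = ?q k - ?q (2 * k)"
    using sum_Suc_diff'[of k "2 * k" ?q] by (simp add: sum_subtractf)
  finally show ?thesis by (smt (verit) zero_le_power2)
qed


section \<open>A Nash inequality and heat kernel decay\<close>

definition nrm1 :: "(real ^ 'n \<Rightarrow> real) \<Rightarrow> real" where
  "nrm1 u = ip (\<lambda>x. \<bar>u x\<bar>) (\<lambda>_. 1)"

lemma fs_abs [intro]: "fs u \<Longrightarrow> fs (\<lambda>x. \<bar>u x\<bar>)"
  by (simp add: fs_def supp_def)

lemma ip_mono_left: assumes "fs u" "fs v" "\<And>x. u x \<le> v x" shows "ip u (\<lambda>_. 1) \<le> ip v (\<lambda>_. 1)"
proof -
  let ?A = "supp u \<union> supp v"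
  have "finite ?A" using assms by (simp add: fs_def)
  then show ?thesis using ip_eq[of ?A u "\<lambda>_. 1"] ip_eq[of ?A v "\<lambda>_. 1"] assms(3)
    by (auto intro!: sum_mono mult_left_mono deg_nonneg)
qed

lemma nrm1_avg_le: assumes "fs u" shows "nrm1 (avg u) \<le> nrm1 u"
proof -
  have "nrm1 (avg u) \<le> ip (avg (\<lambda>x. \<bar>u x\<bar>)) (\<lambda>_. 1)"
    unfolding nrm1_def using assms by (intro ip_mono_left avg_abs_le) auto
  also have "\<dots> = ip (\<lambda>x. \<bar>u x\<bar>) (avg (\<lambda>_. 1))" using assms by (intro ip_avg) auto
  also have "\<dots> = nrm1 u"
    unfolding nrm1_def using assms by (intro ip_cong) (auto simp: avg_const fs_def supp_def)
  finally show ?thesis .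
qed

lemma nrm1_avg_pow_le: "fs u \<Longrightarrow> nrm1 ((avg ^^ k) u) \<le> nrm1 u"
proof (induction k)
  case (Suc k)
  then show ?case using nrm1_avg_le[of "(avg ^^ k) u"] by fastforce
qed simp

lemma nrm1_pmass: assumes "y \<in> V" shows "nrm1 (pmass y) = 1"
proof -
  have "(\<lambda>x. \<bar>pmass y x\<bar>) = pmass y" using deg_nonneg by (auto simp: pmass_def fun_eq_iff)
  then show ?thesis using ip_pmass[OF assms] by (simp add: nrm1_def)
qed

lemma nrm1_nonneg: "0 \<le> nrm1 u"
  unfolding nrm1_def ip_def by (intro sum_nonneg) (simp add: deg_nonneg)

definition lvec :: "('n \<Rightarrow> nat) \<Rightarrow> real ^ 'n" where
  "lvec z = M *v (\<chi> i. real (z i))"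

lemma lvec_Lat: "lvec z \<in> Lat"
  unfolding Lat_eq lvec_def by (auto intro!: exI[of _ "\<chi> i. real (z i)"])

lemma lvec_inj: "lvec z = lvec w \<Longrightarrow> z = w"
  unfolding lvec_def by (drule M_inj) (simp add: vec_eq_iff fun_eq_iff)

lemma column_Lat: "column i M \<in> Lat"
  unfolding Lat_eq matrix_vector_mult_basis[symmetric] by (auto intro!: exI[of _ "axis i 1"] simp: axis_def)

lemma lvec_eq: "lvec z = (\<Sum>i\<in>UNIV. real (z i) *\<^sub>R column i M)"
  unfolding lvec_def by (simp add: matrix_mult_sum scalar_mult_eq_scaleR)

lemma nrm_sdiff_add: assumes "fs u" "l \<in> Lat" "m \<in> Lat"
  shows "nrm (sdiff (l + m) u) \<le> nrm (sdiff l u) + nrm (sdiff m u)"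
proof -
  have l2: "2 *\<^sub>R l \<in> Lat" using Lat_double assms by blast
  have "sdiff (l + m) u = (\<lambda>x. sdiff l u x + sdiff m u (x + 2 *\<^sub>R l))"
    by (simp only: sdiff_def fun_eq_iff scaleR_add_right) (simp add: add.assoc)
  then show ?thesis
    using nrm_triangle[of "sdiff l u" "\<lambda>x. sdiff m u (x + 2 *\<^sub>R l)"] nrm_shift[OF l2, of "sdiff m u"] fs_shift[OF l2] assms
    by auto
qed

lemma nrm_sdiff_zero: "nrm (sdiff 0 u) = 0"
  by (simp add: nrm_def ip_def sdiff_def)

text \<open>
  A difference along \<open>lvec z\<close> is a sum of translates of differences along the columns of \<open>M\<close>, with \<open>z i\<close>
  of them in direction \<open>i\<close>.
\<close>

lemma nrm_sdiff_lvec: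
  "\<exists>K\<ge>0. \<forall>u z. fs u \<longrightarrow> nrm (sdiff (lvec z) u) \<le> real (\<Sum>i\<in>UNIV. z i) * K * sqrt (energy u)"
proof -
  have "\<forall>i. \<exists>C\<ge>0. \<forall>u. fs u \<longrightarrow> (nrm (sdiff (column i M) u))\<^sup>2 \<le> C * energy u"
    using sdiff_energy column_Lat by blast
  then obtain C where C: "\<And>i. C i \<ge> 0" "\<And>i u. fs u \<Longrightarrow> (nrm (sdiff (column i M) u))\<^sup>2 \<le> C i * energy u"
    by metis
  define K where "K = (\<Sum>i\<in>UNIV. sqrt (C i))"
  have one: "nrm (sdiff (column i M) u) \<le> K * sqrt (energy u)" if "fs u" for i u
  proof -
    have "nrm (sdiff (column i M) u) \<le> sqrt (C i * energy u)"
      using C(2)[OF that] by (rule real_le_rsqrt)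
    also have "\<dots> \<le> K * sqrt (energy u)"
      unfolding K_def real_sqrt_mult using energy_nonneg[OF that] C(1)
      by (intro mult_right_mono member_le_sum) auto
    finally show ?thesis .
  qed
  have mult: "nrm (sdiff (real k *\<^sub>R column i M) u) \<le> real k * (K * sqrt (energy u))" if "fs u" for k i u
  proof (induction k)
    case (Suc k)
    have "nrm (sdiff (column i M + real k *\<^sub>R column i M) u)
        \<le> nrm (sdiff (column i M) u) + nrm (sdiff (real k *\<^sub>R column i M) u)"
      using that Lat_of_nat column_Lat by (intro nrm_sdiff_add) auto
    with Suc one[OF that, of i] show ?case
      by (simp add: scaleR_add_left distrib_right)
  qed (simp add: nrm_sdiff_zero)
  have "nrm (sdiff (\<Sum>i\<in>A. real (z i) *\<^sub>R column i M) u) \<le> (\<Sum>i\<in>A. real (z i) * (K * sqrt (energy u)))"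
    if "fs u" "finite A" for A z u
    using that(2)
  proof (induction A)
    case (insert i A)
    have "nrm (sdiff (real (z i) *\<^sub>R column i M + (\<Sum>i\<in>A. real (z i) *\<^sub>R column i M)) u)
        \<le> nrm (sdiff (real (z i) *\<^sub>R column i M) u) + nrm (sdiff (\<Sum>i\<in>A. real (z i) *\<^sub>R column i M) u)"
      using that Lat_of_nat column_Lat by (intro nrm_sdiff_add Lat_sum) auto
    with insert mult[OF that(1), of "z i" i] show ?case by simp
  qed (simp add: nrm_sdiff_zero)
  then have "\<forall>u z. fs u \<longrightarrow> nrm (sdiff (lvec z) u) \<le> real (\<Sum>i\<in>UNIV. z i) * K * sqrt (energy u)"
    unfolding lvec_eq by (simp add: sum_distrib_right mult.assoc)
  moreover have "0 \<le> K" unfolding K_def using C(1) by (intro sum_nonneg) auto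
  ultimately show ?thesis by blast
qed

text \<open>
  Compare \<open>u\<close> with its mean over the \<open>R ^ CARD('n)\<close> translates by doubled lattice vectors from a box of side
  \<open>R\<close>. The distance in norm is at most a multiple of \<open>R * sqrt (energy u)\<close>, and the mean is pointwise at
  most \<open>nrm1 u / R ^ CARD('n)\<close> because the translates of a vertex are distinct.
\<close>

lemma nash:
  "\<exists>C>0. \<forall>u R. fs u \<longrightarrow> R \<ge> 1 \<longrightarrow>
     ip u u \<le> C * real R * nrm u * sqrt (energy u) + (nrm1 u)\<^sup>2 / real R ^ CARD('n)"
proof -
  obtain K where K: "K \<ge> 0" "\<And>u z. fs u \<Longrightarrow> nrm (sdiff (lvec z) u) \<le> real (\<Sum>i\<in>UNIV. z i) * K * sqrt (energy u)"
    using nrm_sdiff_lvec by blast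
  define C where "C = real CARD('n) * K + 1"
  have "ip u u \<le> C * real R * nrm u * sqrt (energy u) + (nrm1 u)\<^sup>2 / real R ^ CARD('n)"
    if u: "fs u" and R: "R \<ge> 1" for u R
  proof -
    define B where "B = (UNIV :: 'n set) \<rightarrow>\<^sub>E {..<R}"
    have B: "finite B" "card B = R ^ CARD('n)"
      unfolding B_def by (auto intro: finite_PiE simp: card_funcsetE)
    have finu: "finite (supp u)" and uV: "supp u \<subseteq> V" using u by (auto simp: fs_def)
    have en: "0 \<le> energy u" using energy_nonneg[OF u] .
    have 1: "- ip u (sdiff (lvec z) u) \<le> C * real R * nrm u * sqrt (energy u)" if "z \<in> B" for z
    proof -
      have "(\<Sum>i\<in>UNIV. z i) \<le> (\<Sum>i\<in>(UNIV::'n set). R)"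
        using that by (intro sum_mono) (auto simp: B_def PiE_def Pi_def less_imp_le)
      then have "(\<Sum>i\<in>UNIV. z i) \<le> CARD('n) * R" by simp
      then have "real (\<Sum>i\<in>UNIV. z i) \<le> real (CARD('n) * R)" unfolding of_nat_le_iff .
      then have "real (\<Sum>i\<in>UNIV. z i) \<le> real CARD('n) * real R" unfolding of_nat_mult .
      then have "real (\<Sum>i\<in>UNIV. z i) * K * sqrt (energy u) \<le> real CARD('n) * real R * K * sqrt (energy u)"
        using K(1) en by (intro mult_right_mono) auto
      also have "\<dots> \<le> C * real R * sqrt (energy u)"
        using en by (simp add: C_def algebra_simps)
      finally have "nrm (sdiff (lvec z) u) \<le> C * real R * sqrt (energy u)"
        using K(2)[OF u, of z] by linarith
      then have "nrm u * nrm (sdiff (lvec z) u) \<le> nrm u * (C * real R * sqrt (energy u))"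
        by (intro mult_left_mono) auto
      with ip_le_nrm[OF u fs_sdiff[OF lvec_Lat u, of z]] show ?thesis by (simp add: mult_ac)
    qed
    have abs1: "(\<Sum>y\<in>supp u. \<bar>u y\<bar>) \<le> nrm1 u"
    proof -
      have "(\<Sum>y\<in>supp u. \<bar>u y\<bar>) \<le> (\<Sum>y\<in>supp u. deg y * \<bar>u y\<bar>)"
      proof (rule sum_mono)
        fix y assume "y \<in> supp u"
        then have "1 \<le> deg y" using uV deg_ge_1 by auto
        then show "\<bar>u y\<bar> \<le> deg y * \<bar>u y\<bar>" by (simp add: mult_le_cancel_right1)
      qed
      also have "\<dots> = nrm1 u"
        unfolding nrm1_def using finu by (subst ip_eq[of "supp u"]) (auto simp: supp_def)
      finally show ?thesis .
    qed
    have 2: "(\<Sum>z\<in>B. \<bar>u (x + 2 *\<^sub>R lvec z)\<bar>) \<le> nrm1 u" for x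
    proof -
      have inj: "inj_on (\<lambda>z. x + 2 *\<^sub>R lvec z) B"
      proof (rule inj_onI)
        fix z w assume "x + 2 *\<^sub>R lvec z = x + 2 *\<^sub>R lvec w"
        then have "2 *\<^sub>R lvec z = 2 *\<^sub>R lvec w" by (rule add_left_imp_eq)
        then have "lvec z = lvec w" unfolding scaleR_cancel_left by simp
        then show "z = w" by (rule lvec_inj)
      qed
      have "(\<Sum>z\<in>B. \<bar>u (x + 2 *\<^sub>R lvec z)\<bar>) = (\<Sum>y\<in>(\<lambda>z. x + 2 *\<^sub>R lvec z) ` B. \<bar>u y\<bar>)"
        by (subst sum.reindex[OF inj]) (simp add: comp_def)
      also have "\<dots> \<le> (\<Sum>y\<in>supp u \<union> (\<lambda>z. x + 2 *\<^sub>R lvec z) ` B. \<bar>u y\<bar>)"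
        using B finu by (intro sum_mono2) auto
      also have "\<dots> = (\<Sum>y\<in>supp u. \<bar>u y\<bar>)"
        using B finu by (intro sum.mono_neutral_right) (auto simp: supp_def)
      finally show ?thesis using abs1 by linarith
    qed
    have "real (card B) * ip u u = (\<Sum>z\<in>B. ip u u)" by simp
    also have "\<dots> = (\<Sum>z\<in>B. - ip u (sdiff (lvec z) u)) + (\<Sum>z\<in>B. ip u (\<lambda>x. u (x + 2 *\<^sub>R lvec z)))"
      unfolding sum.distrib[symmetric] by (intro sum.cong refl) (simp only: sdiff_def[abs_def] ip_diff_right)
    also have "(\<Sum>z\<in>B. - ip u (sdiff (lvec z) u)) \<le> (\<Sum>z\<in>B. C * real R * nrm u * sqrt (energy u))"
      by (intro sum_mono 1)
    also have "\<dots> = real (card B) * (C * real R * nrm u * sqrt (energy u))" by simp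
    also have "(\<Sum>z\<in>B. ip u (\<lambda>x. u (x + 2 *\<^sub>R lvec z)))
        = (\<Sum>x\<in>supp u. deg x * u x * (\<Sum>z\<in>B. u (x + 2 *\<^sub>R lvec z)))"
      unfolding ip_def by (subst sum.swap) (simp add: sum_distrib_left)
    also have "\<dots> \<le> (\<Sum>x\<in>supp u. deg x * \<bar>u x\<bar> * nrm1 u)"
    proof (rule sum_mono)
      fix x
      have "\<bar>\<Sum>z\<in>B. u (x + 2 *\<^sub>R lvec z)\<bar> \<le> nrm1 u" by (rule order_trans[OF sum_abs 2])
      then have "deg x * \<bar>u x\<bar> * \<bar>\<Sum>z\<in>B. u (x + 2 *\<^sub>R lvec z)\<bar> \<le> deg x * \<bar>u x\<bar> * nrm1 u"
        by (intro mult_left_mono) (auto simp: deg_nonneg)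
      then show "deg x * u x * (\<Sum>z\<in>B. u (x + 2 *\<^sub>R lvec z)) \<le> deg x * \<bar>u x\<bar> * nrm1 u"
        using abs_le_D1[of "deg x * u x * (\<Sum>z\<in>B. u (x + 2 *\<^sub>R lvec z))"] deg_nonneg[of x]
        by (simp add: abs_mult)
    qed
    also have "\<dots> = (nrm1 u)\<^sup>2"
      unfolding sum_distrib_right[symmetric] power2_eq_square nrm1_def
      using ip_eq[OF finu, of "\<lambda>x. \<bar>u x\<bar>" "\<lambda>_. 1"] by (simp add: supp_def)
    finally have "real (card B) * ip u u \<le> real (card B) * (C * real R * nrm u * sqrt (energy u)) + (nrm1 u)\<^sup>2"
      by simp
    moreover have "0 < real (card B)" using R B by simp
    ultimately have "ip u u \<le> C * real R * nrm u * sqrt (energy u) + (nrm1 u)\<^sup>2 / real (card B)"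
      by (simp add: field_simps)
    then show ?thesis by (simp add: B)
  qed
  moreover have "0 < C" using K(1) by (simp add: C_def add_nonneg_pos)
  ultimately show ?thesis by blast
qed

text \<open>
  Either \<open>t\<close> dominates the right-hand side, or the linear term does and \<open>a\<close> can be cancelled.
\<close>

lemma quadratic_absorb:
  fixes a b s t :: real
  assumes "0 \<le> a" "0 \<le> b" "0 \<le> s" "a\<^sup>2 \<le> s * a * b + t" "0 \<le> t"
  shows "a\<^sup>2 \<le> (2 * s * b)\<^sup>2 + 2 * t"
proof (cases "s * a * b \<le> t")
  case False
  then have "a * a \<le> (2 * s * b) * a" using assms(4) by (simp add: power2_eq_square algebra_simps)
  moreover have "a > 0" using False assms by (cases "a = 0") auto
  ultimately have "a \<le> 2 * s * b" by simp
  then show ?thesis using assms by (simp add: power_mono add_increasing2)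
next
  case True
  then show ?thesis using assms(4) zero_le_power2[of "2 * s * b"] by linarith
qed

text \<open>
  With \<open>q k = |P\<^sup>k \<delta>|\<^sup>2\<close> and \<open>R\<close> about \<open>e * sqrt j\<close>, the Nash inequality for \<open>P\<^bsup>2j\<^esup> \<delta>\<close>, whose energy
  is at most \<open>q j / j\<close>, bounds \<open>q (2 j)\<close> by a small multiple of \<open>q j\<close> plus a multiple of
  \<open>sqrt j ^ (- CARD('n))\<close>. If \<open>e\<close> is small enough, this reproduces the claimed rate from \<open>j\<close> to \<open>2 j\<close>.
\<close>

lemma heat_kernel_bound:
  "\<exists>A>0. \<forall>y\<in>V. \<forall>k\<ge>1. (nrm ((avg ^^ k) (pmass y)))\<^sup>2 \<le> A / sqrt (real k) ^ CARD('n)"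
proof -
  let ?d = "CARD('n)"
  obtain C where C: "C > 0" "\<And>u R. fs u \<Longrightarrow> R \<ge> 1 \<Longrightarrow>
     ip u u \<le> C * real R * nrm u * sqrt (energy u) + (nrm1 u)\<^sup>2 / real R ^ ?d"
    using nash by blast
  \<comment> \<open>With this \<open>e\<close> the contraction factor \<open>(4 * C * e)\<^sup>2\<close> is at most \<open>1 / (2 * 2 ^ d)\<close>, where \<open>2 ^ d\<close> is the loss from \<open>j\<close> to \<open>k \<le> 4 * j\<close>.\<close>
  define e where "e = min 1 (1 / (8 * C * 2 ^ ?d))"
  have e: "0 < e" "e \<le> 1" using C by (auto simp: e_def)
  \<comment> \<open>\<open>A\<close> absorbs twice the inhomogeneous term and also covers small \<open>k\<close>, where \<open>sqrt k \<le> 2 / e\<close>.\<close>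
  define A where "A = 2 ^ (?d + 2) / e ^ ?d"
  have "4 \<le> (2::real) ^ (?d + 2)" by (simp add: one_le_power)
  then have A4: "4 \<le> A" unfolding A_def using e power_le_one[of e ?d]
    by (simp add: field_simps mult_le_one order_trans[of "4 * e ^ ?d" 4])
  have "\<forall>k\<ge>1. (nrm ((avg ^^ k) (pmass y)))\<^sup>2 \<le> A / sqrt (real k) ^ ?d" if y: "y \<in> V" for y
  proof -
    define q where "q k = (nrm ((avg ^^ k) (pmass y)))\<^sup>2" for k
    have fsq: "fs ((avg ^^ k) (pmass y))" for k using y by blast
    have q0: "0 \<le> q k" for k by (simp add: q_def)
    have q_mono: "j \<le> k \<Longrightarrow> q k \<le> q j" for j k
      unfolding q_def by (intro power_mono nrm_avg_pow_mono fs_pmass y) auto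
    have q1: "q k \<le> 1" for k
    proof -
      have "q k \<le> q 0" by (rule q_mono) simp
      also have "\<dots> \<le> 1" unfolding q_def using nrm_pmass_le[OF y] by (simp add: power_le_one)
      finally show ?thesis .
    qed
    have step: "q (2 * j) \<le> (4 * C * e)\<^sup>2 * q j + 2 / (e * sqrt (real j)) ^ ?d" if j: "1 \<le> e * sqrt (real j)" for j
    proof -
      define R where "R = nat \<lceil>e * sqrt (real j)\<rceil>"
      have R: "e * sqrt (real j) \<le> real R" "real R \<le> 2 * (e * sqrt (real j))" "1 \<le> R"
        using j by (auto simp: R_def) linarith+
      have jpos: "0 < j" using j e by (cases "j = 0") auto
      let ?u = "(avg ^^ (2 * j)) (pmass y)"
      have en: "energy ?u \<le> q j / real j"
        using energy_decay[OF fs_pmass[OF y], of j] jpos by (simp add: q_def field_simps)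
      have n1: "(nrm1 ?u)\<^sup>2 \<le> 1"
        using nrm1_avg_pow_le[OF fs_pmass[OF y], of "2 * j"] nrm1_pmass[OF y] nrm1_nonneg by (simp add: power_le_one)
      have "C * real R * nrm ?u * sqrt (energy ?u) \<le> C * (2 * (e * sqrt (real j))) * nrm ?u * sqrt (q j / real j)"
        using C R en e by (intro mult_mono) (auto simp: energy_nonneg[OF fsq])
      also have "\<dots> = (2 * C * e) * sqrt (q (2 * j)) * sqrt (q j)"
        using jpos by (simp add: q_def real_sqrt_divide)
      finally have 1: "C * real R * nrm ?u * sqrt (energy ?u) \<le> (2 * C * e) * sqrt (q (2 * j)) * sqrt (q j)" .
      have "(nrm1 ?u)\<^sup>2 / real R ^ ?d \<le> 1 / (e * sqrt (real j)) ^ ?d"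
        using n1 R j by (intro frac_le power_mono) auto
      then have "(sqrt (q (2 * j)))\<^sup>2 \<le> (2 * C * e) * sqrt (q (2 * j)) * sqrt (q j) + 1 / (e * sqrt (real j)) ^ ?d"
        using C(2)[OF fsq[of "2 * j"] R(3)] 1 q0 by (simp add: q_def nrm_sq)
      from quadratic_absorb[OF _ _ _ this] show ?thesis
        using C e q0 j by (simp add: power_mult_distrib)
    qed
    have "q k \<le> A / sqrt (real k) ^ ?d" if "k \<ge> 1" for k
      using that
    proof (induction k rule: less_induct)
      case (less k)
      define j where "j = k div 2"
      have jk: "2 * j \<le> k" "k \<le> 2 * j + 1" by (auto simp: j_def)
      show ?case
      proof (cases "1 \<le> e * sqrt (real j)")
        case True
        have jpos: "0 < j" using True e by (cases "j = 0") auto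
        then have IH: "q j \<le> A / sqrt (real j) ^ ?d" using less.IH[of j] less.prems by (auto simp: j_def)
        have sj: "0 < sqrt (real j) ^ ?d" using jpos by simp
        have "4 * C * e \<le> 1 / (2 * 2 ^ ?d)"
        proof -
          have "e \<le> 1 / (8 * C * 2 ^ ?d)" by (simp add: e_def)
          then have "4 * C * e \<le> 4 * C * (1 / (8 * C * 2 ^ ?d))" using C by (intro mult_left_mono) auto
          then show ?thesis using C by simp
        qed
        then have "(4 * C * e)\<^sup>2 \<le> (1 / (2 * 2 ^ ?d))\<^sup>2" using C e by (intro power_mono) auto
        also have "\<dots> \<le> 1 / (2 * 2 ^ ?d)"
          unfolding power2_eq_square by (intro mult_left_le) (auto simp: field_simps one_le_power mult_ge1_I)
        finally have th: "(4 * C * e)\<^sup>2 \<le> 1 / (2 * 2 ^ ?d)" .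
        have "q k \<le> q (2 * j)" by (rule q_mono[OF jk(1)])
        also have "\<dots> \<le> (4 * C * e)\<^sup>2 * q j + 2 / (e * sqrt (real j)) ^ ?d" by (rule step[OF True])
        also have "\<dots> \<le> 1 / (2 * 2 ^ ?d) * (A / sqrt (real j) ^ ?d) + 2 / (e * sqrt (real j)) ^ ?d"
          using th IH q0[of j] by (intro add_mono mult_mono) auto
        also have "\<dots> = A / (2 ^ ?d * sqrt (real j) ^ ?d)"
          using e sj by (simp add: A_def power_mult_distrib power_add field_simps)
        also have "\<dots> \<le> A / sqrt (real k) ^ ?d"
        proof (intro divide_left_mono)
          have "sqrt (real k) \<le> sqrt (4 * real j)" using jk jpos by (intro real_sqrt_le_mono) linarith
          then have "sqrt (real k) \<le> 2 * sqrt (real j)" by (simp add: real_sqrt_mult)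
          then show "sqrt (real k) ^ ?d \<le> 2 ^ ?d * sqrt (real j) ^ ?d"
            unfolding power_mult_distrib[symmetric] by (intro power_mono) auto
        qed (use A4 sj less.prems in auto)
        finally show ?thesis .
      next
        case False
        have "sqrt (real k) \<le> 2 / e"
        proof (cases "j = 0")
          case True
          then have "k = 1" using jk less.prems by simp
          then show ?thesis using e by (simp add: field_simps)
        next
          case jn: False
          have "sqrt (real k) \<le> sqrt (4 * real j)" using jk jn by (intro real_sqrt_le_mono) linarith
          then have "sqrt (real k) \<le> 2 * sqrt (real j)" by (simp add: real_sqrt_mult)
          moreover have "sqrt (real j) \<le> 1 / e" using False e by (simp add: field_simps)
          ultimately show ?thesis by simp
        qed
        then have "sqrt (real k) ^ ?d \<le> (2 / e) ^ ?d" by (intro power_mono) auto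
        also have "\<dots> \<le> A" using e by (simp add: A_def power_divide divide_right_mono)
        finally have "1 \<le> A / sqrt (real k) ^ ?d" using less.prems by simp
        then show ?thesis using q1[of k] by linarith
      qed
    qed
    then show ?thesis by (simp add: q_def)
  qed
  then show ?thesis using A4 by (intro exI[of _ A]) auto
qed


section \<open>Decay rates and convergence of Green sums\<close>

text \<open>
  Decay of the square norm at polynomial rate \<open>a\<close>; the rate at \<open>k = 0\<close> is immaterial and would be
  meaningless, since \<open>0 powr _ = 0\<close>.
\<close>

definition decays :: "real \<Rightarrow> (real ^ 'n \<Rightarrow> real) \<Rightarrow> bool" where
  "decays a f \<longleftrightarrow> fs f \<and> (\<exists>A\<ge>0. \<forall>k\<ge>1. nrm ((avg ^^ k) f) \<le> A * real k powr (- a))"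

lemma heat_kernel_powr:
  "\<exists>A\<ge>0. \<forall>y\<in>V. \<forall>k\<ge>1. nrm ((avg ^^ k) (pmass y)) \<le> A * real k powr (- (CARD('n) / 4))"
proof -
  obtain A where A: "A > 0" "\<And>y k. y \<in> V \<Longrightarrow> k \<ge> 1 \<Longrightarrow> (nrm ((avg ^^ k) (pmass y)))\<^sup>2 \<le> A / sqrt (real k) ^ CARD('n)"
    using heat_kernel_bound by blast
  have "nrm ((avg ^^ k) (pmass y)) \<le> sqrt A * real k powr (- (CARD('n) / 4))" if "y \<in> V" "k \<ge> 1" for y k
  proof -
    have k: "0 < real k" using that by simp
    have "sqrt (real k) ^ CARD('n) = real k powr (CARD('n) / 2)"
      unfolding powr_half_sqrt[OF less_imp_le[OF k], symmetric] using k by (subst powr_power) auto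
    moreover have "(real k powr (- (CARD('n) / 4)))\<^sup>2 = real k powr (- (CARD('n) / 2))"
      using k by (subst powr_power) auto
    ultimately have "A / sqrt (real k) ^ CARD('n) = (sqrt A * real k powr (- (CARD('n) / 4)))\<^sup>2"
      using A(1) by (simp only: power_mult_distrib powr_minus divide_inverse) simp
    then have "(nrm ((avg ^^ k) (pmass y)))\<^sup>2 \<le> (sqrt A * real k powr (- (CARD('n) / 4)))\<^sup>2"
      using A(2)[OF that] by simp
    then show ?thesis by (rule power2_le_imp_le) (use A(1) in simp)
  qed
  then show ?thesis using A(1) by (intro exI[of _ "sqrt A"]) auto
qed

lemma decays_pmass: "y \<in> V \<Longrightarrow> decays (CARD('n) / 4) (pmass y)"
  using heat_kernel_powr unfolding decays_def by blast

text \<open>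
  Estimates at \<open>j = k div 2\<close> are turned into estimates at \<open>k\<close> by this comparison.
\<close>

lemma powr_half_le:
  assumes "1 \<le> j" "1 \<le> k" "k \<le> 2 * j + 1" "0 \<le> b"
  shows "real j powr (- b) \<le> 3 powr b * real k powr (- b)"
proof -
  have "real j powr (- b) = 3 powr b * (3 * real j) powr (- b)"
    using assms by (simp add: powr_mult powr_minus)
  also have "(3 * real j) powr (- b) \<le> real k powr (- b)"
    using assms by (intro powr_mono2') auto
  finally show ?thesis by simp
qed

text \<open>
  Differences commute with \<open>avg\<close>, so \<open>P\<^bsup>2j\<^esup>\<close> of a difference is a difference of \<open>P\<^bsup>2j\<^esup> f\<close>. Its square is
  bounded by the energy, and the energy by \<open>|P\<^sup>j f|\<^sup>2 / j\<close>: this is the gain of \<open>j\<^bsup>-1/2\<^esup>\<close>.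
\<close>

lemma decays_sdiff:
  assumes l: "l \<in> Lat" and f: "decays a f" and a: "0 \<le> a"
  shows "decays (a + 1 / 2) (sdiff l f)"
proof -
  obtain A where A: "A \<ge> 0" "\<And>k. k \<ge> 1 \<Longrightarrow> nrm ((avg ^^ k) f) \<le> A * real k powr (- a)" and fsf: "fs f"
    using f by (auto simp: decays_def)
  obtain C where C: "C \<ge> 0" "\<And>u. fs u \<Longrightarrow> (nrm (sdiff l u))\<^sup>2 \<le> C * energy u"
    using sdiff_energy[OF l] by blast
  let ?b = "a + 1 / 2"
  have half: "nrm ((avg ^^ (2 * j)) (sdiff l f)) \<le> sqrt C * A * real j powr (- ?b)" if j: "j \<ge> 1" for j
  proof -
    have "energy ((avg ^^ (2 * j)) f) \<le> (nrm ((avg ^^ j) f))\<^sup>2 / real j"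
      using energy_decay[OF fsf, of j] j by (simp add: field_simps)
    also have "\<dots> \<le> (A * real j powr (- a))\<^sup>2 / real j"
      using A(2)[OF j] by (intro divide_right_mono power_mono) auto
    also have "\<dots> = (A * real j powr (- ?b))\<^sup>2"
    proof -
      have "(real j powr (- ?b))\<^sup>2 = (real j powr (- a))\<^sup>2 / real j"
        using j by (simp add: powr_power) (simp add: powr_diff distrib_left)
      then show ?thesis by (simp add: power_mult_distrib)
    qed
    finally have "C * energy ((avg ^^ (2 * j)) f) \<le> C * (A * real j powr (- ?b))\<^sup>2"
      using C(1) by (intro mult_left_mono)
    then have "(nrm (sdiff l ((avg ^^ (2 * j)) f)))\<^sup>2 \<le> (sqrt C * (A * real j powr (- ?b)))\<^sup>2"
      using C(2)[OF fs_avg_pow[OF fsf], of "2 * j"] C(1) by (simp add: power_mult_distrib)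
    then have "nrm (sdiff l ((avg ^^ (2 * j)) f)) \<le> sqrt C * (A * real j powr (- ?b))"
      by (rule power2_le_imp_le) (use A(1) C(1) in auto)
    then show ?thesis by (simp add: avg_sdiff[OF l] mult.assoc)
  qed
  have fsh: "fs (sdiff l f)" using fsf l by blast
  define B where "B = sqrt C * A * 3 powr ?b + nrm (sdiff l f)"
  have "nrm ((avg ^^ k) (sdiff l f)) \<le> B * real k powr (- ?b)" if k: "k \<ge> 1" for k
  proof (cases "k = 1")
    case True
    have "nrm ((avg ^^ 1) (sdiff l f)) \<le> nrm ((avg ^^ 0) (sdiff l f))"
      by (rule nrm_avg_pow_mono[OF fsh]) simp
    then show ?thesis using True A(1) C(1) by (simp add: B_def add_increasing)
  next
    case False
    define j where "j = k div 2"
    have j: "1 \<le> j" "2 * j \<le> k" "k \<le> 2 * j + 1" using False k by (auto simp: j_def)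
    have "nrm ((avg ^^ k) (sdiff l f)) \<le> sqrt C * A * real j powr (- ?b)"
      using half[OF j(1)] nrm_avg_pow_mono[OF fsh j(2)] by linarith
    also have "\<dots> \<le> sqrt C * A * (3 powr ?b * real k powr (- ?b))"
      using j a A(1) C(1) by (intro mult_left_mono powr_half_le) auto
    also have "\<dots> \<le> B * real k powr (- ?b)"
      by (simp add: B_def algebra_simps)
    finally show ?thesis .
  qed
  moreover have "0 \<le> B" using A(1) C(1) by (simp add: B_def)
  ultimately show ?thesis using fsh unfolding decays_def by blast
qed

text \<open>
  The value of \<open>P\<^bsup>i+j\<^esup> f\<close> at \<open>x\<close> is the inner product of \<open>P\<^sup>i (pmass x)\<close> and \<open>P\<^sup>j f\<close>; splitting the steps evenly
  adds the decay rates of the two factors.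
\<close>

lemma decays_pointwise:
  assumes f: "decays a f" and a: "0 \<le> a"
  shows "\<exists>A. \<forall>x\<in>V. \<forall>k. \<bar>(avg ^^ k) f x\<bar> \<le> A * real (Suc k) powr (- (a + CARD('n) / 4))"
proof -
  let ?b = "a + CARD('n) / 4"
  obtain A where A: "A \<ge> 0" "\<And>k. k \<ge> 1 \<Longrightarrow> nrm ((avg ^^ k) f) \<le> A * real k powr (- a)" and fsf: "fs f"
    using f by (auto simp: decays_def)
  obtain H where H: "H \<ge> 0" "\<And>y k. y \<in> V \<Longrightarrow> k \<ge> 1 \<Longrightarrow> nrm ((avg ^^ k) (pmass y)) \<le> H * real k powr (- (CARD('n) / 4))"
    using heat_kernel_powr by blast
  have "0 \<le> ?b" using a by simp
  have pt: "\<bar>(avg ^^ (i + j)) f x\<bar> \<le> nrm ((avg ^^ i) (pmass x)) * nrm ((avg ^^ j) f)" if "x \<in> V" for x i j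
  proof -
    have "(avg ^^ (i + j)) f x = ip (pmass x) ((avg ^^ i) ((avg ^^ j) f))"
      using that by (simp add: ip_pmass funpow_add)
    also have "\<dots> = ip ((avg ^^ i) (pmass x)) ((avg ^^ j) f)"
      using that by (subst ip_avg_pow) auto
    finally show ?thesis using ip_le_nrm[OF fs_avg_pow[OF fs_pmass[OF that]] fs_avg_pow[OF fsf], of i j] by simp
  qed
  have pt0: "\<bar>(avg ^^ k) f x\<bar> \<le> nrm f" if "x \<in> V" for x k
  proof -
    have "\<bar>(avg ^^ k) f x\<bar> \<le> nrm (pmass x) * nrm ((avg ^^ k) f)" using pt[OF that, of 0 k] by simp
    also have "\<dots> \<le> 1 * nrm f"
      using nrm_pmass_le[OF that] nrm_avg_pow_mono[OF fsf, of 0 k] by (intro mult_mono) auto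
    finally show ?thesis by simp
  qed
  define B where "B = H * A * 3 powr ?b * 3 powr ?b + nrm f * 3 powr ?b"
  have "\<bar>(avg ^^ k) f x\<bar> \<le> B * real (Suc k) powr (- ?b)" if x: "x \<in> V" for x k
  proof (cases "k \<le> 1")
    case True
    then have "1 \<le> 3 powr ?b * real (Suc k) powr (- ?b)"
      using powr_half_le[of 1 "Suc k" ?b] \<open>0 \<le> ?b\<close> by simp
    then have "nrm f * 1 \<le> nrm f * (3 powr ?b * real (Suc k) powr (- ?b))"
      by (intro mult_left_mono) auto
    also have "\<dots> \<le> B * real (Suc k) powr (- ?b)"
      unfolding B_def using A(1) H(1) by (simp add: distrib_right mult.assoc)
    finally show ?thesis using pt0[OF x, of k] by simp
  next
    case False
    define j where "j = k div 2"
    have j: "1 \<le> j" "2 * j \<le> k" "k \<le> 2 * j + 1" using False by (auto simp: j_def)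
    have "\<bar>(avg ^^ k) f x\<bar> \<le> nrm ((avg ^^ (k - j)) (pmass x)) * nrm ((avg ^^ j) f)"
      using pt[OF x, of "k - j" j] j by simp
    also have "\<dots> \<le> nrm ((avg ^^ j) (pmass x)) * nrm ((avg ^^ j) f)"
      using x j by (intro mult_right_mono nrm_avg_pow_mono) auto
    also have "\<dots> \<le> (H * real j powr (- (CARD('n) / 4))) * (A * real j powr (- a))"
      using A H j x by (intro mult_mono) auto
    also have "\<dots> = H * A * real j powr (- ?b)"
      using powr_add[of "real j" "- a" "- (CARD('n) / 4)"] by (simp add: mult_ac)
    also have "\<dots> \<le> H * A * (3 powr ?b * real k powr (- ?b))"
      using j \<open>0 \<le> ?b\<close> A(1) H(1) by (intro mult_left_mono powr_half_le) auto
    also have "\<dots> \<le> H * A * (3 powr ?b * (3 powr ?b * real (Suc k) powr (- ?b)))"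
      using False \<open>0 \<le> ?b\<close> A(1) H(1) by (intro mult_left_mono powr_half_le) auto
    also have "\<dots> \<le> B * real (Suc k) powr (- ?b)"
      by (simp add: B_def algebra_simps)
    finally show ?thesis .
  qed
  then show ?thesis by blast
qed

definition green_sum :: "nat \<Rightarrow> (real ^ 'n \<Rightarrow> real) \<Rightarrow> real ^ 'n \<Rightarrow> real" where
  "green_sum N f x = (\<Sum>n<N. (avg ^^ n) f x)"

text \<open>
  The property that the potential of \<open>f\<close> exists as a pointwise limit with partial sums bounded uniformly over
  the vertices. In dimension 2 the series need not converge absolutely on bipartite networks, hence the
  formulation by partial sums.
\<close>

definition green_bdd :: "(real ^ 'n \<Rightarrow> real) \<Rightarrow> bool" where
  "green_bdd f \<longleftrightarrow> fs f \<and> (\<exists>B. \<forall>N. \<forall>x\<in>V. \<bar>green_sum N f x\<bar> \<le> B) \<and> (\<forall>x\<in>V. convergent (\<lambda>N. green_sum N f x))"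

definition green_l2 :: "(real ^ 'n \<Rightarrow> real) \<Rightarrow> bool" where
  "green_l2 f \<longleftrightarrow> fs f \<and> (\<exists>\<xi>. (\<lambda>x. (\<xi> x)\<^sup>2) summable_on V \<and> (\<forall>x\<in>V. (\<lambda>N. green_sum N f x) \<longlonglongrightarrow> \<xi> x))"

lemma green_sum_add: "green_sum N (\<lambda>x. u x + v x) = (\<lambda>x. green_sum N u x + green_sum N v x)"
  by (simp add: green_sum_def fun_eq_iff avg_pow_add sum.distrib)

lemma green_sum_scale: "green_sum N (\<lambda>x. a * u x) = (\<lambda>x. a * green_sum N u x)"
  by (simp add: green_sum_def fun_eq_iff avg_pow_scale sum_distrib_left)

lemma green_sum_zero: "green_sum N (\<lambda>_. 0) = (\<lambda>_. 0)"
  using green_sum_scale[of N 0 "\<lambda>_. 0"] by simp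

lemma green_sum_telescope: "green_sum N (\<lambda>x. u x - avg u x) x = u x - (avg ^^ N) u x"
proof (induction N)
  case (Suc N)
  have "(avg ^^ N) (avg u) x = (avg ^^ Suc N) u x" by (simp add: funpow_swap1)
  with Suc show ?case by (simp add: green_sum_def avg_pow_diff)
qed (simp add: green_sum_def)

lemma fs_green_sum [intro]: "fs f \<Longrightarrow> fs (green_sum N f)"
proof (induction N)
  case (Suc N)
  have "green_sum (Suc N) f = (\<lambda>x. green_sum N f x + (avg ^^ N) f x)" by (simp add: green_sum_def fun_eq_iff)
  then show ?case using Suc by auto
qed (simp add: green_sum_def[abs_def])

lemma green_bdd_zero: "green_bdd (\<lambda>_. 0)"
  by (auto simp: green_bdd_def green_sum_zero convergent_const)

lemma green_bdd_add: assumes "green_bdd u" "green_bdd v" shows "green_bdd (\<lambda>x. u x + v x)"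
proof -
  obtain A B where "\<And>N x. x \<in> V \<Longrightarrow> \<bar>green_sum N u x\<bar> \<le> A" "\<And>N x. x \<in> V \<Longrightarrow> \<bar>green_sum N v x\<bar> \<le> B"
    using assms unfolding green_bdd_def by metis
  then have "\<forall>N. \<forall>x\<in>V. \<bar>green_sum N u x + green_sum N v x\<bar> \<le> A + B"
    using abs_triangle_ineq add_mono order_trans by meson
  then show ?thesis using assms unfolding green_bdd_def green_sum_add by (auto intro: convergent_add)
qed

lemma green_bdd_scale: assumes "green_bdd u" shows "green_bdd (\<lambda>x. a * u x)"
proof -
  obtain A where "\<And>N x. x \<in> V \<Longrightarrow> \<bar>green_sum N u x\<bar> \<le> A"
    using assms unfolding green_bdd_def by metis
  then have "\<forall>N. \<forall>x\<in>V. \<bar>a * green_sum N u x\<bar> \<le> \<bar>a\<bar> * A" by (simp add: abs_mult mult_left_mono)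
  then show ?thesis using assms unfolding green_bdd_def green_sum_scale
    by (auto intro: convergent_mult convergent_const)
qed

lemma green_l2_zero: "green_l2 (\<lambda>_. 0)"
  by (auto simp: green_l2_def green_sum_zero intro!: exI[of _ "\<lambda>_. 0"])

lemma l2_add:
  fixes u v :: "'a \<Rightarrow> real"
  assumes "(\<lambda>x. (u x)\<^sup>2) summable_on S" "(\<lambda>x. (v x)\<^sup>2) summable_on S"
  shows "(\<lambda>x. (u x + v x)\<^sup>2) summable_on S"
proof (rule summable_on_comparison_test)
  show "(\<lambda>x. 2 * (u x)\<^sup>2 + 2 * (v x)\<^sup>2) summable_on S"
    by (intro summable_on_add summable_on_cmult_right assms)
  show "(u x + v x)\<^sup>2 \<le> 2 * (u x)\<^sup>2 + 2 * (v x)\<^sup>2" for x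
    using sum_squares_bound[of "u x" "v x"] by (simp add: power2_eq_square algebra_simps)
qed auto

lemma green_l2_add: assumes "green_l2 u" "green_l2 v" shows "green_l2 (\<lambda>x. u x + v x)"
proof -
  obtain \<xi> \<zeta> where 1: "(\<lambda>x. (\<xi> x)\<^sup>2) summable_on V" "\<forall>x\<in>V. (\<lambda>N. green_sum N u x) \<longlonglongrightarrow> \<xi> x"
    and 2: "(\<lambda>x. (\<zeta> x)\<^sup>2) summable_on V" "\<forall>x\<in>V. (\<lambda>N. green_sum N v x) \<longlonglongrightarrow> \<zeta> x"
    using assms unfolding green_l2_def by blast
  then show ?thesis using assms unfolding green_l2_def green_sum_add
    by (auto intro!: exI[of _ "\<lambda>x. \<xi> x + \<zeta> x"] l2_add tendsto_add)
qed

lemma green_l2_scale: assumes "green_l2 u" shows "green_l2 (\<lambda>x. a * u x)"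
proof -
  obtain \<xi> where 1: "(\<lambda>x. (\<xi> x)\<^sup>2) summable_on V" "\<forall>x\<in>V. (\<lambda>N. green_sum N u x) \<longlonglongrightarrow> \<xi> x"
    using assms unfolding green_l2_def by blast
  then show ?thesis using assms unfolding green_l2_def green_sum_scale
    by (auto intro!: exI[of _ "\<lambda>x. a * \<xi> x"] tendsto_mult summable_on_cmult_right simp: power_mult_distrib)
qed

lemma deg_bounded: "\<exists>D. \<forall>x. deg x \<le> D"
proof -
  obtain F where F: "finite F" "\<And>x. x \<in> V \<Longrightarrow> \<exists>y\<in>F. x - y \<in> Lat" using cover by blast
  have "deg x \<le> (\<Sum>y\<in>F. deg y)" for x
  proof (cases "x \<in> V")
    case True
    then obtain y where y: "y \<in> F" "x - y \<in> Lat" using F by blast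
    have "deg x = deg y" using deg_shift[OF y(2), of y] by simp
    also have "\<dots> \<le> (\<Sum>y\<in>F. deg y)" using y F by (intro member_le_sum) (auto simp: deg_nonneg)
    finally show ?thesis .
  qed (simp add: deg_outside sum_nonneg deg_nonneg)
  then show ?thesis by blast
qed

text \<open>
  \<open>P\<^sup>N \<xi> (x)\<close> is the inner product of \<open>\<xi>\<close> with \<open>P\<^sup>N (pmass x)\<close>, whose norm tends to 0.
\<close>

lemma avg_pow_l2_null:
  assumes \<xi>: "(\<lambda>x. (\<xi> x)\<^sup>2) summable_on V" and x: "x \<in> V"
  shows "(\<lambda>N. (avg ^^ N) \<xi> x) \<longlonglongrightarrow> 0"
proof -
  obtain H where H: "H \<ge> 0" "\<And>y k. y \<in> V \<Longrightarrow> k \<ge> 1 \<Longrightarrow> nrm ((avg ^^ k) (pmass y)) \<le> H * real k powr (- (CARD('n) / 4))"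
    using heat_kernel_powr by blast
  obtain D where D: "\<And>x. deg x \<le> D" using deg_bounded by blast
  have D0: "0 \<le> D" using D[of 0] deg_nonneg[of 0] by linarith
  define S where "S = sqrt (D * (\<Sum>\<^sub>\<infinity>x\<in>V. (\<xi> x)\<^sup>2))"
  have S0: "0 \<le> S" unfolding S_def using D0 by (simp add: infsum_nonneg)
  have "\<bar>(avg ^^ N) \<xi> x\<bar> \<le> H * S * real N powr (- (CARD('n) / 4))" if N: "N \<ge> 1" for N
  proof -
    let ?u = "(avg ^^ N) (pmass x)"
    have u: "finite (supp ?u)" "supp ?u \<subseteq> V" using fs_avg_pow[OF fs_pmass[OF x], of N] by (auto simp: fs_def)
    have "(\<Sum>y\<in>supp ?u. deg y * (\<xi> y)\<^sup>2) \<le> (\<Sum>y\<in>supp ?u. D * (\<xi> y)\<^sup>2)"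
      by (intro sum_mono mult_right_mono D) auto
    also have "\<dots> \<le> D * (\<Sum>\<^sub>\<infinity>x\<in>V. (\<xi> x)\<^sup>2)"
      unfolding sum_distrib_left[symmetric]
      using D0 u by (intro mult_left_mono finite_sum_le_infsum[OF \<xi>]) auto
    finally have L: "L2_set (\<lambda>y. sqrt (deg y) * \<xi> y) (supp ?u) \<le> S"
      unfolding L2_set_def S_def by (simp add: power_mult_distrib deg_nonneg)
    have "\<bar>(avg ^^ N) \<xi> x\<bar> = \<bar>ip ?u \<xi>\<bar>"
      using ip_avg_pow[OF fs_pmass[OF x], of N \<xi>] by (simp add: ip_pmass x)
    also have "\<dots> \<le> nrm ?u * L2_set (\<lambda>y. sqrt (deg y) * \<xi> y) (supp ?u)"
      by (rule ip_le_L2[OF u(1)]) simp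
    also have "\<dots> \<le> (H * real N powr (- (CARD('n) / 4))) * S"
      using H N x L by (intro mult_mono) auto
    finally show ?thesis by (simp add: mult_ac)
  qed
  then have ev: "\<forall>\<^sub>F N in sequentially. norm ((avg ^^ N) \<xi> x) \<le> H * S * real N powr (- (CARD('n) / 4))"
    unfolding real_norm_def by (intro eventually_sequentiallyI[of 1])
  have "(\<lambda>N. H * S * real N powr (- (CARD('n) / 4))) \<longlonglongrightarrow> H * S * 0"
    by (intro tendsto_mult tendsto_const tendsto_neg_powr filterlim_real_sequentially) simp
  then have "(\<lambda>N. H * S * real N powr (- (CARD('n) / 4))) \<longlonglongrightarrow> 0"
    by (simp only: mult_zero_right)
  then show ?thesis by (rule Lim_null_comparison[OF ev])
qed

lemma fs_l2: "fs u \<Longrightarrow> (\<lambda>x. (u x)\<^sup>2) summable_on V"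
  by (rule finite_nonzero_values_imp_summable_on) (rule finite_subset[of _ "supp u"], auto simp: fs_def supp_def)

lemma green_bdd_laplacian: assumes u: "fs u" shows "green_bdd (\<lambda>x. u x - avg u x)"
proof -
  let ?B = "\<Sum>y\<in>supp u. \<bar>u y\<bar>"
  have ub: "\<bar>u x\<bar> \<le> ?B" for x
  proof (cases "x \<in> supp u")
    case True
    then show ?thesis using u by (intro member_le_sum) (auto simp: fs_def)
  qed (simp add: supp_def sum_nonneg)
  have "\<bar>green_sum N (\<lambda>x. u x - avg u x) x\<bar> \<le> 2 * ?B" if "x \<in> V" for x N
    unfolding green_sum_telescope using avg_pow_abs_bound[of u ?B, OF ub that, of N] ub[of x] by linarith
  moreover have "convergent (\<lambda>N. green_sum N (\<lambda>x. u x - avg u x) x)" if "x \<in> V" for x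
    unfolding green_sum_telescope using avg_pow_l2_null[OF fs_l2[OF u] that]
    by (intro convergent_diff convergent_const) (auto simp: convergent_def)
  ultimately show ?thesis using u unfolding green_bdd_def by blast
qed

lemma green_l2_laplacian: assumes u: "fs u" shows "green_l2 (\<lambda>x. u x - avg u x)"
proof -
  have "(\<lambda>N. green_sum N (\<lambda>x. u x - avg u x) x) \<longlonglongrightarrow> u x" if "x \<in> V" for x
    unfolding green_sum_telescope using tendsto_diff[OF tendsto_const avg_pow_l2_null[OF fs_l2[OF u] that], of "u x"] by simp
  then show ?thesis using u fs_l2[OF u] unfolding green_l2_def by blast
qed

lemma summable_powr_Suc: "b > 1 \<Longrightarrow> summable (\<lambda>k. A * real (Suc k) powr (- b))"
  using summable_real_powr_iff[of "- b"] by (intro summable_mult, subst summable_Suc_iff) auto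

lemma green_bdd_decays:
  assumes f: "decays a f" and a: "0 \<le> a" "a + CARD('n) / 4 > 1"
  shows "green_bdd f"
proof -
  obtain A where A: "\<And>x k. x \<in> V \<Longrightarrow> \<bar>(avg ^^ k) f x\<bar> \<le> A * real (Suc k) powr (- (a + CARD('n) / 4))"
    using decays_pointwise[OF f a(1)] by blast
  note S = summable_powr_Suc[OF a(2), of A]
  have A0: "0 \<le> A" using A[OF zero_V, of 0] abs_ge_zero order_trans by fastforce
  have "\<bar>green_sum N f x\<bar> \<le> (\<Sum>k. A * real (Suc k) powr (- (a + CARD('n) / 4)))" if x: "x \<in> V" for N x
  proof -
    have "\<bar>green_sum N f x\<bar> \<le> (\<Sum>k<N. A * real (Suc k) powr (- (a + CARD('n) / 4)))"
      unfolding green_sum_def by (rule order_trans[OF sum_abs sum_mono]) (use A[OF x] in simp)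
    also have "\<dots> \<le> (\<Sum>k. A * real (Suc k) powr (- (a + CARD('n) / 4)))"
      using A0 by (intro sum_le_suminf[OF S]) auto
    finally show ?thesis .
  qed
  moreover have "convergent (\<lambda>N. green_sum N f x)" if x: "x \<in> V" for x
    using summable_comparison_test'[OF S, of 0 "\<lambda>k. (avg ^^ k) f x"] A[OF x]
    unfolding green_sum_def summable_iff_convergent by simp
  moreover have "fs f" using f by (simp add: decays_def)
  ultimately show ?thesis unfolding green_bdd_def by blast
qed

text \<open>
  The norms of \<open>P\<^sup>k f\<close> are summable, so the norms of the partial sums are bounded; a pointwise limit of functions
  with bounded square norm is square summable.
\<close>

lemma green_l2_decays:
  assumes f: "decays a f" and a: "a > 1"
  shows "green_l2 f"
proof -
  obtain A where A: "A \<ge> 0" "\<And>k. k \<ge> 1 \<Longrightarrow> nrm ((avg ^^ k) f) \<le> A * real k powr (- a)" and fsf: "fs f"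
    using f by (auto simp: decays_def)
  have "green_bdd f" using green_bdd_decays[OF f] a by (simp add: add_pos_nonneg)
  then obtain \<xi> where \<xi>: "\<And>x. x \<in> V \<Longrightarrow> (\<lambda>N. green_sum N f x) \<longlonglongrightarrow> \<xi> x"
    unfolding green_bdd_def convergent_def by metis
  note S = summable_powr_Suc[OF a, of A]
  define B where "B = nrm f + (\<Sum>k. A * real (Suc k) powr (- a))"
  have nS: "nrm (green_sum (Suc N) f) \<le> nrm f + (\<Sum>k<N. A * real (Suc k) powr (- a))" for N
  proof (induction N)
    case (Suc N)
    have "green_sum (Suc (Suc N)) f = (\<lambda>x. green_sum (Suc N) f x + (avg ^^ Suc N) f x)"
      by (simp add: green_sum_def fun_eq_iff)
    then have "nrm (green_sum (Suc (Suc N)) f) \<le> nrm (green_sum (Suc N) f) + nrm ((avg ^^ Suc N) f)"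
      using nrm_triangle[of "green_sum (Suc N) f" "(avg ^^ Suc N) f"] fsf by (metis fs_avg_pow fs_green_sum)
    with Suc A(2)[of "Suc N"] show ?case by simp
  qed (simp add: green_sum_def[abs_def])
  have nB: "nrm (green_sum (Suc N) f) \<le> B" for N
    unfolding B_def using nS[of N] sum_le_suminf[OF S, of "{..<N}"] A(1) by simp
  have "(\<lambda>x. (\<xi> x)\<^sup>2) summable_on V"
  proof (rule nonneg_bdd_above_summable_on)
    show "bdd_above (sum (\<lambda>x. (\<xi> x)\<^sup>2) ` {F. F \<subseteq> V \<and> finite F})"
    proof (rule bdd_aboveI2[of _ _ "B\<^sup>2"], clarify)
      fix F assume F: "F \<subseteq> V" "finite F"
      have "(\<Sum>x\<in>F. (green_sum (Suc N) f x)\<^sup>2) \<le> B\<^sup>2" for N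
      proof -
        let ?g = "green_sum (Suc N) f"
        have g: "finite (supp ?g)" using fs_green_sum[OF fsf] by (simp add: fs_def)
        have "(\<Sum>x\<in>F. (?g x)\<^sup>2) \<le> (\<Sum>x\<in>F. deg x * ?g x * ?g x)"
        proof (rule sum_mono)
          fix x assume "x \<in> F"
          then have "1 \<le> deg x" using F deg_ge_1 by auto
          then show "(?g x)\<^sup>2 \<le> deg x * ?g x * ?g x" 
            by (simp add: power2_eq_square mult.assoc mult_le_cancel_right1)
        qed
        also have "\<dots> \<le> (\<Sum>x\<in>F \<union> supp ?g. deg x * ?g x * ?g x)"
          using F g by (intro sum_mono2) (auto simp: deg_nonneg mult.assoc)
        also have "\<dots> = (nrm ?g)\<^sup>2"
          unfolding nrm_sq using F g by (intro ip_eq[symmetric]) auto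
        also have "\<dots> \<le> B\<^sup>2" using nB[of N] by (intro power_mono) auto
        finally show ?thesis .
      qed
      moreover have "(\<lambda>N. \<Sum>x\<in>F. (green_sum (Suc N) f x)\<^sup>2) \<longlonglongrightarrow> (\<Sum>x\<in>F. (\<xi> x)\<^sup>2)"
        using F \<xi> by (intro tendsto_sum tendsto_power LIMSEQ_Suc) auto
      ultimately show "(\<Sum>x\<in>F. (\<xi> x)\<^sup>2) \<le> B\<^sup>2"
        by (intro LIMSEQ_le_const2) auto
    qed
  qed auto
  then show ?thesis using fsf \<xi> unfolding green_l2_def by blast
qed

end


section \<open>Finitely supported functions with vanishing moments\<close>

text \<open>
  If \<open>f\<close> were not in the span of \<open>S\<close>, some linear functional would vanish on \<open>S\<close> but not at \<open>f\<close>. On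
  finitely supported functions a functional is summation against the function \<open>w\<close> of its values at unit
  masses. The conclusion is phrased as closure of a class \<open>G\<close> under linear combinations, which is how spans
  are used below.
\<close>

lemma finite_support_duality:
  fixes S :: "('a \<Rightarrow> real) set" and f :: "'a \<Rightarrow> real"
  assumes S: "\<And>s. s \<in> S \<Longrightarrow> finite {x. s x \<noteq> 0}" and f: "finite {x. f x \<noteq> 0}"
    and ann: "\<And>w. (\<And>s. s \<in> S \<Longrightarrow> (\<Sum>x | s x \<noteq> 0. s x * w x) = 0) \<Longrightarrow> (\<Sum>x | f x \<noteq> 0. f x * w x) = 0"
    and G0: "G (\<lambda>_. 0)"
    and Gadd: "\<And>u v. G u \<Longrightarrow> G v \<Longrightarrow> G (\<lambda>x. u x + v x)"
    and Gscale: "\<And>a u. G u \<Longrightarrow> G (\<lambda>x. a * u x)"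
    and GS: "\<And>s. s \<in> S \<Longrightarrow> G s"
  shows "G f"
proof -
  define sc where "sc = (\<lambda>(a::real) (u::'a \<Rightarrow> real) x. a * u x)"
  interpret V: vector_space sc
    by standard (auto simp: sc_def fun_eq_iff algebra_simps)
  interpret VP: vector_space_pair sc "(*) :: real \<Rightarrow> real \<Rightarrow> real"
    by standard (auto simp: algebra_simps)
  have "f \<in> V.span S"
  proof (rule ccontr)
    assume nf: "f \<notin> V.span S"
    obtain B where B: "B \<subseteq> S" "V.independent B" "S \<subseteq> V.span B"
      using V.maximal_independent_subset[of S] by blast
    have "V.span B = V.span S"
      using B by (metis V.span_mono V.span_span subset_antisym)
    then have nfB: "f \<notin> V.span B" using nf by simp
    then have ind: "V.independent (insert f B)" using B(2) by (simp add: V.independent_insertI)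
    obtain g where g: "Vector_Spaces.linear sc (*) g" "\<And>x. x \<in> insert f B \<Longrightarrow> g x = (if x = f then 1 else 0)"
      using VP.linear_independent_extend[OF ind, of "\<lambda>x. if x = f then 1 else 0"] by blast
    have fB: "f \<notin> B" using nfB V.span_base by blast
    have gB: "g x = 0" if "x \<in> V.span B" for x
      using that
    proof (induction rule: V.span_induct_alt)
      case base
      then show ?case using VP.linear_0[OF g(1)] by (simp add: zero_fun_def)
    next
      case (step a x y)
      then have "g x = 0" using g(2)[of x] fB by auto
      then show ?case using step VP.linear_add[OF g(1), of "sc a x" y] VP.linear_scale[OF g(1), of a x]
        by (simp add: plus_fun_def)
    qed
    define e where "e = (\<lambda>(y::'a) x. if x = y then (1::real) else 0)"
    have rep: "g u = (\<Sum>y | u y \<noteq> 0. u y * g (e y))" if "finite {y. u y \<noteq> 0}" for u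
    proof -
      have sumfun: "(\<Sum>y\<in>A. h y) x = (\<Sum>y\<in>A. h y x)" if "finite A" for A :: "'a set" and h :: "'a \<Rightarrow> 'a \<Rightarrow> real" and x
        using that by (induction A) auto
      have "u = (\<Sum>y | u y \<noteq> 0. sc (u y) (e y))"
        using that by (auto simp: fun_eq_iff sumfun sc_def e_def sum.delta if_distrib[of "\<lambda>t. _ * t"] cong: if_cong)
      then have "g u = (\<Sum>y | u y \<noteq> 0. g (sc (u y) (e y)))"
        using VP.linear_sum[OF g(1), of "\<lambda>y. sc (u y) (e y)" "{y. u y \<noteq> 0}"] by simp
      then show ?thesis using VP.linear_scale[OF g(1)] by simp
    qed
    have "(\<Sum>x | f x \<noteq> 0. f x * g (e x)) = 0"
    proof (rule ann)
      fix s assume "s \<in> S"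
      then show "(\<Sum>x | s x \<noteq> 0. s x * g (e x)) = 0"
        using rep[OF S, of s] gB[of s] B(3) by auto
    qed
    then show False using rep[OF f] g(2)[of f] by simp
  qed
  then show ?thesis
  proof (induction rule: V.span_induct_alt)
    case base
    then show ?case using G0 by (simp add: zero_fun_def)
  next
    case (step a x y)
    then show ?case using Gadd[OF Gscale[OF GS], of x y a] by (simp add: sc_def plus_fun_def)
  qed
qed

context periodic_network
begin

definition linear_class :: "((real ^ 'n \<Rightarrow> real) \<Rightarrow> bool) \<Rightarrow> bool" where
  "linear_class G \<longleftrightarrow> G (\<lambda>_. 0) \<and> (\<forall>u v. G u \<longrightarrow> G v \<longrightarrow> G (\<lambda>x. u x + v x)) \<and> (\<forall>a u. G u \<longrightarrow> G (\<lambda>x. a * u x))"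

text \<open>
  The duality for the degree-weighted pairing: the weight is absorbed into \<open>w\<close>.
\<close>

lemma network_duality:
  assumes S: "\<And>s. s \<in> S \<Longrightarrow> fs s" and f: "fs f"
    and ann: "\<And>w. (\<And>s. s \<in> S \<Longrightarrow> ip s w = 0) \<Longrightarrow> ip f w = 0"
    and G: "linear_class G" and GS: "\<And>s. s \<in> S \<Longrightarrow> G s"
  shows "G f"
proof (rule finite_support_duality[of S f G])
  fix w assume w: "\<And>s. s \<in> S \<Longrightarrow> (\<Sum>x | s x \<noteq> 0. s x * w x) = 0"
  have eq: "ip u (\<lambda>x. w x / deg x) = (\<Sum>x | u x \<noteq> 0. u x * w x)" if "fs u" for u
    unfolding ip_def using that deg_pos
    by (intro sum.cong) (fastforce simp: fs_def supp_def)+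
  show "(\<Sum>x | f x \<noteq> 0. f x * w x) = 0"
    using ann[of "\<lambda>x. w x / deg x"] w S f by (simp add: eq)
next
  show "finite {x. f x \<noteq> 0}" using f by (simp add: fs_def supp_def)
  show "finite {x. s x \<noteq> 0}" if "s \<in> S" for s using S[OF that] by (simp add: fs_def supp_def)
  show "G (\<lambda>_. 0)" using G unfolding linear_class_def by blast
  show "G (\<lambda>x. u x + v x)" if "G u" "G v" for u v
    using G that unfolding linear_class_def by blast
  show "G (\<lambda>x. a * u x)" if "G u" for a u
    using G that unfolding linear_class_def by blast
qed (use GS in blast)

text \<open>
  The maximum is attained and propagates from a vertex to its neighbours, hence everywhere.
\<close>

lemma harmonic_max:
  assumes harm: "\<And>x. x \<in> V \<Longrightarrow> avg w x = w x" and fin: "finite (w ` V)"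
  shows "\<exists>a. \<forall>x\<in>V. w x = a"
proof -
  define m where "m = Max (w ` V)"
  have le: "w x \<le> m" if "x \<in> V" for x using fin that by (simp add: m_def)
  obtain x0 where x0: "x0 \<in> V" "w x0 = m"
  proof -
    have "m \<in> w ` V" unfolding m_def using Max_in[OF fin] zero_V by blast
    then show ?thesis using that by blast
  qed
  have step: "w y = m" if x: "x \<in> V" "w x = m" "c x y \<noteq> 0" for x y
  proof -
    have "(\<Sum>z\<in>nb x. c x z * (m - w z)) = deg x * m - deg x * avg w x"
      unfolding deg_avg by (simp add: right_diff_distrib sum_subtractf sum_distrib_right deg_def)
    also have "\<dots> = 0" using harm[OF x(1)] x(2) by simp
    finally have "\<forall>z\<in>nb x. c x z * (m - w z) = 0"
      by (subst (asm) sum_nonneg_eq_0_iff) (auto intro!: mult_nonneg_nonneg c_nonneg le nb_V)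
    then show ?thesis using x(3) by (auto simp: nb_def)
  qed
  have "w x = m" if "x \<in> V" for x
  proof -
    have "(x0, x) \<in> {(x, y). c x y \<noteq> 0}\<^sup>*" using connected x0 that by blast
    then have "x \<in> V \<and> w x = m"
    proof (induction rule: rtrancl_induct)
      case (step y z)
      then show ?case using \<open>\<And>x y. x \<in> V \<Longrightarrow> w x = m \<Longrightarrow> c x y \<noteq> 0 \<Longrightarrow> w y = m\<close> c_vertices' by auto
    qed (use x0 in auto)
    then show ?thesis by simp
  qed
  then show ?thesis by blast
qed

text \<open>
  Halving the coordinates of a lattice vector leaves remainders in \<open>{0, 1}\<close>, so doubled lattice vectors have
  finitely many cosets in the lattice.
\<close>

lemma Lat_parity: assumes "l \<in> Lat" shows "\<exists>m\<in>Lat. \<exists>r. (\<forall>i. r i < 2) \<and> l = 2 *\<^sub>R m + lvec r"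
proof -
  obtain z where z: "l = M *v z" "\<forall>i. z $ i \<in> \<int>" using assms by (auto simp: Lat_eq)
  define q where "q = (\<chi> i. real_of_int (\<lfloor>z $ i\<rfloor> div 2))"
  define r where "r i = nat (\<lfloor>z $ i\<rfloor> mod 2)" for i
  have "z $ i = real_of_int \<lfloor>z $ i\<rfloor>" for i using z(2) by (metis Ints_cases floor_of_int)
  moreover have "real_of_int t = 2 * real_of_int (t div 2) + real (nat (t mod 2))" for t
  proof -
    have "t = 2 * (t div 2) + int (nat (t mod 2))" by simp
    then show ?thesis by (metis of_int_add of_int_mult of_int_numeral of_int_of_nat_eq)
  qed
  ultimately have "z $ i = 2 * q $ i + real (r i)" for i
    unfolding q_def r_def vec_lambda_beta by metis
  then have "z = 2 *\<^sub>R q + (\<chi> i. real (r i))"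
    unfolding vec_eq_iff vector_add_component vector_scaleR_component vec_lambda_beta by simp
  then have "l = 2 *\<^sub>R (M *v q) + lvec r"
    unfolding z(1) lvec_def matrix_vector_mult_scaleR[symmetric] matrix_vector_right_distrib[symmetric] by simp
  moreover have "M *v q \<in> Lat" unfolding Lat_eq by (auto simp: q_def intro!: exI[of _ q])
  moreover have "\<forall>i. r i < 2" by (auto simp: r_def)
  ultimately show ?thesis by blast
qed

lemma double_periodic_finite:
  assumes per: "\<And>x l. x \<in> V \<Longrightarrow> l \<in> Lat \<Longrightarrow> w (x + 2 *\<^sub>R l) = w x"
  shows "finite (w ` V)"
proof -
  obtain F where F: "finite F" "F \<subseteq> V" "\<And>x. x \<in> V \<Longrightarrow> \<exists>y\<in>F. x - y \<in> Lat" using cover by blast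
  define R where "R = (UNIV :: 'n set) \<rightarrow>\<^sub>E {..<2::nat}"
  have "finite R" unfolding R_def by (intro finite_PiE) auto
  have "w ` V \<subseteq> (\<lambda>(y, r). w (y + lvec r)) ` (F \<times> R)"
  proof (rule image_subsetI)
    fix x assume x: "x \<in> V"
    then obtain y where y: "y \<in> F" "x - y \<in> Lat" using F by blast
    obtain m r where m: "m \<in> Lat" "\<forall>i. r i < (2::nat)" "x - y = 2 *\<^sub>R m + lvec r" using Lat_parity[OF y(2)] by blast
    have "x = (y + lvec r) + 2 *\<^sub>R m" using m(3) by (metis add.commute add.assoc diff_add_cancel)
    moreover have "y + lvec r \<in> V" using V_shift lvec_Lat y F by blast
    ultimately have "w x = w (y + lvec r)" using per m(1) by metis
    then show "w x \<in> (\<lambda>(y, r). w (y + lvec r)) ` (F \<times> R)"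
      using y m by (intro image_eqI[of _ _ "(y, r)"]) (auto simp: R_def)
  qed
  then show ?thesis using F \<open>finite R\<close> finite_subset by blast
qed

lemma double_periodic_harmonic_const:
  assumes "\<And>x. x \<in> V \<Longrightarrow> avg w x = w x"
    and "\<And>x l. x \<in> V \<Longrightarrow> l \<in> Lat \<Longrightarrow> sdiff l w x = 0"
  shows "\<exists>a. \<forall>x\<in>V. w x = a"
  using assms by (intro harmonic_max double_periodic_finite) (auto simp only: sdiff_def right_minus_eq)

lemma ip_sdiff: assumes "fs u" "l \<in> Lat" shows "ip (sdiff l u) v = ip u (sdiff (- l) v)"
proof -
  let ?l = "2 *\<^sub>R l"
  have l: "?l \<in> Lat" using Lat_double assms by blast
  have "ip (\<lambda>x. u (x + ?l)) v = ip u (\<lambda>x. v (x - ?l))"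
    unfolding ip_def supp_shift
    using deg_shift[OF l, of "_ - ?l"] by (subst sum.reindex) (auto simp: inj_on_def)
  then show ?thesis
    unfolding sdiff_def using assms l
    by (subst ip_diff_left) (auto simp: ip_diff_right)
qed

lemma ip_pmass_laplacian: assumes "x \<in> V"
  shows "ip (\<lambda>z. pmass x z - avg (pmass x) z) w = w x - avg w x"
  using assms by (simp add: ip_diff_left fs_pmass fs_avg ip_pmass ip_avg)

lemma span_point_masses:
  assumes f: "fs f" and G: "linear_class G" and pmass: "\<And>x. x \<in> V \<Longrightarrow> G (pmass x)"
  shows "G f"
proof (rule network_duality[of "pmass ` V" f G])
  fix w assume w: "\<And>s. s \<in> pmass ` V \<Longrightarrow> ip s w = 0"
  have "w x = 0" if "x \<in> V" for x using w[of "pmass x"] that by (simp add: ip_pmass)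
  then show "ip f w = 0" using f by (auto simp: ip_def fs_def intro!: sum.neutral)
qed (use f G pmass in auto)

text \<open>
  By duality: a function \<open>w\<close> orthogonal to all Laplacians of point masses is harmonic, and one orthogonal to
  all \<open>sdiff l (pmass x)\<close> is periodic; together they make \<open>w\<close> constant, so it is orthogonal to \<open>f\<close>.
\<close>

lemma span_zero_sum:
  assumes f: "fs f" "ip f (\<lambda>_. 1) = 0" and G: "linear_class G"
    and lap: "\<And>x. x \<in> V \<Longrightarrow> G (\<lambda>z. pmass x z - avg (pmass x) z)"
    and sdiff: "\<And>x l. x \<in> V \<Longrightarrow> l \<in> Lat \<Longrightarrow> G (sdiff l (pmass x))"
  shows "G f"
proof (rule network_duality[of "(\<lambda>x z. pmass x z - avg (pmass x) z) ` V \<union> (\<lambda>(x, l). sdiff l (pmass x)) ` (V \<times> Lat)" f G])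
  fix w assume w: "\<And>s. s \<in> (\<lambda>x z. pmass x z - avg (pmass x) z) ` V \<union> (\<lambda>(x, l). sdiff l (pmass x)) ` (V \<times> Lat) \<Longrightarrow> ip s w = 0"
  have "avg w x = w x" if "x \<in> V" for x
    using w[of "\<lambda>z. pmass x z - avg (pmass x) z"] ip_pmass_laplacian[OF that, of w] that by auto
  moreover have "sdiff l w x = 0" if "x \<in> V" "l \<in> Lat" for x l
  proof -
    have "sdiff (- l) (pmass x) \<in> (\<lambda>(x, l). sdiff l (pmass x)) ` (V \<times> Lat)"
      using that Lat_uminus by (intro image_eqI[of _ _ "(x, - l)"]) auto
    then show ?thesis
      using w[of "sdiff (- l) (pmass x)"] ip_sdiff[OF fs_pmass[OF that(1)] Lat_uminus[OF that(2)], of w] ip_pmass[OF that(1)] by simp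
  qed
  ultimately obtain a where a: "\<And>x. x \<in> V \<Longrightarrow> w x = a" using double_periodic_harmonic_const by blast
  have "ip f w = ip f (\<lambda>x. a * 1)" using a f by (intro ip_cong) (auto simp: fs_def)
  then show "ip f w = 0" using f by (simp only: ip_scale_right)
qed (use f G lap sdiff in auto)

text \<open>
  The columns of \<open>M\<close> generate the lattice as a group.
\<close>

lemma Lat_hom_unique:
  assumes add: "\<And>l m. l \<in> Lat \<Longrightarrow> m \<in> Lat \<Longrightarrow> \<beta> (l + m) = \<beta> l + (\<beta> m :: real)"
    and col: "\<And>i. \<beta> (column i M) = 0" and l: "l \<in> Lat"
  shows "\<beta> l = 0"
proof -
  have z: "\<beta> 0 = 0" using add[of 0 0] by simp
  have k: "\<beta> (real k *\<^sub>R column i M) = 0" for k i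
    by (induction k) (use add[OF column_Lat Lat_of_nat[OF column_Lat]] col z in \<open>auto simp: scaleR_add_left\<close>)
  have s: "\<beta> (\<Sum>i\<in>A. real (p i) *\<^sub>R column i M) = 0" if "finite A" for A p
    using that
  proof (induction A)
    case (insert i A)
    have "\<beta> (real (p i) *\<^sub>R column i M + (\<Sum>i\<in>A. real (p i) *\<^sub>R column i M))
       = \<beta> (real (p i) *\<^sub>R column i M) + \<beta> (\<Sum>i\<in>A. real (p i) *\<^sub>R column i M)"
      by (intro add Lat_sum Lat_of_nat column_Lat)
    with insert k show ?case by simp
  qed (use z in simp)
  then have lv: "\<beta> (lvec p) = 0" for p unfolding lvec_eq by simp
  obtain z where z: "l = M *v z" "\<forall>i. z $ i \<in> \<int>" using l by (auto simp: Lat_eq)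
  define p where "p i = nat \<lfloor>z $ i\<rfloor>" for i
  define q where "q i = nat (- \<lfloor>z $ i\<rfloor>)" for i
  have "z $ i = real_of_int \<lfloor>z $ i\<rfloor>" for i using z(2) by (metis Ints_cases floor_of_int)
  moreover have "real_of_int t = real (nat t) - real (nat (- t))" for t
    by (cases "t \<ge> 0") auto
  ultimately have "z $ i = real (p i) - real (q i)" for i
    unfolding p_def q_def by metis
  then have "z + (\<chi> i. real (q i)) = (\<chi> i. real (p i))"
    unfolding vec_eq_iff vector_add_component vec_lambda_beta by simp
  then have "l + lvec q = lvec p"
    unfolding z(1) lvec_def matrix_vector_right_distrib[symmetric] by simp
  then show ?thesis using add[OF l lvec_Lat, of q] lv by simp
qed

lemma linear_matching_columns:
  fixes t :: "'n \<Rightarrow> real"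
  shows "\<exists>b. \<forall>j. (\<Sum>i\<in>UNIV. b i * column j M $ i) = t j"
proof -
  obtain N where N: "N ** M = mat 1" using invertible_M unfolding invertible_def by blast
  have "(\<Sum>i\<in>UNIV. (\<Sum>k\<in>UNIV. t k * N $ k $ i) * column j M $ i) = t j" for j
  proof -
    have "(\<Sum>i\<in>UNIV. (\<Sum>k\<in>UNIV. t k * N $ k $ i) * column j M $ i) = (\<Sum>k\<in>UNIV. t k * (N ** M) $ k $ j)"
      unfolding matrix_matrix_mult_def column_def sum_distrib_right sum_distrib_left
      by (subst sum.swap) (simp add: sum_distrib_left mult.assoc)
    then show ?thesis unfolding N by (simp add: mat_def if_distrib[of "\<lambda>x. _ * x"] cong: if_cong)
  qed
  then show ?thesis by (intro exI[of _ "\<lambda>i. \<Sum>k\<in>UNIV. t k * N $ k $ i"] allI)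
qed

text \<open>
  By duality again: if \<open>w\<close> is harmonic with vanishing second differences, each difference \<open>sdiff m w\<close> is
  harmonic and periodic, hence a constant \<open>\<beta> m\<close>, and \<open>\<beta>\<close> is additive in \<open>m\<close>. Subtracting the combination
  of the coordinates \<open>h i\<close> with the same differences leaves a periodic harmonic function, that is, a constant.
  So \<open>w\<close> is an affine function of \<open>h\<close>, and these are orthogonal to \<open>f\<close>.
\<close>

lemma span_zero_moments:
  fixes h :: "'n \<Rightarrow> real ^ 'n \<Rightarrow> real"
  assumes h_harm: "\<And>i x. x \<in> V \<Longrightarrow> avg (h i) x = h i x"
    and h_shift: "\<And>i x l. x \<in> V \<Longrightarrow> l \<in> Lat \<Longrightarrow> h i (x + l) = h i x + l $ i"
    and f: "fs f" "ip f (\<lambda>_. 1) = 0" "\<And>i. ip f (h i) = 0" and G: "linear_class G"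
    and lap: "\<And>x. x \<in> V \<Longrightarrow> G (\<lambda>z. pmass x z - avg (pmass x) z)"
    and sdiff: "\<And>x l m. x \<in> V \<Longrightarrow> l \<in> Lat \<Longrightarrow> m \<in> Lat \<Longrightarrow> G (sdiff l (sdiff m (pmass x)))"
  shows "G f"
proof (rule network_duality[of "(\<lambda>x z. pmass x z - avg (pmass x) z) ` V \<union> (\<lambda>(x, l, m). sdiff l (sdiff m (pmass x))) ` (V \<times> Lat \<times> Lat)" f G])
  fix w assume w: "\<And>s. s \<in> (\<lambda>x z. pmass x z - avg (pmass x) z) ` V \<union> (\<lambda>(x, l, m). sdiff l (sdiff m (pmass x))) ` (V \<times> Lat \<times> Lat) \<Longrightarrow> ip s w = 0"
  have harm: "avg w x = w x" if "x \<in> V" for x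
    using w[of "\<lambda>z. pmass x z - avg (pmass x) z"] ip_pmass_laplacian[OF that, of w] that by auto
  have second: "sdiff l (sdiff m w) x = 0" if "x \<in> V" "l \<in> Lat" "m \<in> Lat" for x l m
  proof -
    have "ip (sdiff (- m) (sdiff (- l) (pmass x))) w = sdiff l (sdiff m w) x"
      using that by (simp add: ip_sdiff fs_sdiff fs_pmass Lat_uminus ip_pmass)
    moreover have "sdiff (- m) (sdiff (- l) (pmass x)) \<in> (\<lambda>(x, l, m). sdiff l (sdiff m (pmass x))) ` (V \<times> Lat \<times> Lat)"
      using that Lat_uminus by (intro image_eqI[of _ _ "(x, - m, - l)"]) auto
    ultimately show ?thesis using w by auto
  qed
  have sdiff_harm: "avg (sdiff m u) x = sdiff m u x" if "\<And>x. x \<in> V \<Longrightarrow> avg u x = u x" "m \<in> Lat" "x \<in> V" for u m x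
    using avg_sdiff[OF that(2), of 1 u] that(1)[of x] that(1)[of "x + 2 *\<^sub>R m"] that(3) V_shift[OF Lat_double[OF that(2)] that(3)]
    by (simp add: sdiff_def)
  have "\<exists>a. \<forall>x\<in>V. sdiff m w x = a" if "m \<in> Lat" for m
    using double_periodic_harmonic_const[of "sdiff m w"] sdiff_harm[OF harm that] second[OF _ _ that] by blast
  then obtain \<beta> where \<beta>: "\<And>m x. m \<in> Lat \<Longrightarrow> x \<in> V \<Longrightarrow> sdiff m w x = \<beta> m" by metis
  have \<beta>_add: "\<beta> (l + m) = \<beta> l + \<beta> m" if "l \<in> Lat" "m \<in> Lat" for l m
  proof -
    have "2 *\<^sub>R l \<in> V" using Lat_double[OF that(1)] Lat_subset_V by blast
    then have "w (2 *\<^sub>R l + 2 *\<^sub>R m) - w (2 *\<^sub>R l) = \<beta> m"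
      using \<beta>[OF that(2)] unfolding sdiff_def by blast
    moreover have "w (2 *\<^sub>R l) - w 0 = \<beta> l" "w (2 *\<^sub>R l + 2 *\<^sub>R m) - w 0 = \<beta> (l + m)"
      using \<beta>[OF that(1) zero_V] \<beta>[OF Lat_add[OF that] zero_V] unfolding sdiff_def add_0 scaleR_add_right by blast+
    ultimately show ?thesis by linarith
  qed
  obtain b where b: "\<And>j. (\<Sum>i\<in>UNIV. b i * column j M $ i) = \<beta> (column j M)"
    using linear_matching_columns[of "\<lambda>j. \<beta> (column j M)"] by blast
  have \<beta>_eq: "\<beta> l = (\<Sum>i\<in>UNIV. b i * l $ i)" if "l \<in> Lat" for l
  proof -
    have "(\<lambda>l. \<beta> l - (\<Sum>i\<in>UNIV. b i * l $ i)) l = 0"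
      by (rule Lat_hom_unique[OF _ _ that]) (auto simp: b \<beta>_add distrib_left sum.distrib)
    then show ?thesis by simp
  qed
  define w' where "w' x = w x - (\<Sum>i\<in>UNIV. b i / 2 * h i x)" for x
  have "avg w' x = w' x" if "x \<in> V" for x
  proof -
    have "avg (\<lambda>x. \<Sum>i\<in>A. b i / 2 * h i x) x = (\<Sum>i\<in>A. b i / 2 * h i x)" for A
    proof (induction A rule: infinite_finite_induct)
      case (insert i A)
      then show ?case using avg_scale[of "b i / 2" "h i"] h_harm[OF that, of i] by (simp add: avg_add)
    qed (use avg_const[OF that, of 0] in auto)
    then show ?thesis unfolding w'_def avg_diff using harm[OF that] by simp
  qed
  moreover have "sdiff l w' x = 0" if "x \<in> V" "l \<in> Lat" for x l
  proof -
    have "sdiff l w' x = sdiff l w x - (\<Sum>i\<in>UNIV. b i / 2 * (h i (x + 2 *\<^sub>R l) - h i x))"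
      by (simp only: sdiff_def w'_def right_diff_distrib sum_subtractf)
    also have "(\<Sum>i\<in>UNIV. b i / 2 * (h i (x + 2 *\<^sub>R l) - h i x)) = \<beta> l"
      using h_shift[OF that(1) Lat_double[OF that(2)]] by (simp add: \<beta>_eq[OF that(2)])
    finally show ?thesis using \<beta> that by simp
  qed
  ultimately obtain a where a: "\<And>x. x \<in> V \<Longrightarrow> w' x = a" using double_periodic_harmonic_const by blast
  have sum_ip: "ip f (\<lambda>x. \<Sum>i\<in>A. b i / 2 * h i x) = 0" for A
  proof (induction A rule: infinite_finite_induct)
    case (insert i A)
    then have "(\<lambda>x. \<Sum>i\<in>insert i A. b i / 2 * h i x) = (\<lambda>x. b i / 2 * h i x + (\<Sum>i\<in>A. b i / 2 * h i x))"
      by (simp add: fun_eq_iff)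
    then show ?case using insert(3) f(3)[of i] by (simp only: ip_add_right ip_scale_right)
  qed (simp_all add: ip_def)
  have "ip f w = ip f (\<lambda>x. a * 1 + (\<Sum>i\<in>UNIV. b i / 2 * h i x))"
    using a f by (intro ip_cong) (force simp: fs_def w'_def algebra_simps)
  then show "ip f w = 0" using f(2) sum_ip by (simp only: ip_scale_right ip_add_right)
qed (use f G lap sdiff in auto)


section \<open>Periodic functions and harmonic coordinates\<close>

definition cover_reps :: "(real ^ 'n) set" where
  "cover_reps = (SOME F. finite F \<and> F \<subseteq> V \<and> (\<forall>x\<in>V. \<exists>y\<in>F. x - y \<in> Lat))"

text \<open>
  The choice depends on the lattice class of \<open>x\<close> only, because the predicate does (\<open>rep_shift\<close>).
\<close>

definition rep :: "real ^ 'n \<Rightarrow> real ^ 'n" where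
  "rep x = (SOME y. y \<in> cover_reps \<and> x - y \<in> Lat)"

definition fund :: "(real ^ 'n) set" where
  "fund = rep ` V"

lemma cover_reps: "finite cover_reps" "cover_reps \<subseteq> V" "x \<in> V \<Longrightarrow> \<exists>y\<in>cover_reps. x - y \<in> Lat"
proof -
  have "finite cover_reps \<and> cover_reps \<subseteq> V \<and> (\<forall>x\<in>V. \<exists>y\<in>cover_reps. x - y \<in> Lat)"
    unfolding cover_reps_def by (rule someI_ex[OF cover])
  then show "finite cover_reps" "cover_reps \<subseteq> V" "x \<in> V \<Longrightarrow> \<exists>y\<in>cover_reps. x - y \<in> Lat" by auto
qed

lemma rep: assumes "x \<in> V" shows "rep x \<in> cover_reps" "x - rep x \<in> Lat"
proof -
  have "\<exists>y. y \<in> cover_reps \<and> x - y \<in> Lat" using cover_reps(3)[OF assms] by blast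
  then have "rep x \<in> cover_reps \<and> x - rep x \<in> Lat" unfolding rep_def by (rule someI_ex)
  then show "rep x \<in> cover_reps" "x - rep x \<in> Lat" by auto
qed

lemma rep_shift: assumes "l \<in> Lat" shows "rep (x + l) = rep x"
proof -
  have "x + l - y \<in> Lat \<longleftrightarrow> x - y \<in> Lat" for y
    using Lat_add[OF _ assms, of "x - y"] Lat_diff[OF _ assms, of "x + l - y"] by (auto simp: algebra_simps)
  then show ?thesis unfolding rep_def by simp
qed

lemma rep_V: "x \<in> V \<Longrightarrow> rep x \<in> V" using rep(1) cover_reps(2) by (auto simp: subset_iff)

lemma finite_fund: "finite fund"
  unfolding fund_def by (rule finite_subset[OF image_subsetI cover_reps(1)]) (rule rep(1))

lemma fund_V: "fund \<subseteq> V" using rep_V by (auto simp: fund_def)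

lemma rep_fund: "x \<in> V \<Longrightarrow> rep x \<in> fund" by (simp add: fund_def)

lemma rep_rep: "x \<in> fund \<Longrightarrow> rep x = x"
proof -
  assume "x \<in> fund"
  then obtain y where y: "y \<in> V" "x = rep y" by (auto simp: fund_def)
  then have "rep (rep y + (y - rep y)) = rep (rep y)" using rep by (intro rep_shift) auto
  then show ?thesis using y by simp
qed

lemma periodic_rep:
  assumes "\<And>x l. l \<in> Lat \<Longrightarrow> g (x + l) = g x" "x \<in> V"
  shows "g (rep x) = g x"
  using assms(1)[OF rep(2)[OF assms(2)], of "rep x"] by simp

lemma periodic_finite:
  assumes per: "\<And>x l. l \<in> Lat \<Longrightarrow> g (x + l) = g x"
  shows "finite (g ` V)"
proof (rule finite_subset)
  show "g ` V \<subseteq> g ` fund"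
  proof (rule image_subsetI)
    fix x assume "x \<in> V"
    then show "g x \<in> g ` fund" using periodic_rep[of g, OF per] rep_fund by (intro image_eqI[of _ _ "rep x"]) auto
  qed
qed (simp add: finite_fund)

lemma edge_bounded:
  fixes g :: "real ^ 'n \<Rightarrow> real ^ 'n \<Rightarrow> real"
  assumes "\<And>x y l. l \<in> Lat \<Longrightarrow> g (x + l) (y + l) = g x y"
  shows "\<exists>B\<ge>0. \<forall>x y. c x y \<noteq> 0 \<longrightarrow> \<bar>g x y\<bar> \<le> B"
proof (intro exI conjI allI impI)
  let ?E = "SIGMA x:fund. nb x"
  have fin: "finite ?E" using finite_fund by auto
  show "0 \<le> (\<Sum>(x, y)\<in>?E. \<bar>g x y\<bar>)" by (intro sum_nonneg) auto
  fix x y assume xy: "c x y \<noteq> 0"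
  then have x: "x \<in> V" using c_vertices by blast
  define l where "l = rep x - x"
  have l: "l \<in> Lat" using Lat_uminus[OF rep(2)[OF x]] by (simp add: l_def)
  have "(x + l, y + l) \<in> ?E" using c_shift[OF l, of x y] xy rep_fund[OF x] by (auto simp: l_def nb_def)
  then have "\<bar>g (x + l) (y + l)\<bar> \<le> (\<Sum>(x, y)\<in>?E. \<bar>g x y\<bar>)"
    using member_le_sum[of "(x + l, y + l)" ?E "\<lambda>(x, y). \<bar>g x y\<bar>"] fin by auto
  then show "\<bar>g x y\<bar> \<le> (\<Sum>(x, y)\<in>?E. \<bar>g x y\<bar>)" using assms[OF l] by simp
qed

text \<open>
  Translating an edge \<open>(x, y)\<close> with \<open>x\<close> in the fundamental domain so that \<open>y\<close> enters the domain, and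
  swapping its ends, is an involution of the edges starting in the domain.
\<close>

lemma mass_transport:
  fixes K :: "real ^ 'n \<Rightarrow> real ^ 'n \<Rightarrow> real"
  assumes K: "\<And>x y l. l \<in> Lat \<Longrightarrow> K (x + l) (y + l) = K x y"
  shows "(\<Sum>x\<in>fund. \<Sum>y\<in>nb x. K x y) = (\<Sum>x\<in>fund. \<Sum>y\<in>nb x. K y x)"
proof -
  let ?E = "SIGMA x:fund. nb x"
  let ?j = "\<lambda>(x, y). (rep y, x + (rep y - y))"
  have j: "?j p \<in> ?E" "?j (?j p) = p" "K (snd (?j p)) (fst (?j p)) = K (fst p) (snd p)" if p: "p \<in> ?E" for p
  proof -
    obtain x y where xy: "p = (x, y)" "x \<in> fund" "y \<in> nb x" using p by auto
    then have yV: "y \<in> V" using nb_V by blast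
    define l where "l = rep y - y"
    have l: "l \<in> Lat" using Lat_uminus[OF rep(2)[OF yV]] by (simp add: l_def)
    have "x \<in> nb y" using xy nb_sym by blast
    then have "x + l \<in> nb (y + l)" using nb_shift[OF l, of y] by blast
    then show "?j p \<in> ?E" using xy rep_fund[OF yV] by (simp add: l_def)
    show "?j (?j p) = p" using xy rep_shift[OF l, of x] rep_rep[OF xy(2)] by (simp add: l_def)
    show "K (snd (?j p)) (fst (?j p)) = K (fst p) (snd p)" using K[OF l, of x y] xy by (simp add: l_def)
  qed
  have "(\<Sum>x\<in>fund. \<Sum>y\<in>nb x. K x y) = (\<Sum>p\<in>?E. K (fst p) (snd p))"
    using finite_fund by (subst sum.Sigma) (auto simp: case_prod_unfold)
  also have "\<dots> = (\<Sum>p\<in>?E. K (snd p) (fst p))"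
    by (rule sum.reindex_bij_witness[of _ ?j ?j]) (use j in blast)+
  also have "\<dots> = (\<Sum>x\<in>fund. \<Sum>y\<in>nb x. K y x)"
    using finite_fund by (subst sum.Sigma) (auto simp: case_prod_unfold)
  finally show ?thesis .
qed

text \<open>
  The graph Laplacian, written so that it is 0 outside \<open>V\<close>.
\<close>

definition lap :: "(real ^ 'n \<Rightarrow> real) \<Rightarrow> real ^ 'n \<Rightarrow> real" where
  "lap u x = deg x * (u x - avg u x)"

lemma lap_alt: "lap u x = (\<Sum>y\<in>nb x. c x y * (u x - u y))"
  unfolding lap_def right_diff_distrib deg_avg
  by (simp add: sum_subtractf sum_distrib_right deg_def)

lemma lap_shift: "l \<in> Lat \<Longrightarrow> lap u (x + l) = lap (\<lambda>y. u (y + l)) x"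
  by (simp add: lap_def deg_shift avg_shift)

lemma lap_periodic: "(\<And>x l. l \<in> Lat \<Longrightarrow> u (x + l) = u x) \<Longrightarrow> l \<in> Lat \<Longrightarrow> lap u (x + l) = lap u x"
  by (simp add: lap_shift)

lemma periodic_lap_symmetric:
  assumes u: "\<And>x l. l \<in> Lat \<Longrightarrow> u (x + l) = u x" and v: "\<And>x l. l \<in> Lat \<Longrightarrow> v (x + l) = v x"
  shows "(\<Sum>x\<in>fund. lap u x * v x) = (\<Sum>x\<in>fund. u x * lap v x)"
proof -
  have "(\<Sum>x\<in>fund. \<Sum>y\<in>nb x. c x y * u y * v x) = (\<Sum>x\<in>fund. \<Sum>y\<in>nb x. c y x * u x * v y)"
    by (rule mass_transport[of "\<lambda>x y. c x y * u y * v x"]) (simp add: c_shift u v)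
  then have "(\<Sum>x\<in>fund. (deg x * avg u x) * v x) = (\<Sum>x\<in>fund. u x * (deg x * avg v x))"
    unfolding deg_avg sum_distrib_left sum_distrib_right using c_sym by (simp add: mult_ac)
  then show ?thesis unfolding lap_def right_diff_distrib left_diff_distrib sum_subtractf by (simp add: mult_ac)
qed

text \<open>
  A linear system on the fundamental domain. By duality its solvability reduces to the functions \<open>v\<close>
  orthogonal to all Laplacians of periodic functions. By symmetry of the Laplacian these are harmonic and
  periodic, so they are constant, and constants are orthogonal to \<open>b\<close> by hypothesis.
\<close>

lemma periodic_poisson:
  assumes b: "\<And>x l. l \<in> Lat \<Longrightarrow> b (x + l) = b x" and b0: "(\<Sum>x\<in>fund. b x) = 0"
  shows "\<exists>\<psi>. (\<forall>x. \<forall>l\<in>Lat. \<psi> (x + l) = \<psi> x) \<and> (\<forall>x\<in>V. lap \<psi> x = b x)"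
proof -
  define r where "r u x = (if x \<in> fund then u x else (0::real))" for u :: "real ^ 'n \<Rightarrow> real" and x
  define p where "p x y = (if rep y = x then 1 else (0::real))" for x y
  define G where "G u \<longleftrightarrow> (\<forall>x. x \<notin> fund \<longrightarrow> u x = 0) \<and>
    (\<exists>\<psi>. (\<forall>x. \<forall>l\<in>Lat. \<psi> (x + l) = \<psi> x) \<and> (\<forall>x\<in>fund. lap \<psi> x = u x))" for u
  have p_per: "p x (y + l) = p x y" if "l \<in> Lat" for x y l using rep_shift[OF that] by (simp add: p_def)
  have fin: "finite {x. r u x \<noteq> 0}" for u using finite_subset[of "{x. r u x \<noteq> 0}" fund] finite_fund by (auto simp: r_def)
  have rsum: "(\<Sum>x | r u x \<noteq> 0. r u x * w x) = (\<Sum>x\<in>fund. u x * w x)" for u w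
    using finite_fund by (intro sum.mono_neutral_cong_left) (auto simp: r_def)
  have "G (r b)"
  proof (rule finite_support_duality[of "(\<lambda>x. r (lap (p x))) ` fund"])
    fix w assume w: "\<And>s. s \<in> (\<lambda>x. r (lap (p x))) ` fund \<Longrightarrow> (\<Sum>x | s x \<noteq> 0. s x * w x) = 0"
    define v where "v x = w (rep x)" for x
    have v: "v (x + l) = v x" if "l \<in> Lat" for x l using rep_shift[OF that] by (simp add: v_def)
    have fdlap: "lap v x = 0" if x: "x \<in> fund" for x
    proof -
      have "0 = (\<Sum>y\<in>fund. lap (p x) y * w y)" using w[of "r (lap (p x))"] x rsum by auto
      also have "\<dots> = (\<Sum>y\<in>fund. lap (p x) y * v y)" by (intro sum.cong) (auto simp: v_def rep_rep)
      also have "\<dots> = (\<Sum>y\<in>fund. p x y * lap v y)" by (rule periodic_lap_symmetric[OF p_per v])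
      also have "\<dots> = (\<Sum>y\<in>fund. if y = x then lap v y else 0)" by (intro sum.cong) (auto simp: p_def rep_rep)
      also have "\<dots> = lap v x" using x finite_fund by simp
      finally show ?thesis by simp
    qed
    have "lap v x = 0" if "x \<in> V" for x
      using fdlap[OF rep_fund[OF that]] periodic_rep[of "lap v", OF lap_periodic[of v, OF v] that] by simp
    then have "avg v x = v x" if "x \<in> V" for x
      using that deg_pos[OF that] by (force simp: lap_def)
    then obtain a where a: "\<And>x. x \<in> V \<Longrightarrow> v x = a"
      using harmonic_max[of v] periodic_finite[of v, OF v] by blast
    have "(\<Sum>x\<in>fund. b x * w x) = (\<Sum>x\<in>fund. b x * a)"
      using a rep_rep fund_V by (intro sum.cong) (auto simp: v_def subset_iff, metis)
    then show "(\<Sum>x | r b x \<noteq> 0. r b x * w x) = 0"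
      unfolding rsum by (simp add: b0 flip: sum_distrib_right)
  next
    show "G (\<lambda>_. 0)" unfolding G_def by (auto intro!: exI[of _ "\<lambda>_. 0"] simp: lap_alt)
  next
    fix u v assume "G u" "G v"
    then obtain \<psi> \<theta> where "\<forall>x. \<forall>l\<in>Lat. \<psi> (x + l) = \<psi> x" "\<forall>x\<in>fund. lap \<psi> x = u x"
      "\<forall>x. \<forall>l\<in>Lat. \<theta> (x + l) = \<theta> x" "\<forall>x\<in>fund. lap \<theta> x = v x" unfolding G_def by blast
    then show "G (\<lambda>x. u x + v x)" using \<open>G u\<close> \<open>G v\<close> unfolding G_def
      by (auto intro!: exI[of _ "\<lambda>x. \<psi> x + \<theta> x"] simp: lap_def avg_add algebra_simps)
  next
    fix a u assume "G u"
    then obtain \<psi> where "\<forall>x. \<forall>l\<in>Lat. \<psi> (x + l) = \<psi> x" "\<forall>x\<in>fund. lap \<psi> x = u x" unfolding G_def by blast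
    then show "G (\<lambda>x. a * u x)" using \<open>G u\<close> unfolding G_def
      by (auto intro!: exI[of _ "\<lambda>x. a * \<psi> x"] simp: lap_def avg_scale algebra_simps)
  next
    fix s assume "s \<in> (\<lambda>x. r (lap (p x))) ` fund"
    then obtain x where "s = r (lap (p x))" by blast
    then show "G s" unfolding G_def using p_per by (auto intro!: exI[of _ "p x"] simp: r_def)
  qed (use fin in auto)
  then obtain \<psi> where \<psi>: "\<And>x l. l \<in> Lat \<Longrightarrow> \<psi> (x + l) = \<psi> x" "\<And>x. x \<in> fund \<Longrightarrow> lap \<psi> x = r b x"
    unfolding G_def by blast
  have "lap \<psi> x = b x" if "x \<in> V" for x
    using \<psi>(2)[OF rep_fund[OF that]] rep_fund[OF that] periodic_rep[of "lap \<psi>", OF lap_periodic[of \<psi>, OF \<psi>(1)] that]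
      periodic_rep[of b, OF b that] by (simp add: r_def)
  then show ?thesis using \<psi>(1) by blast
qed

lemma finite_bounded: "finite (g ` V) \<Longrightarrow> \<exists>B. \<forall>x\<in>V. \<bar>g x :: real\<bar> \<le> B"
proof -
  assume "finite (g ` V)"
  then have "\<forall>x\<in>V. \<bar>g x\<bar> \<le> (\<Sum>t\<in>g ` V. \<bar>t\<bar>)" by (auto intro!: member_le_sum)
  then show ?thesis by blast
qed

text \<open>
  The Laplacian of a linear coordinate is periodic, and its sum over the fundamental domain is 0 by
  \<open>mass_transport\<close>, since the contributions of the two orientations of an edge are opposite. Subtracting a
  periodic solution of the Poisson equation makes the coordinate harmonic.
\<close>

lemma harmonic_coordinates_exist:
  "\<exists>h :: 'n \<Rightarrow> real ^ 'n \<Rightarrow> real. (\<forall>i. \<forall>x\<in>V. avg (h i) x = h i x) \<and>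
     (\<forall>i x. \<forall>l\<in>Lat. h i (x + l) = h i x + l $ i) \<and> (\<forall>i. h i 0 = 0)"
proof -
  have "\<exists>h. (\<forall>x\<in>V. avg h x = h x) \<and> (\<forall>x. \<forall>l\<in>Lat. h (x + l) = h x + l $ i) \<and> h 0 = 0" for i
  proof -
    define b where "b x = lap (\<lambda>y. y $ i) x" for x
    have b: "b (x + l) = b x" if "l \<in> Lat" for x l
      unfolding b_def lap_shift[OF that] by (simp add: lap_alt)
    have "(\<Sum>x\<in>fund. b x) = (\<Sum>x\<in>fund. \<Sum>y\<in>nb x. c y x * (y $ i - x $ i))"
      unfolding b_def lap_alt by (rule mass_transport[of "\<lambda>x y. c x y * (x $ i - y $ i)"]) (simp add: c_shift)
    also have "\<dots> = - (\<Sum>x\<in>fund. b x)"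
      unfolding b_def lap_alt sum_negf[symmetric] by (intro sum.cong refl) (simp add: c_sym algebra_simps)
    finally have "(\<Sum>x\<in>fund. b x) = 0" by simp
    from periodic_poisson[of b, OF b this] obtain \<psi> where
      \<psi>: "\<And>x l. l \<in> Lat \<Longrightarrow> \<psi> (x + l) = \<psi> x" "\<And>x. x \<in> V \<Longrightarrow> lap \<psi> x = b x" by blast
    define h where "h x = (x $ i - \<psi> x) + \<psi> 0" for x
    have "avg h x = h x" if "x \<in> V" for x
    proof -
      have "avg h x = avg (\<lambda>y. y $ i) x - avg \<psi> x + \<psi> 0"
        unfolding h_def using avg_const[OF that] by (simp add: avg_add avg_diff)
      moreover have "x $ i - avg (\<lambda>y. y $ i) x = \<psi> x - avg \<psi> x"
        using \<psi>(2)[OF that] deg_pos[OF that] by (simp add: b_def lap_def)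
      ultimately show ?thesis by (simp add: h_def)
    qed
    then show ?thesis using \<psi>(1) by (intro exI[of _ h]) (auto simp: h_def)
  qed
  then show ?thesis by metis
qed

text \<open>
  Harmonic functions that agree with the linear coordinates on the lattice; the mean return position has
  these coordinates (\<open>mean_return_coordinates\<close>).
\<close>

definition hcoord :: "'n \<Rightarrow> real ^ 'n \<Rightarrow> real" where
  "hcoord = (SOME h. (\<forall>i. \<forall>x\<in>V. avg (h i) x = h i x) \<and>
     (\<forall>i x. \<forall>l\<in>Lat. h i (x + l) = h i x + l $ i) \<and> (\<forall>i. h i 0 = 0))"

lemma hcoord_harmonic: "x \<in> V \<Longrightarrow> avg (hcoord i) x = hcoord i x"
  and hcoord_shift: "l \<in> Lat \<Longrightarrow> hcoord i (x + l) = hcoord i x + l $ i"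
  and hcoord_0: "hcoord i 0 = 0"
proof -
  have *: "(\<forall>i. \<forall>x\<in>V. avg (hcoord i) x = hcoord i x) \<and>
     (\<forall>i x. \<forall>l\<in>Lat. hcoord i (x + l) = hcoord i x + l $ i) \<and> (\<forall>i. hcoord i 0 = 0)"
    unfolding hcoord_def by (rule someI_ex[OF harmonic_coordinates_exist])
  show "x \<in> V \<Longrightarrow> avg (hcoord i) x = hcoord i x" "l \<in> Lat \<Longrightarrow> hcoord i (x + l) = hcoord i x + l $ i" "hcoord i 0 = 0"
    using * by auto
qed

lemma hcoord_Lat: "l \<in> Lat \<Longrightarrow> hcoord i l = l $ i"
  using hcoord_shift[of l i 0] hcoord_0 by simp

lemma hcoord_close: "\<exists>B. \<forall>i. \<forall>x\<in>V. \<bar>hcoord i x - x $ i\<bar> \<le> B"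
proof -
  have "\<exists>B. \<forall>x\<in>V. \<bar>hcoord i x - x $ i\<bar> \<le> B" for i
    by (intro finite_bounded periodic_finite) (simp add: hcoord_shift)
  then obtain B where B: "\<And>i x. x \<in> V \<Longrightarrow> \<bar>hcoord i x - x $ i\<bar> \<le> B i" by metis
  have "0 \<le> B i" for i using B[OF zero_V, of i] by (rule order_trans[OF abs_ge_zero])
  then have "B i \<le> (\<Sum>i\<in>UNIV. B i)" for i by (intro member_le_sum) auto
  then show ?thesis using B by (meson order_trans)
qed

lemma hcoord_lipschitz: "\<exists>B\<ge>0. \<forall>i x y. c x y \<noteq> 0 \<longrightarrow> \<bar>hcoord i x - hcoord i y\<bar> \<le> B"
proof -
  have "\<exists>B\<ge>0. \<forall>x y. c x y \<noteq> 0 \<longrightarrow> \<bar>hcoord i x - hcoord i y\<bar> \<le> B" for i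
    by (rule edge_bounded) (simp add: hcoord_shift)
  then obtain B where B: "\<And>i. 0 \<le> B i" "\<And>i x y. c x y \<noteq> 0 \<Longrightarrow> \<bar>hcoord i x - hcoord i y\<bar> \<le> B i" by metis
  have "B i \<le> (\<Sum>i\<in>UNIV. B i)" for i using B(1) by (intro member_le_sum) auto
  then have "\<bar>hcoord i x - hcoord i y\<bar> \<le> (\<Sum>i\<in>UNIV. B i)" if "c x y \<noteq> 0" for i x y
    using B(2)[OF that, of i] by (meson order_trans)
  moreover have "0 \<le> (\<Sum>i\<in>UNIV. B i)" using B(1) by (intro sum_nonneg) auto
  ultimately show ?thesis by blast
qed

text \<open>
  A bounded function whose mean decreases by 1 in every step off the lattice; it bounds the expected return
  time. It solves a periodic Poisson equation whose right-hand side is \<open>deg\<close>, corrected on the lattice to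
  have sum 0.
\<close>

lemma hitting_potential:
  "\<exists>\<phi> B. (\<forall>l\<in>Lat. \<phi> l = 0) \<and> (\<forall>x\<in>V - Lat. \<phi> x - avg \<phi> x = 1) \<and> (\<forall>x\<in>V. \<bar>\<phi> x\<bar> \<le> B)"
proof -
  \<comment> \<open>The fundamental domain contains exactly one lattice point, which takes the whole correction.\<close>
  define S where "S = (\<Sum>x\<in>fund. deg x)"
  define b where "b x = deg x - S * (if x \<in> Lat then 1 else 0)" for x
  have b: "b (x + l) = b x" if "l \<in> Lat" for x l
    using Lat_add[OF _ that, of x] Lat_diff[OF _ that, of "x + l"] by (auto simp: b_def deg_shift that)
  have "x \<in> fund \<and> x \<in> Lat \<longleftrightarrow> x = rep 0" for x
  proof
    assume "x \<in> fund \<and> x \<in> Lat"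
    then show "x = rep 0" using rep_shift[of x 0] rep_rep[of x] by simp
  next
    assume "x = rep 0"
    then show "x \<in> fund \<and> x \<in> Lat" using rep_fund[OF zero_V] rep(2)[OF zero_V] Lat_uminus[of "- x"] by auto
  qed
  then have "fund \<inter> Lat = {rep 0}" by blast
  then have "(\<Sum>x\<in>fund. if x \<in> Lat then 1 else (0::real)) = 1"
    using finite_fund by (simp add: sum.If_cases)
  then have "(\<Sum>x\<in>fund. b x) = 0"
    unfolding b_def sum_subtractf sum_distrib_left[symmetric] by (simp add: S_def)
  from periodic_poisson[of b, OF b this] obtain \<psi> where
    \<psi>: "\<And>x l. l \<in> Lat \<Longrightarrow> \<psi> (x + l) = \<psi> x" "\<And>x. x \<in> V \<Longrightarrow> lap \<psi> x = b x" by blast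
  define \<phi> where "\<phi> x = \<psi> x - \<psi> 0" for x
  have "\<phi> l = 0" if "l \<in> Lat" for l using \<psi>(1)[OF that, of 0] by (simp add: \<phi>_def)
  moreover have "\<phi> x - avg \<phi> x = 1" if "x \<in> V - Lat" for x
  proof -
    have "avg \<phi> x = avg \<psi> x - \<psi> 0" unfolding \<phi>_def using avg_const[of x "\<psi> 0"] that by (simp add: avg_diff)
    moreover have "deg x * (\<psi> x - avg \<psi> x) = deg x" using \<psi>(2)[of x] that by (simp add: lap_def b_def)
    then have "\<psi> x - avg \<psi> x = 1" using deg_pos[of x] that by simp
    ultimately show ?thesis by (simp add: \<phi>_def)
  qed
  moreover have "\<exists>B. \<forall>x\<in>V. \<bar>\<phi> x\<bar> \<le> B"
    by (intro finite_bounded periodic_finite) (simp add: \<phi>_def \<psi>(1))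
  ultimately show ?thesis by blast
qed


section \<open>Moments of Laplacians of square summable functions\<close>

lemma ip_lap: "ip u (\<lambda>x. v x - avg v x) = (\<Sum>x\<in>supp u. u x * lap v x)"
  by (simp add: ip_def lap_def mult_ac)

lemma green_identity:
  assumes "fs u"
  shows "(\<Sum>x\<in>supp u. u x * lap v x) = (\<Sum>x\<in>supp (lap u). lap u x * v x)"
proof -
  have "supp (\<lambda>x. u x - avg u x) = supp (lap u)"
  proof -
    have "u x - avg u x \<noteq> 0 \<longleftrightarrow> lap u x \<noteq> 0" for x
    proof (cases "x \<in> V")
      case True
      then show ?thesis using deg_pos[OF True] by (simp add: lap_def)
    next
      case False
      then have "u x = 0" using assms by (auto simp: fs_def supp_def)
      then show ?thesis using False by (simp add: lap_def avg_outside)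
    qed
    then show ?thesis by (simp add: supp_def)
  qed
  then have "ip (\<lambda>x. u x - avg u x) v = (\<Sum>x\<in>supp (lap u). lap u x * v x)"
    by (simp add: ip_def lap_def)
  moreover have "ip (\<lambda>x. u x - avg u x) v = ip u (\<lambda>x. v x - avg v x)"
    using assms by (simp add: ip_diff_left ip_diff_right fs_avg ip_avg)
  ultimately show ?thesis by (simp add: ip_lap)
qed

lemma fs_lap: assumes "fs u" shows "finite (supp (lap u))" "supp (lap u) \<subseteq> V"
proof -
  have "fs (\<lambda>x. u x - avg u x)" using assms by blast
  moreover have "supp (lap u) \<subseteq> supp (\<lambda>x. u x - avg u x)" by (auto simp: supp_def lap_def)
  ultimately show "finite (supp (lap u))" "supp (lap u) \<subseteq> V" by (auto simp: fs_def intro: finite_subset)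
qed

text \<open>
  Bounded norms and pointwise convergence to 0 imply weak convergence to 0: split the pairing with \<open>\<xi>\<close> at a
  finite set outside which \<open>\<xi>\<close> has small norm.
\<close>

lemma l2_weak_null:
  fixes \<xi> :: "'a \<Rightarrow> real" and t :: "nat \<Rightarrow> 'a \<Rightarrow> real"
  assumes \<xi>: "(\<lambda>x. (\<xi> x)\<^sup>2) summable_on S"
    and A: "\<And>R. finite (A R)" "\<And>R. A R \<subseteq> S" "\<And>R x. x \<notin> A R \<Longrightarrow> t R x = 0"
    and bd: "\<And>R. R \<ge> 1 \<Longrightarrow> (\<Sum>x\<in>A R. (t R x)\<^sup>2) \<le> C"
    and lim: "\<And>x. x \<in> S \<Longrightarrow> (\<lambda>R. t R x) \<longlonglongrightarrow> 0"
  shows "(\<lambda>R. \<Sum>x\<in>A R. t R x * \<xi> x) \<longlonglongrightarrow> 0"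
proof (rule LIMSEQ_I)
  fix r :: real assume r: "0 < r"
  have C: "0 \<le> C" using bd[of 1] sum_nonneg[of "A 1" "\<lambda>x. (t 1 x)\<^sup>2"] by fastforce
  \<comment> \<open>By Cauchy-Schwarz a tail of norm \<open>e\<close> contributes at most \<open>sqrt C * e \<le> r / 2\<close>; the summand 1 only keeps the denominator positive.\<close>
  define e where "e = r / (2 * (sqrt C + 1))"
  have e: "0 < e" using r C by (simp add: e_def add_nonneg_pos)
  have "((\<lambda>x. (\<xi> x)\<^sup>2) has_sum infsum (\<lambda>x. (\<xi> x)\<^sup>2) S) S" using \<xi> by simp
  then have "\<forall>\<^sub>F F in finite_subsets_at_top S. dist (\<Sum>x\<in>F. (\<xi> x)\<^sup>2) (infsum (\<lambda>x. (\<xi> x)\<^sup>2) S) < e\<^sup>2"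
    unfolding has_sum_def using e tendstoD by fastforce
  then obtain F where F: "finite F" "F \<subseteq> S" "dist (\<Sum>x\<in>F. (\<xi> x)\<^sup>2) (infsum (\<lambda>x. (\<xi> x)\<^sup>2) S) < e\<^sup>2"
    unfolding eventually_finite_subsets_at_top by blast
  have tail: "L2_set \<xi> B \<le> e" if B: "finite B" "B \<subseteq> S" "B \<inter> F = {}" for B
  proof -
    have "(\<Sum>x\<in>F. (\<xi> x)\<^sup>2) + (\<Sum>x\<in>B. (\<xi> x)\<^sup>2) = (\<Sum>x\<in>F \<union> B. (\<xi> x)\<^sup>2)"
      using B F by (subst sum.union_disjoint) auto
    also have "\<dots> \<le> infsum (\<lambda>x. (\<xi> x)\<^sup>2) S" using B F by (intro finite_sum_le_infsum[OF \<xi>]) auto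
    finally have "(\<Sum>x\<in>B. (\<xi> x)\<^sup>2) \<le> e\<^sup>2" using F(3) by (simp add: dist_real_def)
    then show ?thesis unfolding L2_set_def using e by (simp add: real_le_lsqrt sum_nonneg)
  qed
  have "(\<lambda>R. \<Sum>x\<in>F. t R x * \<xi> x) \<longlonglongrightarrow> (\<Sum>x\<in>F. 0 * \<xi> x)"
    using F lim by (intro tendsto_sum tendsto_mult tendsto_const) auto
  then obtain N where N: "\<And>R. R \<ge> N \<Longrightarrow> \<bar>\<Sum>x\<in>F. t R x * \<xi> x\<bar> < r / 2"
    using LIMSEQ_D[of _ _ "r / 2"] r by fastforce
  have "norm ((\<Sum>x\<in>A R. t R x * \<xi> x) - 0) < r" if R: "R \<ge> max N 1" for R
  proof -
    have "(\<Sum>x\<in>A R. t R x * \<xi> x) = (\<Sum>x\<in>A R \<inter> F. t R x * \<xi> x) + (\<Sum>x\<in>A R - F. t R x * \<xi> x)"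
      using A by (subst sum.Int_Diff[of _ _ F]) auto
    also have "(\<Sum>x\<in>A R \<inter> F. t R x * \<xi> x) = (\<Sum>x\<in>F. t R x * \<xi> x)"
    proof (rule sum.mono_neutral_left)
      show "\<forall>i\<in>F - A R \<inter> F. t R i * \<xi> i = 0"
      proof
        fix i assume "i \<in> F - A R \<inter> F"
        then have "i \<notin> A R" by blast
        then show "t R i * \<xi> i = 0" by (simp add: A(3))
      qed
    qed (use F in auto)
    finally have "\<bar>\<Sum>x\<in>A R. t R x * \<xi> x\<bar> \<le> \<bar>\<Sum>x\<in>F. t R x * \<xi> x\<bar> + \<bar>\<Sum>x\<in>A R - F. t R x * \<xi> x\<bar>"
      by (simp add: abs_triangle_ineq)
    moreover have "\<bar>\<Sum>x\<in>A R - F. t R x * \<xi> x\<bar> \<le> (\<Sum>x\<in>A R - F. \<bar>t R x\<bar> * \<bar>\<xi> x\<bar>)"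
      by (rule order_trans[OF sum_abs]) (simp add: abs_mult)
    moreover have "(\<Sum>x\<in>A R - F. \<bar>t R x\<bar> * \<bar>\<xi> x\<bar>) \<le> L2_set (t R) (A R - F) * L2_set \<xi> (A R - F)"
      by (rule L2_set_mult_ineq)
    moreover have "L2_set (t R) (A R - F) * L2_set \<xi> (A R - F) \<le> sqrt C * e"
    proof (rule mult_mono)
      have "(\<Sum>x\<in>A R - F. (t R x)\<^sup>2) \<le> (\<Sum>x\<in>A R. (t R x)\<^sup>2)" using A by (intro sum_mono2) auto
      then show "L2_set (t R) (A R - F) \<le> sqrt C" unfolding L2_set_def using bd[of R] R by simp
      show "L2_set \<xi> (A R - F) \<le> e" using A by (intro tail) auto
    qed (use C in \<open>auto simp: L2_set_nonneg\<close>)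
    moreover have "sqrt C * e \<le> r / 2"
    proof -
      have "sqrt C * e = r / 2 * (sqrt C / (sqrt C + 1))" by (simp add: e_def)
      also have "\<dots> \<le> r / 2 * 1"
      proof (rule mult_left_mono)
        have "0 < sqrt C + 1" using C by (simp add: add_nonneg_pos)
        then show "sqrt C / (sqrt C + 1) \<le> 1" by (subst divide_le_eq_1_pos) auto
      qed (use r in simp)
      finally show ?thesis by simp
    qed
    ultimately show ?thesis using N[of R] R by simp
  qed
  then show "\<exists>no. \<forall>R\<ge>no. norm ((\<Sum>x\<in>A R. t R x * \<xi> x) - 0) < r" by blast
qed

text \<open>
  Since \<open>hcoord\<close> stays close to the identity, such a vertex is \<open>y + M *v z\<close> with \<open>y\<close> in the fundamental domain
  and an integer vector \<open>z\<close> whose entries are at most a multiple of \<open>R\<close>.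
\<close>

lemma ball_count:
  "\<exists>K\<ge>0. \<forall>R\<ge>1. finite {x\<in>V. \<forall>i. \<bar>hcoord i x\<bar> \<le> Q * real R} \<and>
     real (card {x\<in>V. \<forall>i. \<bar>hcoord i x\<bar> \<le> Q * real R}) \<le> K * real R ^ CARD('n)"
proof -
  obtain B where B: "\<And>i x. x \<in> V \<Longrightarrow> \<bar>hcoord i x - x $ i\<bar> \<le> B" using hcoord_close by blast
  obtain N where N: "N ** M = mat 1" using invertible_M unfolding invertible_def by blast
  define Z where "Z = (\<Sum>i\<in>UNIV. \<Sum>j\<in>UNIV. \<bar>N $ i $ j\<bar>)"
  define Y where "Y = (\<Sum>y\<in>fund. norm y)"
  \<comment> \<open>\<open>P * R\<close> bounds the entries of \<open>z\<close>.\<close>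
  define P where "P = nat \<lceil>Z * (\<bar>Q\<bar> + \<bar>B\<bar> + Y)\<rceil> + 1"
  have Z0: "0 \<le> Z" unfolding Z_def by (intro sum_nonneg) auto
  have Y0: "0 \<le> Y" unfolding Y_def by (intro sum_nonneg) auto
  have P: "Z * (\<bar>Q\<bar> + \<bar>B\<bar> + Y) \<le> real P" "1 \<le> P" unfolding P_def by linarith+
  have main: "finite {x\<in>V. \<forall>i. \<bar>hcoord i x\<bar> \<le> Q * real R} \<and>
     real (card {x\<in>V. \<forall>i. \<bar>hcoord i x\<bar> \<le> Q * real R}) \<le> real (card fund) * real (3 * P) ^ CARD('n) * real R ^ CARD('n)"
    (is "finite ?D \<and> _") if R: "R \<ge> 1" for R
  proof -
    let ?I = "(UNIV :: 'n set) \<rightarrow>\<^sub>E {- int (P * R)..int (P * R)}"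
    have sub: "?D \<subseteq> (\<lambda>(y, z). y + M *v (\<chi> i. real_of_int (z i))) ` (fund \<times> ?I)"
    proof
      fix x assume x: "x \<in> ?D"
      define y where "y = rep x"
      have y: "y \<in> fund" "x - y \<in> Lat" using x rep_fund rep(2) by (auto simp: y_def)
      then obtain z where z: "x - y = M *v z" "\<forall>i. z $ i \<in> \<int>" by (auto simp: Lat_eq)
      have "z = N *v (x - y)" unfolding z(1) matrix_vector_mul_assoc N by simp
      have xj: "\<bar>(x - y) $ j\<bar> \<le> (\<bar>Q\<bar> + \<bar>B\<bar> + Y) * real R" for j
      proof -
        have "\<bar>x $ j\<bar> \<le> \<bar>hcoord j x\<bar> + \<bar>hcoord j x - x $ j\<bar>" by linarith
        also have "\<dots> \<le> \<bar>Q\<bar> * real R + \<bar>B\<bar> * real R"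
        proof (rule add_mono)
          have "\<bar>hcoord j x\<bar> \<le> Q * real R" using x by auto
          also have "\<dots> \<le> \<bar>Q\<bar> * real R" by (intro mult_right_mono) auto
          finally show "\<bar>hcoord j x\<bar> \<le> \<bar>Q\<bar> * real R" .
          have "\<bar>hcoord j x - x $ j\<bar> \<le> \<bar>B\<bar> * 1" using B[of x j] x by fastforce
          also have "\<dots> \<le> \<bar>B\<bar> * real R" using R by (intro mult_left_mono) auto
          finally show "\<bar>hcoord j x - x $ j\<bar> \<le> \<bar>B\<bar> * real R" .
        qed
        finally have 1: "\<bar>x $ j\<bar> \<le> \<bar>Q\<bar> * real R + \<bar>B\<bar> * real R" .
        have "\<bar>y $ j\<bar> \<le> norm y" by (rule component_le_norm_cart)
        also have "\<dots> \<le> Y * 1" unfolding Y_def using y finite_fund by (simp add: member_le_sum)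
        also have "\<dots> \<le> Y * real R" using R Y0 by (intro mult_left_mono) auto
        finally have "\<bar>y $ j\<bar> \<le> Y * real R" .
        with 1 show ?thesis by (simp add: algebra_simps)
      qed
      have zi: "\<bar>z $ i\<bar> \<le> real (P * R)" for i
      proof -
        have "\<bar>z $ i\<bar> = \<bar>\<Sum>j\<in>UNIV. N $ i $ j * (x - y) $ j\<bar>"
          unfolding \<open>z = N *v (x - y)\<close> by (simp only: matrix_vector_mult_def vec_lambda_beta)
        also have "\<dots> \<le> (\<Sum>j\<in>UNIV. \<bar>N $ i $ j\<bar> * ((\<bar>Q\<bar> + \<bar>B\<bar> + Y) * real R))"
          by (rule order_trans[OF sum_abs]) (auto intro!: sum_mono mult_left_mono xj simp only: abs_mult abs_ge_zero)
        also have "\<dots> = (\<Sum>j\<in>UNIV. \<bar>N $ i $ j\<bar>) * ((\<bar>Q\<bar> + \<bar>B\<bar> + Y) * real R)" by (simp only: sum_distrib_right)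
        also have "\<dots> \<le> Z * ((\<bar>Q\<bar> + \<bar>B\<bar> + Y) * real R)"
          unfolding Z_def using Y0 by (intro mult_right_mono member_le_sum) (auto intro: sum_nonneg)
        also have "\<dots> = (Z * (\<bar>Q\<bar> + \<bar>B\<bar> + Y)) * real R" by simp
        also have "\<dots> \<le> real P * real R" using P by (intro mult_right_mono) auto
        finally show ?thesis by simp
      qed
      define k where "k i = \<lfloor>z $ i\<rfloor>" for i
      have zk: "z $ i = real_of_int (k i)" for i using z(2) unfolding k_def by (metis Ints_cases floor_of_int)
      have "\<bar>k i\<bar> \<le> int (P * R)" for i using zi[of i] unfolding zk by linarith
      then have "k \<in> ?I" by (auto simp: abs_le_iff minus_le_iff)
      moreover have "x = y + M *v (\<chi> i. real_of_int (k i))"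
        unfolding zk[symmetric] using z(1) by (simp add: vec_nth_inverse algebra_simps)
      ultimately show "x \<in> (\<lambda>(y, z). y + M *v (\<chi> i. real_of_int (z i))) ` (fund \<times> ?I)"
        using y by (intro image_eqI[of _ _ "(y, k)"]) auto
    qed
    have fin: "finite (fund \<times> ?I)" using finite_fund by (intro finite_cartesian_product finite_PiE) auto
    have "card ?D \<le> card ((\<lambda>(y, z). y + M *v (\<chi> i. real_of_int (z i))) ` (fund \<times> ?I))"
      by (rule card_mono[OF finite_imageI[OF fin] sub])
    also have "\<dots> \<le> card (fund \<times> ?I)" by (rule card_image_le[OF fin])
    also have "\<dots> = card fund * (2 * (P * R) + 1) ^ CARD('n)"
      by (simp add: card_cartesian_product card_funcsetE nat_add_distrib nat_mult_distrib)
    also have "\<dots> \<le> card fund * (3 * P * R) ^ CARD('n)"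
    proof (intro mult_left_mono power_mono)
      have "1 \<le> P * R" using P R by simp
      then show "2 * (P * R) + 1 \<le> 3 * P * R" by simp
    qed auto
    finally have "real (card ?D) \<le> real (card fund * (3 * P * R) ^ CARD('n))" unfolding of_nat_le_iff .
    moreover have "finite ?D" using sub fin finite_surj by blast
    ultimately show ?thesis by (simp add: power_mult_distrib mult_ac)
  qed
  show ?thesis
  proof (intro exI conjI)
    show "0 \<le> real (card fund) * real (3 * P) ^ CARD('n)" by simp
    show "\<forall>R\<ge>1. finite {x\<in>V. \<forall>i. \<bar>hcoord i x\<bar> \<le> Q * real R} \<and>
     real (card {x\<in>V. \<forall>i. \<bar>hcoord i x\<bar> \<le> Q * real R}) \<le> real (card fund) * real (3 * P) ^ CARD('n) * real R ^ CARD('n)"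
      using main by blast
  qed
qed

text \<open>
  By Green's identity, the pairing of \<open>T R\<close> with \<open>lap \<xi>\<close> is that of \<open>lap (T R)\<close> with \<open>\<xi>\<close>. The square norm
  of \<open>lap (T R)\<close> is at most the number of vertices, of order \<open>R ^ CARD('n)\<close>, times \<open>C\<^sup>2 / R ^ (2 * a)\<close>,
  hence bounded, so \<open>l2_weak_null\<close> applies.
\<close>

lemma pairing_zero_by_test_functions:
  assumes \<xi>: "(\<lambda>x. (\<xi> x)\<^sup>2) summable_on V"
    and \<eta>: "finite S" "S \<subseteq> V" "\<And>x. x \<in> V - S \<Longrightarrow> lap \<xi> x = 0"
    and T: "\<And>R. R \<ge> 1 \<Longrightarrow> fs (T R)"
    and bound: "\<And>R x. R \<ge> 1 \<Longrightarrow> x \<in> V \<Longrightarrow> \<bar>lap (T R) x\<bar> \<le> C / real R ^ a"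
    and region: "\<And>R x i. R \<ge> 1 \<Longrightarrow> lap (T R) x \<noteq> 0 \<Longrightarrow> \<bar>hcoord i x\<bar> \<le> Q * real R"
    and a: "1 \<le> a" "CARD('n) \<le> 2 * a"
    and lim: "\<And>x. x \<in> V \<Longrightarrow> (\<lambda>R. T R x) \<longlonglongrightarrow> t x"
  shows "(\<Sum>x\<in>S. t x * lap \<xi> x) = 0"
proof -
  obtain K where K: "K \<ge> 0" "\<And>R. R \<ge> 1 \<Longrightarrow> finite {x\<in>V. \<forall>i. \<bar>hcoord i x\<bar> \<le> Q * real R} \<and>
     real (card {x\<in>V. \<forall>i. \<bar>hcoord i x\<bar> \<le> Q * real R}) \<le> K * real R ^ CARD('n)"
    using ball_count by blast
  define U where "U R = T (Suc R)" for R
  have fsU: "fs (U R)" for R using T by (simp add: U_def)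
  have "(\<lambda>R. \<Sum>x\<in>supp (lap (U R)). lap (U R) x * \<xi> x) \<longlonglongrightarrow> 0"
  proof (rule l2_weak_null[OF \<xi>, where C = "K * C\<^sup>2"])
    show "finite (supp (lap (U R)))" "supp (lap (U R)) \<subseteq> V" for R using fs_lap[OF fsU] by auto
    show "lap (U R) x = 0" if "x \<notin> supp (lap (U R))" for R x using that by (simp add: supp_def)
    show "(\<Sum>x\<in>supp (lap (U R)). (lap (U R) x)\<^sup>2) \<le> K * C\<^sup>2" for R
    proof -
      let ?R = "Suc R" and ?D = "{x\<in>V. \<forall>i. \<bar>hcoord i x\<bar> \<le> Q * real (Suc R)}"
      have D: "finite ?D" "real (card ?D) \<le> K * real ?R ^ CARD('n)" using K(2)[of ?R] by auto
      have sub: "supp (lap (U R)) \<subseteq> ?D"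
        using region[of ?R] fs_lap(2)[OF fsU, of R] by (auto simp: U_def supp_def)
      have "(\<Sum>x\<in>supp (lap (U R)). (lap (U R) x)\<^sup>2) \<le> (\<Sum>x\<in>?D. (lap (U R) x)\<^sup>2)"
        by (rule sum_mono2[OF D(1) sub]) simp
      also have "\<dots> \<le> (\<Sum>x\<in>?D. (C / real ?R ^ a)\<^sup>2)"
      proof (rule sum_mono)
        fix x assume "x \<in> ?D"
        then have "\<bar>lap (U R) x\<bar>\<^sup>2 \<le> (C / real ?R ^ a)\<^sup>2"
          using bound[of ?R x] by (intro power_mono) (auto simp: U_def)
        then show "(lap (U R) x)\<^sup>2 \<le> (C / real ?R ^ a)\<^sup>2" by simp
      qed
      also have "\<dots> = real (card ?D) * (C\<^sup>2 / real ?R ^ (2 * a))"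
        by (simp add: power_divide power_mult[symmetric] mult.commute)
      also have "\<dots> \<le> (K * real ?R ^ CARD('n)) * (C\<^sup>2 / real ?R ^ (2 * a))"
        by (intro mult_right_mono D(2)) auto
      also have "\<dots> \<le> (K * real ?R ^ (2 * a)) * (C\<^sup>2 / real ?R ^ (2 * a))"
        using K(1) a(2) by (intro mult_right_mono mult_left_mono power_increasing) auto
      also have "\<dots> = K * C\<^sup>2" by simp
      finally show ?thesis .
    qed
    show "(\<lambda>R. lap (U R) x) \<longlonglongrightarrow> 0" if x: "x \<in> V" for x
    proof (rule Lim_null_comparison)
      show "\<forall>\<^sub>F R in sequentially. norm (lap (U R) x) \<le> \<bar>C\<bar> * inverse (real (Suc R))"
      proof (intro always_eventually allI)
        fix R
        have "norm (lap (U R) x) \<le> C / real (Suc R) ^ a" using bound[of "Suc R" x] x by (simp add: U_def)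
        also have "\<dots> \<le> \<bar>C\<bar> / real (Suc R) ^ 1"
          using a(1) power_increasing[OF a(1), of "real (Suc R)"] by (intro frac_le) auto
        finally show "norm (lap (U R) x) \<le> \<bar>C\<bar> * inverse (real (Suc R))" by (simp add: divide_inverse)
      qed
      show "(\<lambda>R. \<bar>C\<bar> * inverse (real (Suc R))) \<longlonglongrightarrow> 0"
        using tendsto_mult[OF tendsto_const LIMSEQ_inverse_real_of_nat, of "\<bar>C\<bar>"] by simp
    qed
  qed
  moreover have "(\<Sum>x\<in>supp (lap (U R)). lap (U R) x * \<xi> x) = (\<Sum>x\<in>S. U R x * lap \<xi> x)" for R
  proof -
    have "(\<Sum>x\<in>supp (lap (U R)). lap (U R) x * \<xi> x) = (\<Sum>x\<in>supp (U R). U R x * lap \<xi> x)"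
      using green_identity[OF fsU] by simp
    also have "\<dots> = (\<Sum>x\<in>supp (U R) \<union> S. U R x * lap \<xi> x)"
      using fsU[of R] \<eta> by (intro sum.mono_neutral_left) (auto simp: fs_def supp_def)
    also have "\<dots> = (\<Sum>x\<in>S. U R x * lap \<xi> x)"
      using fsU[of R] \<eta> by (intro sum.mono_neutral_right) (auto simp: fs_def)
    finally show ?thesis .
  qed
  ultimately have "(\<lambda>R. \<Sum>x\<in>S. U R x * lap \<xi> x) \<longlonglongrightarrow> 0" by simp
  moreover have "(\<lambda>R. \<Sum>x\<in>S. U R x * lap \<xi> x) \<longlonglongrightarrow> (\<Sum>x\<in>S. t x * lap \<xi> x)"
    using \<eta>(2) lim unfolding U_def by (intro tendsto_sum tendsto_mult tendsto_const LIMSEQ_Suc) auto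
  ultimately show ?thesis using LIMSEQ_unique by blast
qed

text \<open>
  A compactly supported profile on \<open>[0, \<infinity>)\<close> whose derivative is Lipschitz, which is all that the
  second-order expansion below uses.
\<close>

definition bump :: "real \<Rightarrow> real" where
  "bump t = (max 0 (1 - t))\<^sup>2"

lemma bump_taylor: "\<bar>bump b - bump a + 2 * max 0 (1 - a) * (b - a)\<bar> \<le> (b - a)\<^sup>2"
proof -
  consider "a \<le> 1" "b \<le> 1" | "a > 1" "b > 1" | "a \<le> 1" "b > 1" | "a > 1" "b \<le> 1" by linarith
  then show ?thesis
  proof cases
    case 1
    then have "bump b - bump a + 2 * max 0 (1 - a) * (b - a) = (b - a)\<^sup>2"
      by (simp add: bump_def power2_eq_square algebra_simps)
    then show ?thesis by simp
  next
    case 2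
    then show ?thesis by (simp add: bump_def)
  next
    case 3
    have "bump b - bump a + 2 * max 0 (1 - a) * (b - a) = (b - a)\<^sup>2 - (b - 1)\<^sup>2"
      using 3 by (simp add: bump_def power2_eq_square algebra_simps)
    moreover have "(b - 1)\<^sup>2 \<le> (b - a)\<^sup>2" using 3 by (intro power_mono) auto
    ultimately show ?thesis by (simp add: abs_le_iff)
  next
    case 4
    have "bump b - bump a + 2 * max 0 (1 - a) * (b - a) = (1 - b)\<^sup>2"
      using 4 by (simp add: bump_def)
    moreover have "(1 - b)\<^sup>2 \<le> (a - b)\<^sup>2" using 4 by (intro power_mono) auto
    ultimately show ?thesis by (simp add: power2_commute)
  qed
qed

lemma bump_lipschitz: assumes "0 \<le> a" "0 \<le> b" shows "\<bar>bump b - bump a\<bar> \<le> 2 * \<bar>b - a\<bar>"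
proof -
  define p where "p = max 0 (1 - b)"
  define q where "q = max 0 (1 - a)"
  have "bump b - bump a = (p + q) * (p - q)" by (simp add: bump_def p_def q_def power2_eq_square algebra_simps)
  moreover have "\<bar>p + q\<bar> \<le> 2" "\<bar>p - q\<bar> \<le> \<bar>b - a\<bar>" using assms by (auto simp: p_def q_def)
  ultimately show ?thesis by (simp add: abs_mult mult_mono)
qed

definition cutoff :: "nat \<Rightarrow> real ^ 'n \<Rightarrow> real" where
  "cutoff R x = (if x \<in> V then bump ((\<Sum>i\<in>UNIV. (hcoord i x)\<^sup>2) / (real R)\<^sup>2) else 0)"

lemma cutoff_support: assumes "R \<ge> 1" "cutoff R x \<noteq> 0" shows "\<bar>hcoord i x\<bar> \<le> real R"
proof -
  have "t < 1" if "max 0 (1 - t) \<noteq> 0" for t :: real using that by (simp add: max_def split: if_splits)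
  moreover have "max 0 (1 - (\<Sum>i\<in>UNIV. (hcoord i x)\<^sup>2) / (real R)\<^sup>2) \<noteq> 0"
  proof
    assume "max 0 (1 - (\<Sum>i\<in>UNIV. (hcoord i x)\<^sup>2) / (real R)\<^sup>2) = 0"
    then have "bump ((\<Sum>i\<in>UNIV. (hcoord i x)\<^sup>2) / (real R)\<^sup>2) = 0" unfolding bump_def by (simp only:) simp
    then show False using assms(2) unfolding cutoff_def by presburger
  qed
  ultimately have "(\<Sum>i\<in>UNIV. (hcoord i x)\<^sup>2) / (real R)\<^sup>2 < 1" by blast
  then have "(\<Sum>i\<in>UNIV. (hcoord i x)\<^sup>2) < (real R)\<^sup>2" using assms by (simp add: field_simps)
  moreover have "(hcoord i x)\<^sup>2 \<le> (\<Sum>i\<in>UNIV. (hcoord i x)\<^sup>2)" by (intro member_le_sum) auto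
  ultimately have "(hcoord i x)\<^sup>2 \<le> (real R)\<^sup>2" by linarith
  then show ?thesis using abs_le_square_iff[of "hcoord i x" "real R"] by simp
qed

lemma fs_cutoff: assumes "R \<ge> 1" shows "fs (cutoff R)"
proof -
  have "supp (cutoff R) \<subseteq> {x\<in>V. \<forall>i. \<bar>hcoord i x\<bar> \<le> 1 * real R}"
    using cutoff_support[OF assms] by (auto simp: supp_def) (auto simp: cutoff_def split: if_splits)
  moreover have "finite {x\<in>V. \<forall>i. \<bar>hcoord i x\<bar> \<le> 1 * real R}" using ball_count[of 1] assms by blast
  ultimately show ?thesis unfolding fs_def using finite_subset by blast
qed

lemma cutoff_lim: assumes "x \<in> V" shows "(\<lambda>R. cutoff R x) \<longlonglongrightarrow> 1"
proof -
  let ?s = "\<Sum>i\<in>UNIV. (hcoord i x)\<^sup>2"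
  have "(\<lambda>R. ?s * (inverse (real R))\<^sup>2) \<longlonglongrightarrow> ?s * 0\<^sup>2"
    by (intro tendsto_intros lim_inverse_n)
  then have "(\<lambda>R. (max 0 (1 - ?s * (inverse (real R))\<^sup>2))\<^sup>2) \<longlonglongrightarrow> (max 0 (1 - ?s * 0\<^sup>2))\<^sup>2"
    by (intro tendsto_power tendsto_max tendsto_diff tendsto_const)
  then show ?thesis using assms by (simp add: cutoff_def bump_def power_inverse divide_inverse)
qed

text \<open>
  Expand \<open>bump\<close> to second order along the edges at \<open>x\<close>, in the variable \<open>s = |hcoord|\<^sup>2 / R\<^sup>2\<close>, which changes by
  \<open>O(1 / R)\<close> along an edge. Harmonicity of the coordinates cancels the first-order contribution of each
  coordinate, and what remains is \<open>O(1 / R\<^sup>2)\<close>. For \<open>hcoord i * cutoff R\<close>, harmonicity reduces the Laplacian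
  to \<open>hcoord i * lap (cutoff R)\<close> and products of two increments along edges.
\<close>

lemma lap_cutoff:
  "\<exists>C Q. 0 \<le> C \<and> (\<forall>R x. R \<ge> 1 \<longrightarrow> x \<in> V \<longrightarrow>
     \<bar>lap (cutoff R) x\<bar> \<le> C / (real R)\<^sup>2 \<and>
     (\<forall>i. \<bar>lap (\<lambda>y. hcoord i y * cutoff R y) x\<bar> \<le> C / real R) \<and>
     (\<forall>i j. lap (cutoff R) x \<noteq> 0 \<or> lap (\<lambda>y. hcoord j y * cutoff R y) x \<noteq> 0 \<longrightarrow> \<bar>hcoord i x\<bar> \<le> Q * real R))"
proof -
  obtain B where B: "B \<ge> 0" "\<And>i x y. c x y \<noteq> 0 \<Longrightarrow> \<bar>hcoord i x - hcoord i y\<bar> \<le> B" using hcoord_lipschitz by blast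
  obtain D where D: "\<And>x. deg x \<le> D" using deg_bounded by blast
  have D0: "0 \<le> D" using D[of 0] deg_nonneg[of 0] by linarith
  let ?d = "real CARD('n)"
  define Q where "Q = 1 + B"
  define E where "E = ?d * (2 * Q * B + B\<^sup>2)"
  define C2 where "C2 = D * (2 * (?d * B\<^sup>2) + E\<^sup>2)"
  define C where "C = C2 + Q * C2 + D * (B * (2 * E))"
  have Q0: "1 \<le> Q" using B by (simp add: Q_def)
  have E0: "0 \<le> E" using Q0 B by (simp add: E_def)
  have C20: "0 \<le> C2" using D0 by (simp add: C2_def)
  have C0: "0 \<le> C" using C20 Q0 D0 B E0 by (simp add: C_def)
  have wsum: "\<bar>\<Sum>y\<in>nb x. c x y * g y\<bar> \<le> D * G" if "\<And>y. y \<in> nb x \<Longrightarrow> \<bar>g y\<bar> \<le> G" "0 \<le> G" for x g G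
  proof -
    have "\<bar>\<Sum>y\<in>nb x. c x y * g y\<bar> \<le> (\<Sum>y\<in>nb x. c x y * G)"
      by (rule order_trans[OF sum_abs]) (auto simp: abs_mult c_nonneg intro!: sum_mono mult_left_mono that)
    also have "\<dots> = deg x * G" by (simp add: deg_def sum_distrib_right)
    also have "\<dots> \<le> D * G" using D that by (intro mult_right_mono)
    finally show ?thesis .
  qed
  have harm0: "(\<Sum>y\<in>nb x. c x y * (hcoord i y - hcoord i x)) = 0" if "x \<in> V" for x i
  proof -
    have "lap (hcoord i) x = 0" using hcoord_harmonic[OF that] by (simp add: lap_def)
    then have "(\<Sum>y\<in>nb x. c x y * (hcoord i x - hcoord i y)) = 0" by (simp add: lap_alt)
    then show ?thesis by (simp add: right_diff_distrib sum_subtractf)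
  qed
  have main: "\<bar>lap (cutoff R) x\<bar> \<le> C / (real R)\<^sup>2 \<and>
     (\<forall>i. \<bar>lap (\<lambda>y. hcoord i y * cutoff R y) x\<bar> \<le> C / real R) \<and>
     (\<forall>i j. lap (cutoff R) x \<noteq> 0 \<or> lap (\<lambda>y. hcoord j y * cutoff R y) x \<noteq> 0 \<longrightarrow> \<bar>hcoord i x\<bar> \<le> Q * real R)"
    if R: "R \<ge> 1" and x: "x \<in> V" for R x
  proof (cases "\<forall>i. \<bar>hcoord i x\<bar> \<le> Q * real R")
    case False
    then obtain i where i: "\<bar>hcoord i x\<bar> > Q * real R" by (auto simp: not_le)
    have "cutoff R y = 0" if "y = x \<or> y \<in> nb x" for y
    proof (rule ccontr)
      assume "cutoff R y \<noteq> 0"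
      then have "\<bar>hcoord i y\<bar> \<le> real R" by (rule cutoff_support[OF R])
      moreover have "\<bar>hcoord i x - hcoord i y\<bar> \<le> B" using that B by (auto simp: nb_def)
      moreover have "B * 1 \<le> B * real R" using B R by (intro mult_left_mono) auto
      ultimately show False using i by (auto simp: Q_def algebra_simps)
    qed
    then have "lap (cutoff R) x = 0" "lap (\<lambda>y. hcoord i y * cutoff R y) x = 0" for i
      by (auto simp: lap_alt)
    then show ?thesis using C0 by simp
  next
    case True
    let ?s = "\<lambda>x. (\<Sum>i\<in>UNIV. (hcoord i x)\<^sup>2) / (real R)\<^sup>2"
    let ?e = "\<lambda>y i. hcoord i y - hcoord i x"
    have e: "\<bar>?e y i\<bar> \<le> B" if "y \<in> nb x" for y i using B(2)[of x y i] that by (simp add: nb_def abs_minus_commute)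
    have R2: "0 < (real R)\<^sup>2" using R by simp
    have ds: "?s y - ?s x = (\<Sum>i\<in>UNIV. 2 * hcoord i x * ?e y i + (?e y i)\<^sup>2) / (real R)\<^sup>2" for y
      unfolding diff_divide_distrib[symmetric] sum_subtractf[symmetric]
      by (intro arg_cong2[of _ _ _ _ "(/)"] sum.cong refl) (simp add: power2_eq_square algebra_simps)
    have dsE: "\<bar>?s y - ?s x\<bar> \<le> E / real R" if y: "y \<in> nb x" for y
    proof -
      have "\<bar>\<Sum>i\<in>UNIV. 2 * hcoord i x * ?e y i + (?e y i)\<^sup>2\<bar> \<le> (\<Sum>i\<in>(UNIV::'n set). (2 * Q * B + B\<^sup>2) * real R)"
      proof (rule order_trans[OF sum_abs], rule sum_mono)
        fix i
        have "\<bar>2 * hcoord i x * ?e y i\<bar> \<le> 2 * (Q * real R) * B"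
          unfolding abs_mult using True e[OF y] Q0 R by (intro mult_mono) auto
        moreover have "(?e y i)\<^sup>2 \<le> B\<^sup>2 * 1" using e[OF y, of i] B by (simp add: abs_le_square_iff[symmetric])
        moreover have "B\<^sup>2 * 1 \<le> B\<^sup>2 * real R" using R by (intro mult_left_mono) auto
        ultimately show "\<bar>2 * hcoord i x * ?e y i + (?e y i)\<^sup>2\<bar> \<le> (2 * Q * B + B\<^sup>2) * real R"
          using abs_triangle_ineq[of "2 * hcoord i x * ?e y i" "(?e y i)\<^sup>2"] by (simp add: algebra_simps)
      qed
      also have "\<dots> = E * real R" by (simp add: E_def)
      finally have "\<bar>?s y - ?s x\<bar> \<le> E * real R / (real R)\<^sup>2"
        unfolding ds by (simp add: divide_right_mono)
      then show ?thesis using R by (simp add: power2_eq_square)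
    qed
    have lin: "\<bar>\<Sum>y\<in>nb x. c x y * (?s y - ?s x)\<bar> \<le> D * (?d * B\<^sup>2 / (real R)\<^sup>2)"
    proof -
      have "(\<Sum>y\<in>nb x. c x y * (?s y - ?s x)) =
         (\<Sum>y\<in>nb x. c x y * ((\<Sum>i\<in>UNIV. (?e y i)\<^sup>2) / (real R)\<^sup>2)) +
         (\<Sum>y\<in>nb x. c x y * ((\<Sum>i\<in>UNIV. 2 * hcoord i x * ?e y i) / (real R)\<^sup>2))"
        unfolding ds sum.distrib add_divide_distrib distrib_left by (rule add.commute)
      also have "(\<Sum>y\<in>nb x. c x y * ((\<Sum>i\<in>UNIV. 2 * hcoord i x * ?e y i) / (real R)\<^sup>2))
         = (\<Sum>y\<in>nb x. c x y * (\<Sum>i\<in>UNIV. 2 * hcoord i x * ?e y i)) / (real R)\<^sup>2"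
        by (simp only: times_divide_eq_right sum_divide_distrib[symmetric])
      also have "(\<Sum>y\<in>nb x. c x y * (\<Sum>i\<in>UNIV. 2 * hcoord i x * ?e y i)) = (\<Sum>i\<in>UNIV. 2 * hcoord i x * (\<Sum>y\<in>nb x. c x y * ?e y i))"
        unfolding sum_distrib_left by (subst sum.swap) (simp add: mult_ac)
      also have "\<dots> = 0" by (simp add: harm0[OF x])
      finally have eq: "(\<Sum>y\<in>nb x. c x y * (?s y - ?s x)) = (\<Sum>y\<in>nb x. c x y * ((\<Sum>i\<in>UNIV. (?e y i)\<^sup>2) / (real R)\<^sup>2))"
        by simp
      have "\<bar>(\<Sum>i\<in>UNIV. (?e y i)\<^sup>2) / (real R)\<^sup>2\<bar> \<le> ?d * B\<^sup>2 / (real R)\<^sup>2" if y: "y \<in> nb x" for y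
      proof -
        have "(\<Sum>i\<in>UNIV. (?e y i)\<^sup>2) \<le> (\<Sum>i\<in>(UNIV::'n set). B\<^sup>2)"
          using e[OF y] B by (intro sum_mono) (simp add: abs_le_square_iff[symmetric])
        then have "(\<Sum>i\<in>UNIV. (?e y i)\<^sup>2) / (real R)\<^sup>2 \<le> ?d * B\<^sup>2 / (real R)\<^sup>2" by (simp add: divide_right_mono)
        then show ?thesis by (simp add: sum_nonneg)
      qed
      then show ?thesis unfolding eq by (rule wsum) simp_all
    qed
    define q where "q = max 0 (1 - ?s x)"
    have q: "0 \<le> q" "q \<le> 1" by (auto simp: q_def sum_nonneg)
    have T: "cutoff R y - cutoff R x = bump (?s y) - bump (?s x)" if "y \<in> nb x" for y
      using that x nb_V by (simp add: cutoff_def)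
    have rem: "\<bar>bump (?s y) - bump (?s x) + 2 * q * (?s y - ?s x)\<bar> \<le> E\<^sup>2 / (real R)\<^sup>2" if y: "y \<in> nb x" for y
    proof -
      have "\<bar>bump (?s y) - bump (?s x) + 2 * q * (?s y - ?s x)\<bar> \<le> (?s y - ?s x)\<^sup>2"
        unfolding q_def by (rule bump_taylor)
      also have "\<dots> \<le> (E / real R)\<^sup>2" using power_mono[OF dsE[OF y], of 2] by simp
      finally show ?thesis by (simp add: power_divide)
    qed
    have "lap (cutoff R) x = - (\<Sum>y\<in>nb x. c x y * (bump (?s y) - bump (?s x)))"
      unfolding lap_alt sum_negf[symmetric]
    proof (intro sum.cong refl)
      fix y assume y: "y \<in> nb x"
      show "c x y * (cutoff R x - cutoff R y) = - (c x y * (bump (?s y) - bump (?s x)))"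
        unfolding T[OF y, symmetric] by (simp add: algebra_simps)
    qed
    also have "\<dots> = 2 * q * (\<Sum>y\<in>nb x. c x y * (?s y - ?s x))
        - (\<Sum>y\<in>nb x. c x y * (bump (?s y) - bump (?s x) + 2 * q * (?s y - ?s x)))"
      unfolding sum_distrib_left sum_subtractf[symmetric] sum_negf[symmetric]
      by (intro sum.cong refl) (simp add: algebra_simps)
    finally have split: "lap (cutoff R) x = 2 * q * (\<Sum>y\<in>nb x. c x y * (?s y - ?s x))
        - (\<Sum>y\<in>nb x. c x y * (bump (?s y) - bump (?s x) + 2 * q * (?s y - ?s x)))" .
    have "\<bar>lap (cutoff R) x\<bar> \<le> \<bar>2 * q * (\<Sum>y\<in>nb x. c x y * (?s y - ?s x))\<bar>
        + \<bar>\<Sum>y\<in>nb x. c x y * (bump (?s y) - bump (?s x) + 2 * q * (?s y - ?s x))\<bar>"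
      unfolding split by (rule abs_triangle_ineq4)
    also have "\<dots> \<le> 2 * (D * (?d * B\<^sup>2 / (real R)\<^sup>2)) + D * (E\<^sup>2 / (real R)\<^sup>2)"
    proof (rule add_mono)
      have "\<bar>2 * q\<bar> * \<bar>\<Sum>y\<in>nb x. c x y * (?s y - ?s x)\<bar> \<le> 2 * (D * (?d * B\<^sup>2 / (real R)\<^sup>2))"
        using q by (intro mult_mono lin) auto
      then show "\<bar>2 * q * (\<Sum>y\<in>nb x. c x y * (?s y - ?s x))\<bar> \<le> 2 * (D * (?d * B\<^sup>2 / (real R)\<^sup>2))"
        by (simp only: abs_mult)
      show "\<bar>\<Sum>y\<in>nb x. c x y * (bump (?s y) - bump (?s x) + 2 * q * (?s y - ?s x))\<bar> \<le> D * (E\<^sup>2 / (real R)\<^sup>2)"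
        by (rule wsum[OF rem]) auto
    qed
    also have "\<dots> = C2 / (real R)\<^sup>2" using R2 by (simp add: C2_def field_simps)
    finally have b1: "\<bar>lap (cutoff R) x\<bar> \<le> C2 / (real R)\<^sup>2" .
    have b2: "\<bar>lap (\<lambda>y. hcoord i y * cutoff R y) x\<bar> \<le> C / real R" for i
    proof -
      have "lap (\<lambda>y. hcoord i y * cutoff R y) x
         = hcoord i x * lap (cutoff R) x - (\<Sum>y\<in>nb x. c x y * (?e y i * (cutoff R y - cutoff R x)))
           - cutoff R x * (\<Sum>y\<in>nb x. c x y * ?e y i)"
        unfolding lap_alt sum_distrib_left sum_subtractf[symmetric]
        by (intro sum.cong refl) (simp add: algebra_simps)
      then have eq: "lap (\<lambda>y. hcoord i y * cutoff R y) x
         = hcoord i x * lap (cutoff R) x - (\<Sum>y\<in>nb x. c x y * (?e y i * (cutoff R y - cutoff R x)))"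
        by (simp add: harm0[OF x])
      have "\<bar>?e y i * (cutoff R y - cutoff R x)\<bar> \<le> B * (2 * E) / real R" if y: "y \<in> nb x" for y
      proof -
        have "\<bar>cutoff R y - cutoff R x\<bar> \<le> 2 * \<bar>?s y - ?s x\<bar>"
          unfolding T[OF y] by (intro bump_lipschitz) (auto intro!: divide_nonneg_nonneg sum_nonneg)
        also have "\<dots> \<le> 2 * (E / real R)" by (intro mult_left_mono dsE[OF y]) simp
        finally have "\<bar>?e y i\<bar> * \<bar>cutoff R y - cutoff R x\<bar> \<le> B * (2 * (E / real R))"
          using e[OF y] B by (intro mult_mono) auto
        then show ?thesis by (simp add: abs_mult)
      qed
      then have "\<bar>\<Sum>y\<in>nb x. c x y * (?e y i * (cutoff R y - cutoff R x))\<bar> \<le> D * (B * (2 * E) / real R)"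
        using B E0 by (intro wsum) auto
      moreover have "\<bar>hcoord i x * lap (cutoff R) x\<bar> \<le> Q * C2 / real R"
      proof -
        have "\<bar>hcoord i x\<bar> * \<bar>lap (cutoff R) x\<bar> \<le> (Q * real R) * (C2 / (real R)\<^sup>2)"
          using True b1 Q0 by (intro mult_mono) auto
        also have "\<dots> = Q * C2 / real R" using R by (simp add: power2_eq_square)
        finally show ?thesis by (simp add: abs_mult)
      qed
      ultimately have "\<bar>lap (\<lambda>y. hcoord i y * cutoff R y) x\<bar> \<le> Q * C2 / real R + D * (B * (2 * E) / real R)"
        unfolding eq by (intro order_trans[OF abs_triangle_ineq4 add_mono])
      also have "\<dots> = (Q * C2 + D * (B * (2 * E))) / real R" by (simp add: add_divide_distrib)
      also have "\<dots> \<le> C / real R" using C20 by (intro divide_right_mono) (auto simp: C_def)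
      finally show ?thesis .
    qed
    have "C2 / (real R)\<^sup>2 \<le> C / (real R)\<^sup>2"
      using Q0 C20 D0 B E0 by (intro divide_right_mono) (auto simp: C_def)
    then show ?thesis using b1 b2 True by auto
  qed
  show ?thesis
  proof (intro exI conjI)
    show "0 \<le> C" by (rule C0)
  qed (use main in blast)
qed

lemma l2_laplacian_sum_zero:
  assumes \<xi>: "(\<lambda>x. (\<xi> x)\<^sup>2) summable_on V"
    and \<eta>: "finite S" "S \<subseteq> V" "\<And>x. x \<in> V - S \<Longrightarrow> lap \<xi> x = 0" and d: "CARD('n) \<le> 4"
  shows "(\<Sum>x\<in>S. lap \<xi> x) = 0"
proof -
  obtain C Q where CQ: "\<And>R x. R \<ge> 1 \<Longrightarrow> x \<in> V \<Longrightarrow> \<bar>lap (cutoff R) x\<bar> \<le> C / (real R)\<^sup>2 \<and>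
     (\<forall>i. lap (cutoff R) x \<noteq> 0 \<longrightarrow> \<bar>hcoord i x\<bar> \<le> Q * real R)" using lap_cutoff by metis
  have "(\<Sum>x\<in>S. 1 * lap \<xi> x) = 0"
  proof (rule pairing_zero_by_test_functions[OF \<xi> \<eta> fs_cutoff, where C = C and a = 2 and Q = Q and t = "\<lambda>_. 1"])
    show "\<bar>hcoord i x\<bar> \<le> Q * real R" if "R \<ge> 1" "lap (cutoff R) x \<noteq> 0" for R x i
      using CQ[OF that(1), of x] that fs_lap(2)[OF fs_cutoff[OF that(1)]] by (auto simp: supp_def)
  qed (use CQ d cutoff_lim in auto)
  then show ?thesis by simp
qed

lemma l2_laplacian_moment_zero:
  assumes \<xi>: "(\<lambda>x. (\<xi> x)\<^sup>2) summable_on V"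
    and \<eta>: "finite S" "S \<subseteq> V" "\<And>x. x \<in> V - S \<Longrightarrow> lap \<xi> x = 0" and d: "CARD('n) = 2"
  shows "(\<Sum>x\<in>S. hcoord i x * lap \<xi> x) = 0"
proof -
  let ?T = "\<lambda>R x. hcoord i x * cutoff R x"
  obtain C Q where CQ: "\<And>R x. R \<ge> 1 \<Longrightarrow> x \<in> V \<Longrightarrow> \<bar>lap (?T R) x\<bar> \<le> C / real R \<and>
     (\<forall>j. lap (?T R) x \<noteq> 0 \<longrightarrow> \<bar>hcoord j x\<bar> \<le> Q * real R)" using lap_cutoff by metis
  have fsT: "fs (?T R)" if "R \<ge> 1" for R
    using fs_mult[OF fs_cutoff[OF that], of "hcoord i"] by (simp add: mult.commute)
  show ?thesis
  proof (rule pairing_zero_by_test_functions[OF \<xi> \<eta> fsT, where C = C and a = 1 and Q = Q and t = "hcoord i"])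
    show "\<bar>hcoord j x\<bar> \<le> Q * real R" if "R \<ge> 1" "lap (?T R) x \<noteq> 0" for R x j
      using CQ[OF that(1), of x] that fs_lap(2)[OF fsT[OF that(1)]] by (auto simp: supp_def)
    show "(\<lambda>R. ?T R x) \<longlonglongrightarrow> hcoord i x" if "x \<in> V" for x
      using tendsto_mult[OF tendsto_const cutoff_lim[OF that], of "hcoord i x"] by simp
  qed (use CQ d in auto)
qed

end


section \<open>The network of a tiling\<close>

locale tiling_walk =
  fixes T :: "('n::finite) tiling"
  assumes tiling: "periodic_tiling T"
begin

lemma joins_sym: "joins T e v w \<Longrightarrow> joins T e w v"
  unfolding joins_def by (metis arc_reversepath path_image_reversepath pathfinish_reversepath pathstart_reversepath)

text \<open>
  An edge meets the vertex set in exactly two points, and the ends of any arc tracing it are two distinct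
  points of that kind. So an edge determines its unordered pair of ends.
\<close>

lemma joins_ends: assumes "joins T e v w" shows "e \<inter> verts T = {v, w}" "v \<noteq> w"
proof -
  obtain p where p: "arc p" "path_image p = e" "pathstart p = v" "pathfinish p = w" and e: "e \<in> edges T" "v \<in> verts T" "w \<in> verts T"
    using assms by (auto simp: joins_def)
  obtain a b where ab: "joins T e a b" "e \<inter> verts T = {a, b}"
    using tiling e by (auto simp: periodic_tiling_def embedded_graph_def)
  show ne: "v \<noteq> w" using arc_distinct_ends[OF p(1)] p by simp
  have "v \<in> e" "w \<in> e" using p pathstart_in_path_image pathfinish_in_path_image by blast+
  then have "v \<in> {a, b}" "w \<in> {a, b}" using ab e by auto
  then show "e \<inter> verts T = {v, w}" using ab ne by auto
qed

lemma joins_other_end: "joins T e v w \<Longrightarrow> joins T e v w' \<Longrightarrow> w = w'"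
  using joins_ends[of e v w] joins_ends[of e v w'] by (metis doubleton_eq_iff)

lemma joins_verts: "joins T e v w \<Longrightarrow> v \<in> verts T" "joins T e v w \<Longrightarrow> w \<in> verts T"
  by (auto simp: joins_def)

lemma finite_incident: "finite (incident T v)"
proof (cases "v \<in> verts T")
  case True
  then show ?thesis using tiling by (auto simp: periodic_tiling_def bounded_degree_def)
qed (auto simp: incident_def joins_def)

lemma edge_mult_nonzero: "edge_mult T v w \<noteq> 0 \<longleftrightarrow> (\<exists>e. joins T e v w)"
proof -
  have "finite {e. joins T e v w}"
    by (rule finite_subset[OF _ finite_incident[of v]]) (auto simp: incident_def)
  then show ?thesis by (auto simp: edge_mult_def)
qed

lemma edge_mult_pos: "0 < edge_mult T v w \<longleftrightarrow> (\<exists>e. joins T e v w)"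
  using edge_mult_nonzero[of v w] by simp

lemma finite_neighbours: "finite {w. edge_mult T v w \<noteq> 0}"
proof -
  have "\<forall>w. \<exists>e. edge_mult T v w \<noteq> 0 \<longrightarrow> joins T e v w" using edge_mult_nonzero by blast
  then obtain f where f: "\<And>w. edge_mult T v w \<noteq> 0 \<Longrightarrow> joins T (f w) v w" by metis
  have "inj_on f {w. edge_mult T v w \<noteq> 0}"
  proof (rule inj_onI)
    fix a b assume "a \<in> {w. edge_mult T v w \<noteq> 0}" "b \<in> {w. edge_mult T v w \<noteq> 0}" "f a = f b"
    then have "joins T (f a) v a" "joins T (f a) v b" using f[of a] f[of b] by auto
    then show "a = b" by (rule joins_other_end)
  qed
  moreover have "f ` {w. edge_mult T v w \<noteq> 0} \<subseteq> incident T v" using f by (auto simp: incident_def)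
  ultimately show ?thesis using finite_incident inj_on_finite by blast
qed

lemma vdeg_eq: "vdeg T v = (\<Sum>w | edge_mult T v w \<noteq> 0. edge_mult T v w)"
proof -
  have fin: "finite {e. joins T e v w}" for w
    by (rule finite_subset[OF _ finite_incident[of v]]) (auto simp: incident_def)
  have "incident T v = (\<Union>w\<in>{w. edge_mult T v w \<noteq> 0}. {e. joins T e v w})"
    by (auto simp: incident_def edge_mult_pos)
  moreover have "card (\<Union>w\<in>{w. edge_mult T v w \<noteq> 0}. {e. joins T e v w})
      = (\<Sum>w | edge_mult T v w \<noteq> 0. card {e. joins T e v w})"
  proof (rule card_UN_disjoint[OF finite_neighbours])
    show "\<forall>w\<in>{w. edge_mult T v w \<noteq> 0}. \<forall>w'\<in>{w. edge_mult T v w \<noteq> 0}.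
        w \<noteq> w' \<longrightarrow> {e. joins T e v w} \<inter> {e. joins T e v w'} = {}"
      using joins_other_end by blast
  qed (use fin in blast)
  ultimately show ?thesis by (simp only: vdeg_def edge_mult_def)
qed

lemma joins_shift:
  assumes l: "l \<in> lattice T" and j: "joins T e v w"
  shows "joins T ((+) l ` e) (l + v) (l + w)"
proof -
  obtain p where p: "arc p" "path_image p = e" "pathstart p = v" "pathfinish p = w" and e: "e \<in> edges T" "v \<in> verts T" "w \<in> verts T"
    using j by (auto simp: joins_def)
  have per: "(+) l ` verts T = verts T" "(`) ((+) l) ` edges T = edges T"
    using tiling l by (auto simp: periodic_tiling_def lattice_periodic_def)
  let ?q = "(\<lambda>x. l + x) \<circ> p"
  have "arc ?q" "path_image ?q = (+) l ` e" "pathstart ?q = l + v" "pathfinish ?q = l + w"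
    using p by (auto simp: arc_translation_eq path_image_compose pathstart_compose pathfinish_compose)
  moreover have "(+) l ` e \<in> edges T" "l + v \<in> verts T" "l + w \<in> verts T"
    using per e by blast+
  ultimately show ?thesis unfolding joins_def by blast
qed

lemma lattice_uminus: "l \<in> lattice T \<Longrightarrow> - l \<in> lattice T"
proof -
  assume "l \<in> lattice T"
  then obtain y where "l = lattice_matrix T *v y" "\<forall>i. y $ i \<in> \<int>"
    unfolding lattice_def by auto
  then have "- l = lattice_matrix T *v (- y)" "\<forall>i. (- y) $ i \<in> \<int>"
    using matrix_vector_mult_scaleR[of "lattice_matrix T" "-1" y] by (auto simp: scaleR_minus1_left)
  then show ?thesis unfolding lattice_def by blast
qed

lemma edge_mult_shift:
  assumes l: "l \<in> lattice T"
  shows "edge_mult T (v + l) (w + l) = edge_mult T v w"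
proof -
  have "bij_betw ((`) ((+) l)) {e. joins T e v w} {e. joins T e (v + l) (w + l)}"
  proof (rule bij_betw_byWitness[where f' = "(`) ((+) (- l))"])
    show "(`) ((+) l) ` {e. joins T e v w} \<subseteq> {e. joins T e (v + l) (w + l)}"
      using joins_shift[OF l] by (auto simp: add.commute[of v l] add.commute[of w l])
    show "(`) ((+) (- l)) ` {e. joins T e (v + l) (w + l)} \<subseteq> {e. joins T e v w}"
      using joins_shift[OF lattice_uminus[OF l], of _ "v + l" "w + l"] by auto
  qed (auto simp: image_image)
  then show ?thesis unfolding edge_mult_def by (rule bij_betw_same_card[symmetric])
qed

lemma finite_vertex_cover:
  "\<exists>F. finite F \<and> F \<subseteq> verts T \<and> (\<forall>x\<in>verts T. \<exists>y\<in>F. x - y \<in> lattice T)"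
proof -
  let ?E = "{(x, y). x \<in> verts T \<and> y \<in> verts T \<and> x - y \<in> lattice T}"
  have fin: "finite (verts T // ?E)" using tiling by (simp add: periodic_tiling_def)
  have zero: "0 \<in> lattice T" unfolding lattice_def by (auto intro!: exI[of _ 0])
  define s where "s X = (SOME y. y \<in> X)" for X :: "(real ^ 'n) set"
  have s: "s X \<in> X" if "X \<in> verts T // ?E" for X
  proof -
    from that obtain x where "x \<in> verts T" "X = ?E `` {x}" by (rule quotientE)
    then have "x \<in> X" using zero by auto
    then show ?thesis unfolding s_def by (rule someI)
  qed
  have "s ` (verts T // ?E) \<subseteq> verts T"
  proof clarify
    fix X assume X: "X \<in> verts T // ?E"
    then show "s X \<in> verts T" using s[OF X] by (auto elim!: quotientE)
  qed
  moreover have "\<exists>y\<in>s ` (verts T // ?E). x - y \<in> lattice T" if x: "x \<in> verts T" for x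
  proof -
    have X: "?E `` {x} \<in> verts T // ?E" using x by (rule quotientI)
    then show ?thesis using s[OF X] by (intro bexI[of _ "s (?E `` {x})"]) auto
  qed
  moreover have "finite (s ` (verts T // ?E))" using fin by (rule finite_imageI)
  ultimately show ?thesis by (intro exI[of _ "s ` (verts T // ?E)"] conjI ballI)
qed

sublocale periodic_network "verts T" "\<lambda>x y. real (edge_mult T x y)" "lattice_matrix T" "lattice T"
proof
  show "lattice T = {lattice_matrix T *v z |z. \<forall>i. z $ i \<in> \<int>}" by (rule lattice_def)
  show "invertible (lattice_matrix T)" using tiling by (simp add: periodic_tiling_def)
  show "1 \<le> real (edge_mult T x y)" if "real (edge_mult T x y) \<noteq> 0" for x y using that by simp
  show "x \<in> verts T" if "real (edge_mult T x y) \<noteq> 0" for x y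
    using that edge_mult_pos[of x y] joins_verts(1) by auto
  have "{e. joins T e x y} = {e. joins T e y x}" for x y using joins_sym by blast
  then show "real (edge_mult T x y) = real (edge_mult T y x)" for x y by (simp add: edge_mult_def)
  show "finite {y. real (edge_mult T x y) \<noteq> 0}" for x using finite_neighbours by simp
  show "x + l \<in> verts T" if "l \<in> lattice T" "x \<in> verts T" for l x
  proof -
    have "(+) l ` verts T = verts T" using tiling that by (auto simp: periodic_tiling_def lattice_periodic_def)
    then show ?thesis using that by (metis add.commute image_eqI)
  qed
  show "real (edge_mult T (x + l) (y + l)) = real (edge_mult T x y)" if "l \<in> lattice T" for l x y
    using edge_mult_shift[OF that] by simp
  show "\<exists>F. finite F \<and> F \<subseteq> verts T \<and> (\<forall>x\<in>verts T. \<exists>y\<in>F. x - y \<in> lattice T)"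
    by (rule finite_vertex_cover)
  have "{(x, y). \<exists>e. joins T e x y} = {(x, y). real (edge_mult T x y) \<noteq> 0}"
    by (simp add: edge_mult_pos)
  then show "(x, y) \<in> {(x, y). real (edge_mult T x y) \<noteq> 0}\<^sup>*" if "x \<in> verts T" "y \<in> verts T" for x y
    using tiling that by (simp add: periodic_tiling_def connected_graph_def)
  show "0 \<in> verts T" using tiling by (simp add: periodic_tiling_def)
qed

lemma deg_vdeg: "deg x = real (vdeg T x)"
  unfolding deg_def nb_def vdeg_eq by simp

lemma trans_prob_sum: assumes "v \<in> verts T"
  shows "(\<Sum>w\<in>nb v. trans_prob T v w * g w) = avg g v"
  unfolding avg_def trans_prob_def deg_vdeg sum_divide_distrib by (simp add: divide_inverse mult_ac)

lemma pmf_walk_step: assumes v: "v \<in> verts T" shows "pmf (walk_step T v) w = trans_prob T v w"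
  unfolding walk_step_def
proof (rule pmf_embed_pmf)
  show "0 \<le> trans_prob T v x" for x by (simp add: trans_prob_def)
  have "(\<integral>\<^sup>+x. ennreal (trans_prob T v x) \<partial>count_space UNIV) = (\<integral>\<^sup>+x. ennreal (trans_prob T v x) \<partial>count_space (nb v))"
    by (rule nn_integral_count_space_eq) (auto simp: trans_prob_def nb_def)
  also have "\<dots> = (\<Sum>x\<in>nb v. ennreal (trans_prob T v x))" by (simp add: nn_integral_count_space_finite)
  also have "\<dots> = ennreal (\<Sum>x\<in>nb v. trans_prob T v x * 1)" by (subst sum_ennreal[symmetric]) (auto simp: trans_prob_def)
  also have "\<dots> = 1" unfolding trans_prob_sum[OF v] using avg_const[OF v, of 1] by simp
  finally show "(\<integral>\<^sup>+x. ennreal (trans_prob T v x) \<partial>count_space UNIV) = 1" .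
qed

lemma set_walk_step: "v \<in> verts T \<Longrightarrow> set_pmf (walk_step T v) \<subseteq> nb v"
  by (auto simp: set_pmf_eq pmf_walk_step trans_prob_def nb_def)

lemma nn_walk_step:
  assumes v: "v \<in> verts T" and g: "\<And>x. 0 \<le> g x"
  shows "(\<integral>\<^sup>+y. ennreal (g y) \<partial>measure_pmf (walk_step T v)) = ennreal (avg g v)"
proof -
  have "(\<integral>\<^sup>+y. ennreal (g y) \<partial>measure_pmf (walk_step T v)) = (\<Sum>y\<in>nb v. ennreal (g y) * ennreal (pmf (walk_step T v) y))"
    using set_walk_step[OF v] by (intro nn_integral_measure_pmf_support) auto
  also have "\<dots> = ennreal (\<Sum>y\<in>nb v. trans_prob T v y * g y)"
    using g by (subst sum_ennreal[symmetric]) (auto simp: pmf_walk_step[OF v] trans_prob_def ennreal_mult' mult.commute ennreal_mult[symmetric])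
  finally show ?thesis unfolding trans_prob_sum[OF v] .
qed

section \<open>Path measure and Markov property\<close>

abbreviation paths :: "nat set \<Rightarrow> (nat \<Rightarrow> real ^ 'n) measure" where
  "paths J \<equiv> PiM J (\<lambda>_. count_space UNIV)"

interpretation IT: Ionescu_Tulcea "walk_kernel T v" "\<lambda>_. count_space UNIV" for v
  by (rule Ionescu_Tulcea_walk_kernel)

lemma walk_lim: "walk T v = IT.PF.lim v"
  by (simp add: walk_def)

lemma sets_walk [measurable_cong]: "sets (walk T v) = sets (paths UNIV)"
  unfolding walk_lim by simp

lemma space_walk: "space (walk T v) = UNIV"
  unfolding walk_lim by (simp add: space_PiM)

lemma prob_space_walk: "prob_space (walk T v)"
proof (rule prob_space_distrD)
  show "(\<lambda>\<omega>. restrict \<omega> {}) \<in> measurable (walk T v) (paths {})"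
    by (simp add: measurable_cong_sets[OF sets_walk refl])
  show "prob_space (distr (walk T v) (paths {}) (\<lambda>\<omega>. restrict \<omega> {}))"
    unfolding walk_lim using IT.distr_lim[of "{}" v] IT.PF.prob_space_P[of "{}" v] by simp
qed

lemma coord_measurable [measurable]: "(\<lambda>\<omega>. \<omega> n) \<in> measurable (walk T v) (count_space UNIV)"
  by (simp add: measurable_cong_sets[OF sets_walk refl])

lemma distr_walk: "distr (walk T v) (paths {0..<m}) (\<lambda>\<omega>. restrict \<omega> {0..<m}) = IT.C v 0 m (\<lambda>_. undefined)"
proof -
  have "IT.up_to {0..<m} = m"
    unfolding IT.up_to_def
  proof (rule Least_equality)
    fix y assume y: "\<forall>i\<ge>y. i \<notin> {0..<m}"
    show "m \<le> y"
    proof (rule ccontr)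
      assume "\<not> m \<le> y"
      then show False using y by auto
    qed
  qed auto
  then have "IT.CI v {0..<m} = distr (IT.C v 0 m (\<lambda>_. undefined)) (paths {0..<m}) (\<lambda>f. restrict f {0..<m})"
    by (simp add: IT.CI_def)
  also have "\<dots> = IT.C v 0 m (\<lambda>_. undefined)"
    using IT.distr_C[of m m "\<lambda>_. undefined" 0 v] by (simp add: space_PiM)
  finally show ?thesis unfolding walk_lim using IT.distr_lim[of "{0..<m}" v] by simp
qed

text \<open>
  The distribution of the first \<open>n + 2\<close> positions is that of the first \<open>n + 1\<close>, extended by one step of the
  transition kernel. Only products of a function of the past with a function of the new position are
  considered: other functions on a product of uncountable discrete spaces need not be measurable.
\<close>

lemma markov_nn:
  assumes g: "g \<in> borel_measurable (paths {0..<Suc n})"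
  shows "(\<integral>\<^sup>+\<omega>. g (restrict \<omega> {0..<Suc n}) * h (\<omega> (Suc n)) \<partial>walk T v)
    = (\<integral>\<^sup>+\<omega>. g (restrict \<omega> {0..<Suc n}) * (\<integral>\<^sup>+y. h y \<partial>measure_pmf (walk_step T (\<omega> n))) \<partial>walk T v)"
proof -
  note [measurable] = g
  let ?N = "Suc n" and ?N2 = "Suc (Suc n)"
  have coord: "(\<lambda>x. x i) \<in> measurable (paths {0..<m}) (count_space UNIV)" if "i < m" for i m
    using that by (intro measurable_component_singleton) auto
  have [measurable]: "(\<lambda>\<omega>. restrict \<omega> {0..<m}) \<in> measurable (walk T v) (paths {0..<m})" for m
    by (simp add: measurable_cong_sets[OF sets_walk refl])
  have r: "(\<lambda>x. restrict x {0..<?N}) \<in> measurable (paths {0..<?N2}) (paths {0..<?N})"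
    by (rule measurable_restrict_subset) auto
  define f where "f x = g (restrict x {0..<?N}) * h (x ?N)" for x
  have f[measurable]: "f \<in> borel_measurable (paths {0..<?N2})"
    unfolding f_def
  proof (rule borel_measurable_times_ennreal)
    show "(\<lambda>x. g (restrict x {0..<?N})) \<in> borel_measurable (paths {0..<?N2})"
      by (rule measurable_compose[OF r g])
    show "(\<lambda>x. h (x ?N)) \<in> borel_measurable (paths {0..<?N2})"
      by (rule measurable_compose[OF coord]) auto
  qed
  define k where "k x = g x * (\<integral>\<^sup>+y. h y \<partial>measure_pmf (walk_step T (x n)))" for x
  have k[measurable]: "k \<in> borel_measurable (paths {0..<?N})"
    unfolding k_def
  proof (rule borel_measurable_times_ennreal[OF g])
    show "(\<lambda>x. \<integral>\<^sup>+y. h y \<partial>measure_pmf (walk_step T (x n))) \<in> borel_measurable (paths {0..<?N})"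
      by (rule measurable_compose[OF coord]) auto
  qed
  have sp: "(\<lambda>_. undefined) \<in> space (paths {0..<0})" by (simp add: space_PiM)
  have "(\<integral>\<^sup>+\<omega>. g (restrict \<omega> {0..<?N}) * h (\<omega> ?N) \<partial>walk T v) = (\<integral>\<^sup>+\<omega>. f (restrict \<omega> {0..<?N2}) \<partial>walk T v)"
    by (intro nn_integral_cong) (simp add: f_def restrict_restrict Int_absorb1)
  also have "\<dots> = (\<integral>\<^sup>+x. f x \<partial>IT.C v 0 ?N2 (\<lambda>_. undefined))"
    unfolding distr_walk[symmetric] by (subst nn_integral_distr) auto
  also have "\<dots> = (\<integral>\<^sup>+x. \<integral>\<^sup>+z. f z \<partial>IT.eP v ?N x \<partial>IT.C v 0 ?N (\<lambda>_. undefined))"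
  proof -
    have sC: "sets (IT.C v 0 ?N (\<lambda>_. undefined)) = sets (paths {0..<?N})"
      using IT.sets_C[OF sp, of v ?N] unfolding add_0 .
    have "IT.eP v ?N \<in> measurable (IT.C v 0 ?N (\<lambda>_. undefined)) (subprob_algebra (paths {0..<?N2}))"
      unfolding measurable_cong_sets[OF sC refl] by (rule IT.measurable_eP)
    from nn_integral_bind[OF f this] show ?thesis
      using IT.C.simps(2)[of v 0 ?N "\<lambda>_. undefined"] unfolding add_0 by (simp only:)
  qed
  also have "\<dots> = (\<integral>\<^sup>+x. k x \<partial>IT.C v 0 ?N (\<lambda>_. undefined))"
  proof (intro nn_integral_cong)
    fix x assume "x \<in> space (IT.C v 0 ?N (\<lambda>_. undefined))"
    then have x: "x \<in> space (paths {0..<?N})" using IT.space_C[OF sp, of v ?N] by simp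
    have "(\<integral>\<^sup>+z. f z \<partial>IT.eP v ?N x) = (\<integral>\<^sup>+y. f (x(?N := y)) \<partial>walk_kernel T v ?N x)"
      by (rule IT.nn_integral_eP[OF x f])
    also have "\<dots> = (\<integral>\<^sup>+y. g x * h y \<partial>measure_pmf (walk_step T (x n)))"
    proof -
      have "restrict (x(?N := y)) {0..<?N} = x" for y
        using x by (auto simp: space_PiM PiE_def extensional_def fun_eq_iff restrict_def)
      then show ?thesis by (simp add: f_def walk_kernel_def)
    qed
    also have "\<dots> = k x" by (simp add: k_def nn_integral_cmult)
    finally show "(\<integral>\<^sup>+z. f z \<partial>IT.eP v ?N x) = k x" .
  qed
  also have "\<dots> = (\<integral>\<^sup>+\<omega>. k (restrict \<omega> {0..<?N}) \<partial>walk T v)"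
    unfolding distr_walk[symmetric] by (subst nn_integral_distr) auto
  also have "\<dots> = (\<integral>\<^sup>+\<omega>. g (restrict \<omega> {0..<?N}) * (\<integral>\<^sup>+y. h y \<partial>measure_pmf (walk_step T (\<omega> n))) \<partial>walk T v)"
    by (intro nn_integral_cong) (simp add: k_def)
  finally show ?thesis .
qed

lemma walk_start: "AE \<omega> in walk T v. \<omega> 0 = v"
proof -
  have sp: "(\<lambda>_. undefined) \<in> space (paths {0..<0})" by (simp add: space_PiM)
  let ?I = "\<lambda>x. indicator {x. x \<noteq> v} (x (0::nat)) :: ennreal"
  have c0: "(\<lambda>x. x 0) \<in> measurable (paths {0..<Suc 0}) (count_space UNIV)"
    by (intro measurable_component_singleton) auto
  have I: "?I \<in> borel_measurable (paths {0..<Suc 0})"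
    by (rule measurable_compose[OF c0]) simp
  have "(\<integral>\<^sup>+\<omega>. ?I (restrict \<omega> {0..<Suc 0}) \<partial>walk T v) = (\<integral>\<^sup>+x. ?I x \<partial>IT.C v 0 (Suc 0) (\<lambda>_. undefined))"
    unfolding distr_walk[symmetric] using I
    by (subst nn_integral_distr) (auto simp: measurable_cong_sets[OF sets_walk refl])
  also have "\<dots> = (\<integral>\<^sup>+x. ?I x \<partial>IT.eP v 0 (\<lambda>_. undefined))"
    unfolding IT.C.simps add_0 by (subst bind_return[OF IT.measurable_eP sp]) (rule refl)
  also have "\<dots> = (\<integral>\<^sup>+y. ?I ((\<lambda>_. undefined)(0 := y)) \<partial>walk_kernel T v 0 (\<lambda>_. undefined))"
    by (rule IT.nn_integral_eP[OF sp I])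
  also have "\<dots> = 0" by (simp add: walk_kernel_def)
  finally have z: "(\<integral>\<^sup>+\<omega>. indicator {x. x \<noteq> v} (\<omega> 0) \<partial>walk T v) = 0" by simp
  have "(\<lambda>\<omega>. indicator {x. x \<noteq> v} (\<omega> 0) :: ennreal) \<in> borel_measurable (walk T v)"
    by (rule measurable_compose[OF coord_measurable]) simp
  from nn_integral_0_iff_AE[OF this] z show ?thesis by (auto split: split_indicator_asm)
qed


section \<open>The return time and optional stopping\<close>

text \<open>
  The positions possible at time \<open>n\<close>. They are finite in number, which makes every function of a single
  position essentially bounded.
\<close>

primrec reach :: "real ^ 'n \<Rightarrow> nat \<Rightarrow> (real ^ 'n) set" where
  "reach v 0 = {v}"
| "reach v (Suc n) = (\<Union>x\<in>reach v n. nb x)"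

lemma finite_reach: "finite (reach v n)" by (induction n) auto

lemma reach_V: "v \<in> verts T \<Longrightarrow> reach v n \<subseteq> verts T"
  by (cases n) (auto dest: nb_V)

lemma measurable_coord_fun: "(\<lambda>\<omega>. G (\<omega> n)) \<in> measurable (walk T v) (count_space UNIV)"
  by (rule measurable_compose[OF coord_measurable]) simp

lemma measurable_coord_borel: "(\<lambda>\<omega>. G (\<omega> n)) \<in> borel_measurable (walk T v)"
  by (rule measurable_compose[OF coord_measurable]) simp

lemma walk_step_AE:
  assumes x: "x \<in> verts T"
  shows "AE \<omega> in walk T v. \<omega> n = x \<longrightarrow> \<omega> (Suc n) \<in> nb x"
proof -
  let ?g = "\<lambda>\<omega>. indicator {x} (\<omega> n) :: ennreal" and ?h = "indicator (- nb x) :: _ \<Rightarrow> ennreal"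
  have g: "?g \<in> borel_measurable (paths {0..<Suc n})"
    by (rule measurable_compose[OF measurable_component_singleton]) auto
  have "(\<integral>\<^sup>+y. ?h y \<partial>measure_pmf (walk_step T x)) = 0"
    using set_walk_step[OF x] by (subst nn_integral_0_iff_AE) (auto simp: AE_measure_pmf_iff)
  then have z: "?g \<omega> * (\<integral>\<^sup>+y. ?h y \<partial>measure_pmf (walk_step T (\<omega> n))) = 0" for \<omega>
    by (auto split: split_indicator)
  have gr: "?g (restrict \<omega> {0..<Suc n}) = ?g \<omega>" for \<omega> by simp
  have "(\<integral>\<^sup>+\<omega>. ?g \<omega> * ?h (\<omega> (Suc n)) \<partial>walk T v) = 0"
    using markov_nn[where v = v and h = ?h, OF g] unfolding gr z by simp
  moreover have "(\<lambda>\<omega>. ?g \<omega> * ?h (\<omega> (Suc n))) \<in> borel_measurable (walk T v)"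
    by (intro borel_measurable_times_ennreal measurable_coord_borel)
  ultimately have "AE \<omega> in walk T v. ?g \<omega> * ?h (\<omega> (Suc n)) = 0"
    by (subst (asm) nn_integral_0_iff_AE) auto
  then show ?thesis by (rule AE_mp) (auto split: split_indicator_asm)
qed

lemma walk_reach:
  assumes v: "v \<in> verts T"
  shows "AE \<omega> in walk T v. \<omega> n \<in> reach v n"
proof (induction n)
  case 0
  then show ?case using walk_start[of v] by simp
next
  case (Suc n)
  have "AE \<omega> in walk T v. \<forall>x\<in>reach v n. \<omega> n = x \<longrightarrow> \<omega> (Suc n) \<in> nb x"
    using finite_reach reach_V[OF v] by (intro AE_finite_allI walk_step_AE) auto
  with Suc show ?case by eventually_elim auto
qed

lemma walk_path:
  assumes v: "v \<in> verts T"
  shows "AE \<omega> in walk T v. \<omega> 0 = v \<and> (\<forall>n. \<omega> n \<in> reach v n) \<and> (\<forall>n. \<omega> (Suc n) \<in> nb (\<omega> n)) \<and> (\<forall>n. \<omega> n \<in> verts T)"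
proof -
  have "AE \<omega> in walk T v. \<forall>n. \<forall>x\<in>reach v n. \<omega> n = x \<longrightarrow> \<omega> (Suc n) \<in> nb x"
    using finite_reach reach_V[OF v] by (subst AE_all_countable, intro allI AE_finite_allI walk_step_AE) auto
  moreover have "AE \<omega> in walk T v. \<forall>n. \<omega> n \<in> reach v n"
    using walk_reach[OF v] by (subst AE_all_countable) auto
  ultimately show ?thesis using walk_start[of v]
    by eventually_elim (use reach_V[OF v] in blast)
qed

text \<open>
  The indicator of not having returned by time \<open>n\<close>, as a function of the path up to time \<open>n\<close>; almost surely it
  is the indicator of \<open>n < return_time T \<omega>\<close> (\<open>return_time_props\<close>).
\<close>

definition alive :: "nat \<Rightarrow> (nat \<Rightarrow> real ^ 'n) \<Rightarrow> real" where
  "alive n \<omega> = (if \<forall>i\<in>{1..n}. \<omega> i \<notin> lattice T then 1 else 0)"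

lemma alive_measurable:
  assumes "\<And>i. i \<le> n \<Longrightarrow> i \<in> J" shows "alive n \<in> borel_measurable (paths J)"
proof -
  have "(\<lambda>\<omega>. \<omega> i \<notin> lattice T) \<in> measurable (paths J) (count_space UNIV)" if "i \<in> {1..n}" for i
    using assms that by (intro measurable_compose[OF measurable_component_singleton]) auto
  then have "(\<lambda>\<omega>. \<forall>i\<in>{1..n}. \<omega> i \<notin> lattice T) \<in> measurable (paths J) (count_space UNIV)"
    by (intro pred_intros_finite) auto
  then show ?thesis unfolding alive_def by measurable
qed

lemma alive_measurable_walk: "alive n \<in> borel_measurable (walk T v)"
  using alive_measurable[of n UNIV] by (simp add: measurable_cong_sets[OF sets_walk refl])

lemma integrable_bounded_walk:
  assumes "f \<in> borel_measurable (walk T v)" "AE \<omega> in walk T v. \<bar>f \<omega>\<bar> \<le> (B::real)"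
  shows "integrable (walk T v) f"
proof -
  interpret prob_space "walk T v" by (rule prob_space_walk)
  show ?thesis using assms by (intro integrable_const_bound[of _ B]) auto
qed

lemma alive_le: "0 \<le> alive n \<omega>" "alive n \<omega> \<le> 1" by (auto simp: alive_def)

lemma integrable_alive:
  assumes v: "v \<in> verts T"
  shows "integrable (walk T v) (\<lambda>\<omega>. alive n \<omega> * G (\<omega> m))"
proof (rule integrable_bounded_walk)
  show "(\<lambda>\<omega>. alive n \<omega> * G (\<omega> m)) \<in> borel_measurable (walk T v)"
    by (intro borel_measurable_times alive_measurable_walk measurable_coord_borel)
  have pt: "\<bar>alive n \<omega> * G (\<omega> m)\<bar> \<le> (\<Sum>x\<in>reach v m. \<bar>G x\<bar>)" if "\<omega> m \<in> reach v m" for \<omega>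
  proof -
    have "\<bar>alive n \<omega> * G (\<omega> m)\<bar> \<le> 1 * \<bar>G (\<omega> m)\<bar>"
      unfolding abs_mult using alive_le[of n \<omega>] by (intro mult_right_mono) auto
    also have "\<dots> \<le> (\<Sum>x\<in>reach v m. \<bar>G x\<bar>)" using that finite_reach member_le_sum[of "\<omega> m" "reach v m" "\<lambda>x. \<bar>G x\<bar>"] by simp
    finally show ?thesis .
  qed
  show "AE \<omega> in walk T v. \<bar>alive n \<omega> * G (\<omega> m)\<bar> \<le> (\<Sum>x\<in>reach v m. \<bar>G x\<bar>)"
    using walk_reach[OF v, of m] by (rule eventually_mono) (use pt in blast)
qed

lemma markov_nonneg:
  assumes v: "v \<in> verts T" and F: "\<And>x. 0 \<le> F x"
  shows "(\<integral>\<omega>. alive n \<omega> * F (\<omega> (Suc n)) \<partial>walk T v) = (\<integral>\<omega>. alive n \<omega> * avg F (\<omega> n) \<partial>walk T v)"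
proof -
  let ?g = "\<lambda>\<omega>. ennreal (alive n \<omega>)"
  have avgF: "0 \<le> avg F x" for x
    unfolding avg_def using F by (intro divide_nonneg_nonneg sum_nonneg mult_nonneg_nonneg) (auto simp: deg_nonneg)
  have g: "?g \<in> borel_measurable (paths {0..<Suc n})"
    by (intro measurable_compose[OF alive_measurable measurable_ennreal]) auto
  have gr: "?g (restrict \<omega> {0..<Suc n}) = ?g \<omega>" for \<omega> by (simp add: alive_def)
  have "(\<integral>\<^sup>+\<omega>. ennreal (alive n \<omega> * F (\<omega> (Suc n))) \<partial>walk T v) = (\<integral>\<^sup>+\<omega>. ?g \<omega> * ennreal (F (\<omega> (Suc n))) \<partial>walk T v)"
    using F alive_le by (simp add: ennreal_mult)
  also have "\<dots> = (\<integral>\<^sup>+\<omega>. ?g \<omega> * (\<integral>\<^sup>+y. ennreal (F y) \<partial>measure_pmf (walk_step T (\<omega> n))) \<partial>walk T v)"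
    using markov_nn[where v = v and h = "\<lambda>y. ennreal (F y)", OF g] unfolding gr .
  also have "\<dots> = (\<integral>\<^sup>+\<omega>. ennreal (alive n \<omega> * avg F (\<omega> n)) \<partial>walk T v)"
  proof (rule nn_integral_cong_AE)
    have pt: "?g \<omega> * (\<integral>\<^sup>+y. ennreal (F y) \<partial>measure_pmf (walk_step T (\<omega> n))) = ennreal (alive n \<omega> * avg F (\<omega> n))"
      if "\<omega> n \<in> reach v n" for \<omega>
      using nn_walk_step[OF _ F, of "\<omega> n"] that reach_V[OF v, of n] avgF alive_le by (auto simp: ennreal_mult)
    show "AE \<omega> in walk T v. ?g \<omega> * (\<integral>\<^sup>+y. ennreal (F y) \<partial>measure_pmf (walk_step T (\<omega> n))) = ennreal (alive n \<omega> * avg F (\<omega> n))"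
      using walk_reach[OF v, of n] by (rule eventually_mono) (use pt in blast)
  qed
  finally have eq: "(\<integral>\<^sup>+\<omega>. ennreal (alive n \<omega> * F (\<omega> (Suc n))) \<partial>walk T v) = (\<integral>\<^sup>+\<omega>. ennreal (alive n \<omega> * avg F (\<omega> n)) \<partial>walk T v)" .
  show ?thesis
    using F avgF alive_le
    by (subst (1 2) integral_eq_nn_integral)
       (auto simp: eq intro!: borel_measurable_times alive_measurable_walk measurable_coord_borel)
qed

text \<open>
  Positive and negative parts are treated separately; both are integrable because positions at a given time are
  confined to a finite set.
\<close>

lemma markov_real:
  assumes v: "v \<in> verts T"
  shows "(\<integral>\<omega>. alive n \<omega> * F (\<omega> (Suc n)) \<partial>walk T v) = (\<integral>\<omega>. alive n \<omega> * avg F (\<omega> n) \<partial>walk T v)"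
proof -
  let ?p = "\<lambda>x. max 0 (F x)" and ?m = "\<lambda>x. max 0 (- F x)"
  have F: "F x = ?p x - ?m x" for x by simp
  have "(\<integral>\<omega>. alive n \<omega> * F (\<omega> (Suc n)) \<partial>walk T v)
     = (\<integral>\<omega>. alive n \<omega> * ?p (\<omega> (Suc n)) - alive n \<omega> * ?m (\<omega> (Suc n)) \<partial>walk T v)"
    by (intro Bochner_Integration.integral_cong refl) (simp add: max_def)
  also have "\<dots> = (\<integral>\<omega>. alive n \<omega> * ?p (\<omega> (Suc n)) \<partial>walk T v) - (\<integral>\<omega>. alive n \<omega> * ?m (\<omega> (Suc n)) \<partial>walk T v)"
    using integrable_alive[OF v, of n ?p "Suc n"] integrable_alive[OF v, of n ?m "Suc n"]
    by (rule Bochner_Integration.integral_diff)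
  also have "\<dots> = (\<integral>\<omega>. alive n \<omega> * avg ?p (\<omega> n) \<partial>walk T v) - (\<integral>\<omega>. alive n \<omega> * avg ?m (\<omega> n) \<partial>walk T v)"
    using markov_nonneg[OF v, of ?p n] markov_nonneg[OF v, of ?m n] by simp
  also have "\<dots> = (\<integral>\<omega>. alive n \<omega> * avg ?p (\<omega> n) - alive n \<omega> * avg ?m (\<omega> n) \<partial>walk T v)"
    using integrable_alive[OF v, of n "avg ?p" n] integrable_alive[OF v, of n "avg ?m" n]
    by (rule Bochner_Integration.integral_diff[symmetric])
  also have "\<dots> = (\<integral>\<omega>. alive n \<omega> * avg F (\<omega> n) \<partial>walk T v)"
  proof -
    have "avg F = (\<lambda>x. avg ?p x - avg ?m x)" unfolding avg_diff[symmetric] using F by (simp add: fun_eq_iff[symmetric])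
    then show ?thesis by (simp add: right_diff_distrib)
  qed
  finally show ?thesis .
qed

text \<open>
  The expected return time is finite. With \<open>\<phi>\<close> from \<open>hitting_potential\<close>, the expectation of \<open>\<phi>\<close> at time \<open>n\<close>
  on paths that have not returned drops, from time 1 on, by exactly the probability of not having returned,
  and stays bounded.
\<close>

lemma summable_alive:
  assumes v: "v \<in> verts T"
  shows "summable (\<lambda>n. \<integral>\<omega>. alive n \<omega> \<partial>walk T v)"
proof -
  obtain \<phi> B where \<phi>: "\<And>l. l \<in> lattice T \<Longrightarrow> \<phi> l = 0" "\<And>x. x \<in> verts T - lattice T \<Longrightarrow> \<phi> x - avg \<phi> x = 1"
    "\<And>x. x \<in> verts T \<Longrightarrow> \<bar>\<phi> x\<bar> \<le> B" using hitting_potential by blast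
  define p where "p n = (\<integral>\<omega>. alive n \<omega> \<partial>walk T v)" for n
  define a where "a n = (\<integral>\<omega>. alive n \<omega> * \<phi> (\<omega> n) \<partial>walk T v)" for n
  interpret prob_space "walk T v" by (rule prob_space_walk)
  have B0: "0 \<le> B" using \<phi>(3)[OF v] by linarith
  have p0: "0 \<le> p n" for n unfolding p_def by (intro integral_nonneg_AE) (auto simp: alive_le)
  have aB: "\<bar>a n\<bar> \<le> B" for n
  proof -
    have "\<bar>a n\<bar> \<le> (\<integral>\<omega>. \<bar>alive n \<omega> * \<phi> (\<omega> n)\<bar> \<partial>walk T v)" unfolding a_def by (rule integral_abs_bound)
    also have "\<dots> \<le> (\<integral>\<omega>. B \<partial>walk T v)"
    proof (rule integral_mono_AE)
      show "integrable (walk T v) (\<lambda>\<omega>. \<bar>alive n \<omega> * \<phi> (\<omega> n)\<bar>)" using integrable_alive[OF v] by (rule integrable_abs)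
      have pt: "\<bar>alive n \<omega> * \<phi> (\<omega> n)\<bar> \<le> B" if "\<omega> n \<in> verts T" for \<omega>
      proof -
        have "\<bar>alive n \<omega>\<bar> * \<bar>\<phi> (\<omega> n)\<bar> \<le> 1 * B" using alive_le[of n \<omega>] \<phi>(3)[OF that] by (intro mult_mono) auto
        then show ?thesis by (simp add: abs_mult)
      qed
      show "AE \<omega> in walk T v. \<bar>alive n \<omega> * \<phi> (\<omega> n)\<bar> \<le> B"
        using walk_path[OF v] by (rule eventually_mono) (use pt in blast)
    qed simp
    also have "\<dots> = B" by (simp add: prob_space)
    finally show ?thesis .
  qed
  have rec: "a (Suc n) = a n - p n" if n: "n \<ge> 1" for n
  proof -
    have "alive (Suc n) \<omega> * \<phi> (\<omega> (Suc n)) = alive n \<omega> * \<phi> (\<omega> (Suc n))" for \<omega>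
      using \<phi>(1)[of "\<omega> (Suc n)"] by (auto simp: alive_def le_Suc_eq)
    then have "a (Suc n) = (\<integral>\<omega>. alive n \<omega> * avg \<phi> (\<omega> n) \<partial>walk T v)"
      unfolding a_def by (simp only: markov_real[OF v])
    also have "\<dots> = (\<integral>\<omega>. alive n \<omega> * \<phi> (\<omega> n) - alive n \<omega> * 1 \<partial>walk T v)"
    proof (rule integral_cong_AE)
      have pt: "alive n \<omega> * avg \<phi> (\<omega> n) = alive n \<omega> * \<phi> (\<omega> n) - alive n \<omega> * 1" if "\<omega> n \<in> verts T" for \<omega>
        using \<phi>(2)[of "\<omega> n"] n that by (cases "\<omega> n \<in> lattice T") (auto simp: alive_def)
      show "AE \<omega> in walk T v. alive n \<omega> * avg \<phi> (\<omega> n) = alive n \<omega> * \<phi> (\<omega> n) - alive n \<omega> * 1"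
        using walk_path[OF v] by (rule eventually_mono) (use pt in blast)
    qed (intro borel_measurable_times borel_measurable_diff alive_measurable_walk measurable_coord_borel borel_measurable_const)+
    also have "\<dots> = a n - p n"
      using Bochner_Integration.integral_diff[OF integrable_alive[OF v, of n \<phi> n] integrable_alive[OF v, of n "\<lambda>_. 1" n]]
      by (simp add: a_def p_def)
    finally show ?thesis .
  qed
  have "(\<Sum>k<n. p (Suc k)) = a 1 - a (Suc n)" for n
    by (induction n) (auto simp: rec)
  then have "(\<Sum>k<n. p (Suc k)) \<le> 2 * B" for n using aB[of 1] aB[of "Suc n"] by auto
  then have "summable (\<lambda>k. p (Suc k))" using p0 by (intro summableI_nonneg_bounded) auto
  then show ?thesis unfolding p_def by (subst (asm) summable_Suc_iff)
qed

text \<open>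
  The probability of never returning is below every term of a summable sequence.
\<close>

lemma walk_returns:
  assumes v: "v \<in> verts T"
  shows "AE \<omega> in walk T v. \<exists>n\<ge>1. \<omega> n \<in> lattice T"
proof -
  interpret prob_space "walk T v" by (rule prob_space_walk)
  let ?N = "{\<omega>. \<forall>n. alive n \<omega> = 1}"
  have N: "?N \<in> sets (walk T v)"
  proof -
    have "{\<omega>\<in>space (walk T v). \<forall>n. alive n \<omega> = 1} \<in> sets (walk T v)"
    proof (rule sets.sets_Collect_countable_All)
      fix n
      have [measurable]: "alive n \<in> borel_measurable (walk T v)" by (rule alive_measurable_walk)
      show "{\<omega>\<in>space (walk T v). alive n \<omega> = 1} \<in> sets (walk T v)" by measurable
    qed
    then show ?thesis by (simp add: space_walk)
  qed
  have le: "measure (walk T v) ?N \<le> (\<integral>\<omega>. alive n \<omega> \<partial>walk T v)" for n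
  proof -
    have "measure (walk T v) ?N = (\<integral>\<omega>. indicator ?N \<omega> \<partial>walk T v)" using N by simp
    also have "\<dots> \<le> (\<integral>\<omega>. alive n \<omega> \<partial>walk T v)"
    proof (rule integral_mono)
      show "integrable (walk T v) (indicat_real ?N)"
        by (rule integrable_bounded_walk[of _ _ 1]) (use N in \<open>auto split: split_indicator\<close>)
      show "integrable (walk T v) (alive n)" using integrable_alive[OF v, of n "\<lambda>_. 1" 0] by simp
      show "indicat_real ?N \<omega> \<le> alive n \<omega>" for \<omega> by (auto simp: alive_le split: split_indicator)
    qed
    finally show ?thesis .
  qed
  have "measure (walk T v) ?N \<le> 0"
    using summable_LIMSEQ_zero[OF summable_alive[OF v]] le by (intro LIMSEQ_le_const) auto
  then have "measure (walk T v) ?N = 0" by (simp add: antisym)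
  then have "AE \<omega> in walk T v. \<omega> \<notin> ?N" using prob_eq_0[OF N] by simp
  then show ?thesis
  proof (rule AE_mp, intro AE_I2 impI)
    fix \<omega> assume "\<omega> \<notin> ?N"
    then obtain n where "alive n \<omega> \<noteq> 1" by auto
    then obtain i where "i \<in> {1..n}" "\<omega> i \<in> lattice T" by (auto simp: alive_def split: if_splits)
    then show "\<exists>n\<ge>1. \<omega> n \<in> lattice T" by auto
  qed
qed

lemma return_time_props:
  assumes "\<exists>n\<ge>1. \<omega> n \<in> lattice T"
  shows "1 \<le> return_time T \<omega>" "\<omega> (return_time T \<omega>) \<in> lattice T"
    "alive j \<omega> = (if j < return_time T \<omega> then 1 else 0)"
proof -
  have ex: "1 \<le> return_time T \<omega> \<and> \<omega> (return_time T \<omega>) \<in> lattice T"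
    unfolding return_time_def by (rule LeastI_ex) (rule assms)
  then show "1 \<le> return_time T \<omega>" "\<omega> (return_time T \<omega>) \<in> lattice T" by auto
  have least: "\<not> (1 \<le> i \<and> \<omega> i \<in> lattice T)" if "i < return_time T \<omega>" for i
    using that unfolding return_time_def by (rule not_less_Least)
  show "alive j \<omega> = (if j < return_time T \<omega> then 1 else 0)"
  proof (cases "j < return_time T \<omega>")
    case True
    then have "\<forall>i\<in>{1..j}. \<omega> i \<notin> lattice T" using least by auto
    then show ?thesis using True by (simp add: alive_def)
  next
    case False
    then have "return_time T \<omega> \<in> {1..j}" using ex by auto
    then show ?thesis using False ex by (auto simp: alive_def)
  qed
qed

lemma return_time_measurable: "return_time T \<in> measurable (walk T v) (count_space UNIV)"
  unfolding return_time_def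
  by (intro measurable_Least measurable_coord_fun)

lemma stopped_measurable:
  assumes "\<And>n. f n \<in> measurable (walk T v) N"
  shows "(\<lambda>\<omega>. f (return_time T \<omega>) \<omega>) \<in> measurable (walk T v) N"
  using assms return_time_measurable by (rule measurable_compose_countable)

text \<open>
  A sum up to the return time is the series of the terms multiplied by \<open>alive j\<close>. Its integral may be taken
  termwise because the expected return time is finite.
\<close>

lemma stopped_series:
  fixes f :: "nat \<Rightarrow> (nat \<Rightarrow> real ^ 'n) \<Rightarrow> real"
  assumes v: "v \<in> verts T" and f: "\<And>j. f j \<in> borel_measurable (walk T v)"
    and B: "AE \<omega> in walk T v. \<forall>j. \<bar>f j \<omega>\<bar> \<le> B"
  shows "integrable (walk T v) (\<lambda>\<omega>. \<Sum>j<return_time T \<omega>. f j \<omega>)"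
    and "(\<integral>\<omega>. (\<Sum>j<return_time T \<omega>. f j \<omega>) \<partial>walk T v) = (\<Sum>j. \<integral>\<omega>. alive j \<omega> * f j \<omega> \<partial>walk T v)"
proof -
  let ?g = "\<lambda>j \<omega>. alive j \<omega> * f j \<omega>"
  have g: "?g j \<in> borel_measurable (walk T v)" for j by (intro borel_measurable_times alive_measurable_walk f)
  have bnd: "\<bar>?g j \<omega>\<bar> \<le> alive j \<omega> * \<bar>B\<bar>" if "\<bar>f j \<omega>\<bar> \<le> B" for j \<omega>
    using that alive_le[of j \<omega>] by (auto simp: abs_mult intro!: mult_mono)
  have int: "integrable (walk T v) (?g j)" for j
  proof (rule integrable_bounded_walk[OF g])
    have "\<bar>?g j \<omega>\<bar> \<le> \<bar>B\<bar>" if "\<forall>j. \<bar>f j \<omega>\<bar> \<le> B" for \<omega>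
      using bnd[of j \<omega>] that alive_le[of j \<omega>] mult_right_mono[of "alive j \<omega>" 1 "\<bar>B\<bar>"] by fastforce
    then show "AE \<omega> in walk T v. \<bar>?g j \<omega>\<bar> \<le> \<bar>B\<bar>" using B by (auto elim!: eventually_mono)
  qed
  have fin: "AE \<omega> in walk T v. (\<forall>j\<ge>return_time T \<omega>. ?g j \<omega> = 0) \<and> (\<Sum>j<return_time T \<omega>. ?g j \<omega>) = (\<Sum>j<return_time T \<omega>. f j \<omega>)"
    using walk_returns[OF v] by (rule eventually_mono) (auto simp: return_time_props)
  have summ: "AE \<omega> in walk T v. summable (\<lambda>j. norm (?g j \<omega>))"
    using fin
  proof (rule eventually_mono)
    fix \<omega> assume "(\<forall>j\<ge>return_time T \<omega>. ?g j \<omega> = 0) \<and> (\<Sum>j<return_time T \<omega>. ?g j \<omega>) = (\<Sum>j<return_time T \<omega>. f j \<omega>)"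
    then show "summable (\<lambda>j. norm (?g j \<omega>))" by (intro summable_finite[of "{..<return_time T \<omega>}"]) auto
  qed
  have "(\<integral>\<omega>. norm (?g j \<omega>) \<partial>walk T v) \<le> (\<integral>\<omega>. alive j \<omega> \<partial>walk T v) * \<bar>B\<bar>" for j
  proof -
    have "(\<integral>\<omega>. norm (?g j \<omega>) \<partial>walk T v) \<le> (\<integral>\<omega>. alive j \<omega> * \<bar>B\<bar> \<partial>walk T v)"
    proof (rule integral_mono_AE)
      show "AE \<omega> in walk T v. norm (?g j \<omega>) \<le> alive j \<omega> * \<bar>B\<bar>"
        using B by (rule eventually_mono) (simp only: real_norm_def, intro bnd, blast)
    qed (use int integrable_alive[OF v, of j "\<lambda>_. \<bar>B\<bar>" 0] in auto)
    then show ?thesis by simp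
  qed
  then have sum_int: "summable (\<lambda>j. \<integral>\<omega>. norm (?g j \<omega>) \<partial>walk T v)"
    by (intro summable_comparison_test'[OF summable_mult2[OF summable_alive[OF v], of "\<bar>B\<bar>"], of 0])
       (auto simp: abs_of_nonneg integral_nonneg_AE)
  have meas: "(\<lambda>\<omega>. \<Sum>j<return_time T \<omega>. f j \<omega>) \<in> borel_measurable (walk T v)"
    by (rule stopped_measurable[of "\<lambda>n \<omega>. \<Sum>j<n. f j \<omega>"]) (intro borel_measurable_sum f)
  have eq: "AE \<omega> in walk T v. (\<Sum>j. ?g j \<omega>) = (\<Sum>j<return_time T \<omega>. f j \<omega>)"
    using fin
  proof (rule eventually_mono)
    fix \<omega> assume a: "(\<forall>j\<ge>return_time T \<omega>. ?g j \<omega> = 0) \<and> (\<Sum>j<return_time T \<omega>. ?g j \<omega>) = (\<Sum>j<return_time T \<omega>. f j \<omega>)"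
    then have "(\<Sum>j. ?g j \<omega>) = (\<Sum>j<return_time T \<omega>. ?g j \<omega>)"
      by (intro suminf_finite) auto
    then show "(\<Sum>j. ?g j \<omega>) = (\<Sum>j<return_time T \<omega>. f j \<omega>)" using a by simp
  qed
  have I: "integrable (walk T v) (\<lambda>\<omega>. \<Sum>j. ?g j \<omega>)" by (rule integrable_suminf[OF int summ sum_int])
  have "integral\<^sup>L (walk T v) (\<lambda>\<omega>. \<Sum>j. ?g j \<omega>) = (\<Sum>j. \<integral>\<omega>. ?g j \<omega> \<partial>walk T v)"
    by (rule integral_suminf[OF int summ sum_int])
  then show "(\<integral>\<omega>. (\<Sum>j<return_time T \<omega>. f j \<omega>) \<partial>walk T v) = (\<Sum>j. \<integral>\<omega>. alive j \<omega> * f j \<omega> \<partial>walk T v)"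
    using integral_cong_AE[OF _ meas eq] I by simp
  show "integrable (walk T v) (\<lambda>\<omega>. \<Sum>j<return_time T \<omega>. f j \<omega>)"
    using integrable_cong_AE[OF _ meas eq] I by simp
qed

text \<open>
  Up to the return time, \<open>F\<close> at the final position exceeds \<open>F v\<close> by the sum of the increments
  \<open>F (\<omega> (Suc j)) - avg F (\<omega> j)\<close>, which have mean 0 by the Markov property, minus the sum of
  \<open>F (\<omega> j) - avg F (\<omega> j)\<close>. The Lipschitz condition bounds all terms, so \<open>stopped_series\<close> applies to both sums.
\<close>

lemma optional_stopping:
  assumes v: "v \<in> verts T" and lip: "\<And>x y. edge_mult T x y \<noteq> 0 \<Longrightarrow> \<bar>F x - F y\<bar> \<le> B"
  shows "integrable (walk T v) (\<lambda>\<omega>. F (\<omega> (return_time T \<omega>)))"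
    and "F v = (\<integral>\<omega>. (\<Sum>j<return_time T \<omega>. F (\<omega> j) - avg F (\<omega> j)) \<partial>walk T v)
      + (\<integral>\<omega>. F (\<omega> (return_time T \<omega>)) \<partial>walk T v)"
proof -
  interpret prob_space "walk T v" by (rule prob_space_walk)
  let ?\<tau> = "return_time T"
  let ?d = "\<lambda>j \<omega>. F (\<omega> (Suc j)) - avg F (\<omega> j)" and ?s = "\<lambda>j \<omega>. F (\<omega> j) - avg F (\<omega> j)"
  have lipnb: "\<bar>F x - F y\<bar> \<le> B" if "y \<in> nb x" for x y using lip[of x y] that by (simp add: nb_def)
  have sB: "\<bar>F x - avg F x\<bar> \<le> B" if x: "x \<in> verts T" for x
  proof -
    have "F x - avg F x = avg (\<lambda>y. F x - F y) x" using avg_const[OF x, of "F x"] by (simp add: avg_diff)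
    also have "\<bar>\<dots>\<bar> \<le> avg (\<lambda>y. \<bar>F x - F y\<bar>) x" by (rule avg_abs_le)
    also have "\<dots> \<le> avg (\<lambda>_. B) x" by (intro avg_mono lipnb)
    finally show ?thesis using avg_const[OF x] by simp
  qed
  have dB: "\<bar>F y - avg F x\<bar> \<le> 2 * B" if "x \<in> verts T" "y \<in> nb x" for x y
    using sB[OF that(1)] lipnb[OF that(2)] by linarith
  have d: "?d j \<in> borel_measurable (walk T v)" and s: "?s j \<in> borel_measurable (walk T v)" for j
    by (intro borel_measurable_diff measurable_coord_borel)+
  have dAE: "AE \<omega> in walk T v. \<forall>j. \<bar>?d j \<omega>\<bar> \<le> 2 * B"
    using walk_path[OF v] by (rule eventually_mono) (use dB in blast)
  have sAE: "AE \<omega> in walk T v. \<forall>j. \<bar>?s j \<omega>\<bar> \<le> B"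
    using walk_path[OF v] by (rule eventually_mono) (use sB in blast)
  note D = stopped_series[OF v d dAE] and S = stopped_series[OF v s sAE]
  have "(\<integral>\<omega>. alive j \<omega> * ?d j \<omega> \<partial>walk T v) = 0" for j
    using Bochner_Integration.integral_diff[OF integrable_alive[OF v, of j F "Suc j"] integrable_alive[OF v, of j "avg F" j]]
    by (simp add: right_diff_distrib markov_real[OF v])
  then have D0: "(\<integral>\<omega>. (\<Sum>j<?\<tau> \<omega>. ?d j \<omega>) \<partial>walk T v) = 0" unfolding D(2) by simp
  have meas: "(\<lambda>\<omega>. F (\<omega> (?\<tau> \<omega>))) \<in> borel_measurable (walk T v)"
    by (rule stopped_measurable[of "\<lambda>n \<omega>. F (\<omega> n)"]) (rule measurable_coord_borel)
  have tel: "(\<Sum>j<n. ?d j \<omega>) = F (\<omega> n) - F (\<omega> 0) + (\<Sum>j<n. ?s j \<omega>)" for n \<omega>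
    by (induction n) auto
  have eq: "AE \<omega> in walk T v. (F v + (\<Sum>j<?\<tau> \<omega>. ?d j \<omega>)) - (\<Sum>j<?\<tau> \<omega>. ?s j \<omega>) = F (\<omega> (?\<tau> \<omega>))"
    using walk_path[OF v] by (rule eventually_mono) (simp add: tel)
  have I: "integrable (walk T v) (\<lambda>\<omega>. (F v + (\<Sum>j<?\<tau> \<omega>. ?d j \<omega>)) - (\<Sum>j<?\<tau> \<omega>. ?s j \<omega>))"
    using D(1) S(1) by (intro Bochner_Integration.integrable_diff Bochner_Integration.integrable_add) auto
  then show "integrable (walk T v) (\<lambda>\<omega>. F (\<omega> (?\<tau> \<omega>)))"
    using integrable_cong_AE[OF _ meas eq] by simp
  have "(\<integral>\<omega>. F (\<omega> (?\<tau> \<omega>)) \<partial>walk T v) = (\<integral>\<omega>. (F v + (\<Sum>j<?\<tau> \<omega>. ?d j \<omega>)) - (\<Sum>j<?\<tau> \<omega>. ?s j \<omega>) \<partial>walk T v)"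
    using integral_cong_AE[OF _ meas eq] I by simp
  also have "\<dots> = (\<integral>\<omega>. F v + (\<Sum>j<?\<tau> \<omega>. ?d j \<omega>) \<partial>walk T v) - (\<integral>\<omega>. (\<Sum>j<?\<tau> \<omega>. ?s j \<omega>) \<partial>walk T v)"
    using D(1) S(1) by (intro Bochner_Integration.integral_diff Bochner_Integration.integrable_add) auto
  also have "(\<integral>\<omega>. F v + (\<Sum>j<?\<tau> \<omega>. ?d j \<omega>) \<partial>walk T v) = (\<integral>\<omega>. F v \<partial>walk T v) + (\<integral>\<omega>. (\<Sum>j<?\<tau> \<omega>. ?d j \<omega>) \<partial>walk T v)"
    using D(1) by (intro Bochner_Integration.integral_add) auto
  also have "(\<integral>\<omega>. F v \<partial>walk T v) = F v" by (simp add: prob_space)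
  finally show "F v = (\<integral>\<omega>. (\<Sum>j<?\<tau> \<omega>. ?s j \<omega>) \<partial>walk T v) + (\<integral>\<omega>. F (\<omega> (?\<tau> \<omega>)) \<partial>walk T v)"
    using D0 by simp
qed

text \<open>
  Stop the harmonic coordinate \<open>hcoord i\<close> at the return time: it agrees with the linear coordinate on the
  lattice, where the walk is stopped.
\<close>

lemma mean_return_coordinates:
  assumes v: "v \<in> verts T"
  shows "mean_return T v $ i = hcoord i v"
proof -
  obtain B where B: "\<And>i x y. edge_mult T x y \<noteq> 0 \<Longrightarrow> \<bar>hcoord i x - hcoord i y\<bar> \<le> B"
    using hcoord_lipschitz by auto
  let ?\<tau> = "return_time T"
  have meas: "(\<lambda>\<omega>. \<omega> (?\<tau> \<omega>) $ i) \<in> borel_measurable (walk T v)" for i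
    by (rule stopped_measurable[of "\<lambda>n \<omega>. \<omega> n $ i"]) (rule measurable_coord_borel)
  have eq: "AE \<omega> in walk T v. hcoord i (\<omega> (?\<tau> \<omega>)) = \<omega> (?\<tau> \<omega>) $ i" for i
    using walk_returns[OF v] by (rule eventually_mono) (simp add: hcoord_Lat return_time_props)
  have meas': "(\<lambda>\<omega>. hcoord i (\<omega> (?\<tau> \<omega>))) \<in> borel_measurable (walk T v)" for i
    by (rule stopped_measurable[of "\<lambda>n \<omega>. hcoord i (\<omega> n)"]) (rule measurable_coord_borel)
  have comp: "integrable (walk T v) (\<lambda>\<omega>. \<omega> (?\<tau> \<omega>) $ i)" "(\<integral>\<omega>. \<omega> (?\<tau> \<omega>) $ i \<partial>walk T v) = hcoord i v" for i
  proof -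
    note O = optional_stopping[OF v, of "hcoord i" B, OF B]
    show "integrable (walk T v) (\<lambda>\<omega>. \<omega> (?\<tau> \<omega>) $ i)"
      using integrable_cong_AE[OF meas' meas eq] O(1) by simp
    have "AE \<omega> in walk T v. (\<Sum>j<?\<tau> \<omega>. hcoord i (\<omega> j) - avg (hcoord i) (\<omega> j)) = 0"
      using walk_path[OF v] by (rule eventually_mono) (simp add: hcoord_harmonic)
    then have "(\<integral>\<omega>. (\<Sum>j<?\<tau> \<omega>. hcoord i (\<omega> j) - avg (hcoord i) (\<omega> j)) \<partial>walk T v) = 0"
      by (rule integral_eq_zero_AE)
    then show "(\<integral>\<omega>. \<omega> (?\<tau> \<omega>) $ i \<partial>walk T v) = hcoord i v"
      using O(2) integral_cong_AE[OF meas' meas eq] by simp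
  qed
  have vec: "x = (\<Sum>i\<in>UNIV. x $ i *\<^sub>R axis i 1)" for x :: "real ^ 'n"
    using basis_expansion[of x] by (simp add: scalar_mult_eq_scaleR)
  have "integrable (walk T v) (\<lambda>\<omega>. \<Sum>i\<in>UNIV. \<omega> (?\<tau> \<omega>) $ i *\<^sub>R (axis i 1 :: real ^ 'n))"
    using comp(1) by (intro Bochner_Integration.integrable_sum integrable_scaleR_left) auto
  then have "integrable (walk T v) (\<lambda>\<omega>. \<omega> (?\<tau> \<omega>))" unfolding vec[symmetric] .
  then have "(\<integral>\<omega>. \<omega> (?\<tau> \<omega>) \<partial>walk T v) \<bullet> axis i 1 = (\<integral>\<omega>. \<omega> (?\<tau> \<omega>) \<bullet> axis i 1 \<partial>walk T v)"
    by (simp add: integral_inner_left)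
  then show ?thesis unfolding mean_return_def using comp(2)[of i] by (simp add: inner_axis)
qed


section \<open>The potential kernel and Green convolution\<close>

lemma linear_class_green_bdd: "linear_class green_bdd"
  unfolding linear_class_def using green_bdd_zero green_bdd_add green_bdd_scale by blast

lemma linear_class_green_l2: "linear_class green_l2"
  unfolding linear_class_def using green_l2_zero green_l2_add green_l2_scale by blast

text \<open>
  By \<open>span_zero_sum\<close> it is enough to treat Laplacians and first differences of point masses. A first difference
  has decay rate \<open>d/4 + 1/2\<close>, and the further \<open>d/4\<close> for pointwise values brings this above 1 from \<open>d = 2\<close> on.
\<close>

lemma green_bdd_zero_sum:
  assumes d: "2 \<le> CARD('n)" and f: "fs f" "ip f (\<lambda>_. 1) = 0"
  shows "green_bdd f"
proof (rule span_zero_sum[OF f linear_class_green_bdd])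
  show "green_bdd (\<lambda>z. pmass x z - avg (pmass x) z)" if "x \<in> verts T" for x using that by (intro green_bdd_laplacian fs_pmass)
  show "green_bdd (sdiff l (pmass x))" if "x \<in> verts T" "l \<in> lattice T" for x l
    by (rule green_bdd_decays[OF decays_sdiff[OF that(2) decays_pmass[OF that(1)]]]) (use d in auto)
qed

lemma green_bdd_pmass: "3 \<le> CARD('n) \<Longrightarrow> x \<in> verts T \<Longrightarrow> green_bdd (pmass x)"
  by (rule green_bdd_decays[OF decays_pmass]) auto

lemma green_l2_dim5: assumes d: "5 \<le> CARD('n)" and f: "fs f" shows "green_l2 f"
proof (rule span_point_masses[OF f linear_class_green_l2])
  show "green_l2 (pmass x)" if "x \<in> verts T" for x
    by (rule green_l2_decays[OF decays_pmass[OF that]]) (use d in auto)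
qed

lemma green_l2_dim3: assumes d: "3 \<le> CARD('n)" and f: "fs f" "ip f (\<lambda>_. 1) = 0" shows "green_l2 f"
proof (rule span_zero_sum[OF f linear_class_green_l2])
  show "green_l2 (\<lambda>z. pmass x z - avg (pmass x) z)" if "x \<in> verts T" for x using that by (intro green_l2_laplacian fs_pmass)
  show "green_l2 (sdiff l (pmass x))" if "x \<in> verts T" "l \<in> lattice T" for x l
    by (rule green_l2_decays[OF decays_sdiff[OF that(2) decays_pmass[OF that(1)]]]) (use d in auto)
qed

lemma green_l2_dim2:
  assumes d: "2 \<le> CARD('n)" and f: "fs f" "ip f (\<lambda>_. 1) = 0" "\<And>i. ip f (hcoord i) = 0"
  shows "green_l2 f"
proof (rule span_zero_moments[where h = hcoord, OF hcoord_harmonic hcoord_shift f linear_class_green_l2])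
  show "green_l2 (\<lambda>z. pmass x z - avg (pmass x) z)" if "x \<in> verts T" for x using that by (intro green_l2_laplacian fs_pmass)
  show "green_l2 (sdiff l (sdiff m (pmass x)))" if "x \<in> verts T" "l \<in> lattice T" "m \<in> lattice T" for x l m
    by (rule green_l2_decays[OF decays_sdiff[OF that(2) decays_sdiff[OF that(3) decays_pmass[OF that(1)]]]]) (use d in auto)
qed

lemma heat_symmetric:
  assumes "x \<in> verts T" "y \<in> verts T" shows "(avg ^^ n) (pmass x) y = (avg ^^ n) (pmass y) x"
proof -
  have "(avg ^^ n) (pmass x) y = ip (pmass y) ((avg ^^ n) (pmass x))" using assms by (simp add: ip_pmass)
  also have "\<dots> = ip ((avg ^^ n) (pmass y)) (pmass x)" using assms by (simp add: ip_avg_pow fs_pmass)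
  also have "\<dots> = ip (pmass x) ((avg ^^ n) (pmass y))" using assms by (intro ip_commute) auto
  finally show ?thesis using assms by (simp add: ip_pmass)
qed

lemma infsum_finite_support:
  assumes "finite S" "S \<subseteq> A" "\<And>x. x \<in> A - S \<Longrightarrow> g x = 0"
  shows "infsum g A = sum g S"
proof -
  have "infsum g A = infsum g S" by (rule infsum_cong_neutral) (use assms in auto)
  then show ?thesis using assms(1) by simp
qed

lemma trans_prob_n_eq:
  assumes "x \<in> verts T" "v \<in> verts T"
  shows "trans_prob_n T n v x / real (vdeg T x) = (avg ^^ n) (pmass x) v"
  using assms(2)
proof (induction n arbitrary: v)
  case 0
  then show ?case by (simp add: pmass_def deg_vdeg)
next
  case (Suc n)
  have "trans_prob_n T (Suc n) v x = (\<Sum>w\<in>nb v. trans_prob T v w * trans_prob_n T n w x)"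
    unfolding trans_prob_n.simps
  proof (rule infsum_finite_support)
    show "nb v \<subseteq> verts T" using nb_V by blast
  qed (simp_all add: trans_prob_def nb_def finite_c[simplified])
  then have "trans_prob_n T (Suc n) v x / real (vdeg T x)
      = (\<Sum>w\<in>nb v. trans_prob T v w * (trans_prob_n T n w x / real (vdeg T x)))"
    by (simp add: sum_divide_distrib)
  also have "\<dots> = (\<Sum>w\<in>nb v. trans_prob T v w * (avg ^^ n) (pmass x) w)"
    using Suc.IH nb_V by (intro sum.cong) auto
  also have "\<dots> = avg ((avg ^^ n) (pmass x)) v" by (rule trans_prob_sum[OF Suc.prems])
  finally show ?case by simp
qed

text \<open>
  The constants subtracted in dimension 2 to make the Green series converge.
\<close>

definition renorm :: "nat \<Rightarrow> real" where
  "renorm n = (if CARD('n) = 2 then (avg ^^ n) (pmass 0) 0 else 0)"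

text \<open>
  The potential kernel; it is the Green's function with pole at any vertex \<open>v\<close>, evaluated at \<open>x\<close>
  (\<open>green_eq\<close>).
\<close>

definition pot :: "real ^ 'n \<Rightarrow> real ^ 'n \<Rightarrow> real" where
  "pot x v = (\<Sum>n. (avg ^^ n) (pmass x) v - renorm n)"

lemma ip_pmass_diff_one: "x \<in> verts T \<Longrightarrow> y \<in> verts T \<Longrightarrow> ip (\<lambda>z. pmass x z - pmass y z) (\<lambda>_. 1) = 0"
  by (simp add: ip_diff_left fs_pmass ip_pmass)

text \<open>
  In dimension 2, the terms are those of two Green sums of functions with zero sum: one for moving the pole
  from \<open>x\<close> to 0, evaluated at \<open>v\<close>, and, by symmetry of the heat kernel, one for moving \<open>v\<close> to 0, evaluated
  at 0.
\<close>

lemma pot_sums: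
  assumes d: "2 \<le> CARD('n)" and x: "x \<in> verts T" and v: "v \<in> verts T"
  shows "(\<lambda>n. (avg ^^ n) (pmass x) v - renorm n) sums pot x v"
proof -
  have "convergent (\<lambda>N. \<Sum>n<N. (avg ^^ n) (pmass x) v - renorm n)"
  proof (cases "CARD('n) = 2")
    case True
    have "(\<Sum>n<N. (avg ^^ n) (pmass x) v - renorm n)
        = green_sum N (\<lambda>z. pmass x z - pmass 0 z) v + green_sum N (\<lambda>z. pmass v z - pmass 0 z) 0" for N
      unfolding green_sum_def sum.distrib[symmetric] avg_pow_diff renorm_def
      using True heat_symmetric[OF v zero_V] by (intro sum.cong) auto
    moreover have "convergent (\<lambda>N. green_sum N (\<lambda>z. pmass y z - pmass 0 z) w)" if "y \<in> verts T" "w \<in> verts T" for y w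
      using green_bdd_zero_sum[OF d, of "\<lambda>z. pmass y z - pmass 0 z"] ip_pmass_diff_one[OF that(1) zero_V] that zero_V
      unfolding green_bdd_def by auto
    ultimately show ?thesis using x v zero_V by (simp add: convergent_add)
  next
    case False
    then have "green_bdd (pmass x)" using d x by (intro green_bdd_pmass) auto
    then show ?thesis using v False by (simp add: green_bdd_def green_sum_def renorm_def)
  qed
  then show ?thesis unfolding pot_def summable_iff_convergent[symmetric] by (rule summable_sums)
qed

lemma pot_lim:
  assumes d: "2 \<le> CARD('n)" and x: "x \<in> verts T" and v: "v \<in> verts T"
  shows "(\<lambda>N. green_sum N (pmass x) v - (\<Sum>n<N. renorm n)) \<longlonglongrightarrow> pot x v"
  using pot_sums[OF assms] unfolding sums_def green_sum_def sum_subtractf .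

lemma pot_symmetric: "x \<in> verts T \<Longrightarrow> v \<in> verts T \<Longrightarrow> pot x v = pot v x"
  unfolding pot_def using heat_symmetric by simp

lemma green_sum_shift: "l \<in> lattice T \<Longrightarrow> green_sum N f (x + l) = green_sum N (\<lambda>y. f (y + l)) x"
  by (simp add: green_sum_def avg_pow_shift)

text \<open>
  Up to lattice translations there are finitely many edges, and each contributes a function with zero sum.
\<close>

lemma dipole_bounded:
  assumes d: "2 \<le> CARD('n)"
  shows "\<exists>B. \<forall>v w. edge_mult T v w \<noteq> 0 \<longrightarrow> (\<forall>N. \<forall>x\<in>verts T. \<bar>green_sum N (\<lambda>z. pmass v z - pmass w z) x\<bar> \<le> B)"
proof -
  let ?E = "SIGMA v:fund. nb v"
  have fin: "finite ?E" using finite_fund by auto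
  define B where "B v w = (SOME B. \<forall>N. \<forall>x\<in>verts T. \<bar>green_sum N (\<lambda>z. pmass v z - pmass w z) x\<bar> \<le> B)" for v w
  have B: "\<bar>green_sum N (\<lambda>z. pmass v z - pmass w z) x\<bar> \<le> B v w"
    if "v \<in> verts T" "w \<in> verts T" "x \<in> verts T" for v w N x
  proof -
    have "green_bdd (\<lambda>z. pmass v z - pmass w z)"
      using that by (intro green_bdd_zero_sum[OF d] fs_diff fs_pmass ip_pmass_diff_one)
    then have "\<exists>B. \<forall>N. \<forall>x\<in>verts T. \<bar>green_sum N (\<lambda>z. pmass v z - pmass w z) x\<bar> \<le> B" by (simp add: green_bdd_def)
    from someI_ex[OF this] show ?thesis using that(3) unfolding B_def by blast
  qed
  have "\<bar>green_sum N (\<lambda>z. pmass v z - pmass w z) x\<bar> \<le> (\<Sum>(v, w)\<in>?E. \<bar>B v w\<bar>)"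
    if e: "edge_mult T v w \<noteq> 0" and x: "x \<in> verts T" for v w N x
  proof -
    have vw: "v \<in> verts T" "w \<in> verts T" using e c_vertices[of v w] c_vertices'[of v w] by auto
    define l where "l = rep v - v"
    have l: "l \<in> lattice T" using Lat_uminus[OF rep(2)[OF vw(1)]] by (simp add: l_def)
    have E: "(v + l, w + l) \<in> ?E" using c_shift[OF l, of v w] e rep_fund[OF vw(1)] by (auto simp: l_def nb_def)
    have "green_sum N (\<lambda>z. pmass v z - pmass w z) x = green_sum N (\<lambda>z. pmass (v + l) z - pmass (w + l) z) (x + l)"
      using pmass_shift[OF l] by (simp add: green_sum_shift[OF l])
    also have "\<bar>\<dots>\<bar> \<le> \<bar>B (v + l) (w + l)\<bar>"
      using B[of "v + l" "w + l" "x + l" N] V_shift[OF l] vw x by fastforce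
    also have "\<dots> \<le> (\<Sum>(v, w)\<in>?E. \<bar>B v w\<bar>)"
      using member_le_sum[OF E, of "\<lambda>(v, w). \<bar>B v w\<bar>"] fin by auto
    finally show ?thesis .
  qed
  then show ?thesis by blast
qed

lemma pot_lipschitz:
  assumes d: "2 \<le> CARD('n)"
  shows "\<exists>B. \<forall>x\<in>verts T. \<forall>v w. edge_mult T v w \<noteq> 0 \<longrightarrow> \<bar>pot x v - pot x w\<bar> \<le> B"
proof -
  obtain B where B: "\<And>v w N x. edge_mult T v w \<noteq> 0 \<Longrightarrow> x \<in> verts T \<Longrightarrow> \<bar>green_sum N (\<lambda>z. pmass v z - pmass w z) x\<bar> \<le> B"
    using dipole_bounded[OF d] by blast
  have "\<bar>pot x v - pot x w\<bar> \<le> B" if x: "x \<in> verts T" and e: "edge_mult T v w \<noteq> 0" for x v w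
  proof -
    have vw: "v \<in> verts T" "w \<in> verts T" using e c_vertices[of v w] c_vertices'[of v w] by auto
    have "green_sum N (pmass x) v - (\<Sum>n<N. renorm n) - (green_sum N (pmass x) w - (\<Sum>n<N. renorm n)) = green_sum N (\<lambda>z. pmass v z - pmass w z) x" for N
      unfolding green_sum_def avg_pow_diff sum_subtractf using heat_symmetric[OF x] vw by simp
    then have "(\<lambda>N. green_sum N (\<lambda>z. pmass v z - pmass w z) x) \<longlonglongrightarrow> pot x v - pot x w"
      using tendsto_diff[OF pot_lim[OF d x vw(1)] pot_lim[OF d x vw(2)]] by simp
    then have "(\<lambda>N. \<bar>green_sum N (\<lambda>z. pmass v z - pmass w z) x\<bar>) \<longlonglongrightarrow> \<bar>pot x v - pot x w\<bar>" by (rule tendsto_rabs)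
    then show ?thesis by (rule LIMSEQ_le_const2) (use B[OF e x] in auto)
  qed
  then show ?thesis by blast
qed

lemma green_sum_lap: "green_sum N u v - avg (green_sum N u) v = u v - (avg ^^ N) u v"
proof (induction N)
  case (Suc N)
  have "green_sum (Suc N) u = (\<lambda>x. green_sum N u x + (avg ^^ N) u x)" by (simp add: green_sum_def fun_eq_iff)
  then show ?case using Suc by (simp add: avg_add)
qed (simp add: green_sum_def[abs_def] avg_def)

lemma pot_laplacian:
  assumes d: "2 \<le> CARD('n)" and x: "x \<in> verts T" and v: "v \<in> verts T"
  shows "pot x v - avg (pot x) v = pmass x v"
proof -
  let ?S = "\<lambda>N w. green_sum N (pmass x) w - (\<Sum>n<N. renorm n)"
  have "(\<lambda>N. ?S N v - avg (?S N) v) \<longlonglongrightarrow> pot x v - avg (pot x) v"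
    unfolding avg_def using nb_V
    by (intro tendsto_diff pot_lim[OF d x v] tendsto_divide_zero tendsto_divide tendsto_sum tendsto_mult tendsto_const pot_lim[OF d x])
       (use deg_pos[OF v] in auto)
  moreover have "?S N v - avg (?S N) v = pmass x v - (avg ^^ N) (pmass x) v" for N
    using avg_const[OF v, of "\<Sum>n<N. renorm n"] green_sum_lap[of N "pmass x" v] by (simp add: avg_diff)
  moreover have "(\<lambda>N. pmass x v - (avg ^^ N) (pmass x) v) \<longlonglongrightarrow> pmass x v - 0"
    by (intro tendsto_diff tendsto_const avg_pow_l2_null[OF fs_l2[OF fs_pmass[OF x]] v])
  ultimately show ?thesis using LIMSEQ_unique by fastforce
qed

lemma green0_eq:
  assumes x: "x \<in> verts T" and l: "l \<in> lattice T"
  shows "green0 T (x - l) = pot x l"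
proof -
  have xl: "x - l \<in> verts T" using V_shift[OF Lat_uminus[OF l] x] by simp
  have "trans_prob_n T n 0 (x - l) / real (vdeg T (x - l)) = (avg ^^ n) (pmass x) l" for n
    using trans_prob_n_eq[OF xl zero_V, of n] avg_pow_shift[OF l, of n "pmass x" 0] pmass_shift[OF l, of x] by simp
  moreover have "trans_prob_n T n 0 0 / real (vdeg T 0) = (avg ^^ n) (pmass 0) 0" for n
    by (rule trans_prob_n_eq[OF zero_V zero_V])
  ultimately show ?thesis by (simp add: green0_def pot_def renorm_def)
qed

text \<open>
  Off the lattice, \<open>optional_stopping\<close> is applied to \<open>pot x\<close>: its defect from the average is the point mass at
  \<open>x\<close>, which counts visits to \<open>x\<close>, and its values on the lattice are those of \<open>green0\<close>.
\<close>

lemma green_eq: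
  assumes d: "2 \<le> CARD('n)" and x: "x \<in> verts T" and v: "v \<in> verts T"
  shows "green T v x = pot x v"
proof (cases "v \<in> lattice T")
  case True
  then show ?thesis by (simp add: green_def green0_eq[OF x])
next
  case False
  let ?\<tau> = "return_time T"
  obtain B where B: "\<And>a b. edge_mult T a b \<noteq> 0 \<Longrightarrow> \<bar>pot x a - pot x b\<bar> \<le> B"
    using pot_lipschitz[OF d] x by blast
  have "pot x v = (\<integral>\<omega>. (\<Sum>j<?\<tau> \<omega>. pot x (\<omega> j) - avg (pot x) (\<omega> j)) \<partial>walk T v) + (\<integral>\<omega>. pot x (\<omega> (?\<tau> \<omega>)) \<partial>walk T v)"
    by (rule optional_stopping(2)[OF v, of "pot x" B, OF B])
  also have "(\<integral>\<omega>. (\<Sum>j<?\<tau> \<omega>. pot x (\<omega> j) - avg (pot x) (\<omega> j)) \<partial>walk T v)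
      = (\<integral>\<omega>. 1 / real (vdeg T x) * (\<Sum>j<?\<tau> \<omega>. of_bool (\<omega> j = x)) \<partial>walk T v)"
  proof (rule integral_cong_AE)
    show "(\<lambda>\<omega>. \<Sum>j<?\<tau> \<omega>. pot x (\<omega> j) - avg (pot x) (\<omega> j)) \<in> borel_measurable (walk T v)"
      by (rule stopped_measurable[of "\<lambda>n \<omega>. \<Sum>j<n. pot x (\<omega> j) - avg (pot x) (\<omega> j)"])
         (intro borel_measurable_sum borel_measurable_diff measurable_coord_borel)
    show "(\<lambda>\<omega>. 1 / real (vdeg T x) * (\<Sum>j<?\<tau> \<omega>. of_bool (\<omega> j = x))) \<in> borel_measurable (walk T v)"
      by (rule stopped_measurable[of "\<lambda>n \<omega>. 1 / real (vdeg T x) * (\<Sum>j<n. of_bool (\<omega> j = x))"])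
         (intro borel_measurable_times borel_measurable_const borel_measurable_sum measurable_coord_borel)
    have pt: "(\<Sum>j<?\<tau> \<omega>. pot x (\<omega> j) - avg (pot x) (\<omega> j)) = 1 / real (vdeg T x) * (\<Sum>j<?\<tau> \<omega>. of_bool (\<omega> j = x))"
      if "\<forall>n. \<omega> n \<in> verts T" for \<omega>
      unfolding sum_distrib_left using pot_laplacian[OF d x] that
      by (intro sum.cong) (auto simp: pmass_def deg_vdeg)
    show "AE \<omega> in walk T v. (\<Sum>j<?\<tau> \<omega>. pot x (\<omega> j) - avg (pot x) (\<omega> j)) = 1 / real (vdeg T x) * (\<Sum>j<?\<tau> \<omega>. of_bool (\<omega> j = x))"
      using walk_path[OF v] by (rule eventually_mono) (use pt in blast)
  qed
  also have "\<dots> = 1 / real (vdeg T x) * (\<integral>\<omega>. (\<Sum>j<?\<tau> \<omega>. of_bool (\<omega> j = x)) \<partial>walk T v)"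
    by (rule integral_mult_right_zero)
  also have "(\<integral>\<omega>. pot x (\<omega> (?\<tau> \<omega>)) \<partial>walk T v) = (\<integral>\<omega>. green0 T (x - \<omega> (?\<tau> \<omega>)) \<partial>walk T v)"
  proof (rule integral_cong_AE)
    show "(\<lambda>\<omega>. pot x (\<omega> (?\<tau> \<omega>))) \<in> borel_measurable (walk T v)"
      by (rule stopped_measurable[of "\<lambda>n \<omega>. pot x (\<omega> n)"]) (rule measurable_coord_borel)
    show "(\<lambda>\<omega>. green0 T (x - \<omega> (?\<tau> \<omega>))) \<in> borel_measurable (walk T v)"
      by (rule stopped_measurable[of "\<lambda>n \<omega>. green0 T (x - \<omega> n)"]) (rule measurable_coord_borel)
    show "AE \<omega> in walk T v. pot x (\<omega> (?\<tau> \<omega>)) = green0 T (x - \<omega> (?\<tau> \<omega>))"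
      using walk_returns[OF v] by (rule eventually_mono) (simp add: green0_eq[OF x] return_time_props)
  qed
  finally show ?thesis using False by (simp add: green_def)
qed

text \<open>
  The density of \<open>\<eta>\<close> with respect to the degree measure.
\<close>

definition dens :: "(real ^ 'n \<Rightarrow> real) \<Rightarrow> real ^ 'n \<Rightarrow> real" where
  "dens \<eta> v = (if v \<in> verts T then \<eta> v / deg v else 0)"

lemma fs_dens:
  assumes "finite {v\<in>verts T. \<eta> v \<noteq> 0}" shows "fs (dens \<eta>)"
proof -
  have "supp (dens \<eta>) \<subseteq> {v\<in>verts T. \<eta> v \<noteq> 0}" by (auto simp: supp_def dens_def split: if_splits)
  then show ?thesis unfolding fs_def using finite_subset[OF _ assms] by blast
qed

lemma ip_dens:
  assumes "finite S" "S \<subseteq> verts T" "\<And>x. x \<in> verts T - S \<Longrightarrow> \<eta> x = 0"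
  shows "ip (dens \<eta>) w = (\<Sum>x\<in>S. \<eta> x * w x)"
proof -
  have "supp (dens \<eta>) \<subseteq> S" using assms(3) by (auto simp: supp_def dens_def split: if_splits)
  from ip_eq[OF assms(1) this] have "ip (dens \<eta>) w = (\<Sum>x\<in>S. deg x * dens \<eta> x * w x)" .
  also have "\<dots> = (\<Sum>x\<in>S. \<eta> x * w x)"
    using assms(2) deg_pos by (intro sum.cong) (fastforce simp: dens_def)+
  finally show ?thesis .
qed

lemma green_conv_eq:
  assumes d: "2 \<le> CARD('n)" and S: "finite S" "S \<subseteq> verts T" "\<And>x. x \<in> verts T - S \<Longrightarrow> \<eta> x = 0"
    and x: "x \<in> verts T"
  shows "green_conv T \<eta> x = (\<Sum>v\<in>S. \<eta> v * pot x v)"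
proof -
  have "green_conv T \<eta> x = (\<Sum>\<^sub>\<infinity>v\<in>verts T. \<eta> v * green T v x)"
    using x by (simp add: green_conv_def)
  also have "\<dots> = (\<Sum>v\<in>S. \<eta> v * green T v x)"
    by (rule infsum_finite_support[OF S(1,2)]) (simp only: S(3) mult_zero_left)
  also have "\<dots> = (\<Sum>v\<in>S. \<eta> v * pot x v)" using S(2) green_eq[OF d x] by (intro sum.cong) auto
  finally show ?thesis .
qed

lemma green_conv_lim:
  assumes d: "2 \<le> CARD('n)" and S: "finite S" "S \<subseteq> verts T" "\<And>x. x \<in> verts T - S \<Longrightarrow> \<eta> x = 0"
    and x: "x \<in> verts T"
  shows "(\<lambda>N. green_sum N (dens \<eta>) x - sum \<eta> S * (\<Sum>n<N. renorm n)) \<longlonglongrightarrow> green_conv T \<eta> x"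
proof -
  have fsd: "fs (dens \<eta>)"
    by (rule fs_dens, rule finite_subset[OF _ S(1)]) (use S(3) in blast)
  have "(avg ^^ n) (dens \<eta>) x = (\<Sum>v\<in>S. \<eta> v * (avg ^^ n) (pmass x) v)" for n
  proof -
    have "(avg ^^ n) (dens \<eta>) x = ip (pmass x) ((avg ^^ n) (dens \<eta>))" by (simp add: ip_pmass[OF x])
    also have "\<dots> = ip ((avg ^^ n) (pmass x)) (dens \<eta>)" using fs_pmass[OF x] by (simp add: ip_avg_pow)
    also have "\<dots> = ip (dens \<eta>) ((avg ^^ n) (pmass x))" using fs_pmass[OF x] fsd by (intro ip_commute) auto
    also have "\<dots> = (\<Sum>v\<in>S. \<eta> v * (avg ^^ n) (pmass x) v)" by (rule ip_dens[OF S])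
    finally show ?thesis .
  qed
  then have "green_sum N (dens \<eta>) x = (\<Sum>v\<in>S. \<eta> v * green_sum N (pmass x) v)" for N
    unfolding green_sum_def sum_distrib_left by (simp add: sum.swap[of _ S])
  then have "green_sum N (dens \<eta>) x - sum \<eta> S * (\<Sum>n<N. renorm n) = (\<Sum>v\<in>S. \<eta> v * (green_sum N (pmass x) v - (\<Sum>n<N. renorm n)))" for N
    by (simp add: right_diff_distrib sum_subtractf sum_distrib_right)
  moreover have "(\<lambda>N. \<Sum>v\<in>S. \<eta> v * (green_sum N (pmass x) v - (\<Sum>n<N. renorm n))) \<longlonglongrightarrow> (\<Sum>v\<in>S. \<eta> v * pot x v)"
    using S(2) by (intro tendsto_sum tendsto_mult tendsto_const pot_lim[OF d x]) auto
  moreover have "green_conv T \<eta> x = (\<Sum>v\<in>S. \<eta> v * pot x v)" by (rule green_conv_eq[OF d S x])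
  ultimately show ?thesis by (simp only:)
qed

lemma lap_green_conv:
  assumes d: "2 \<le> CARD('n)" and S: "finite S" "S \<subseteq> verts T" "\<And>x. x \<in> verts T - S \<Longrightarrow> \<eta> x = 0"
    and x: "x \<in> verts T"
  shows "lap (green_conv T \<eta>) x = \<eta> x"
proof -
  have eq: "green_conv T \<eta> y = (\<Sum>v\<in>S. \<eta> v * pot v y)" if "y \<in> verts T" for y
    using green_conv_eq[OF d S that] pot_symmetric[OF that] S(2) by (simp add: subset_iff)
  have "lap (green_conv T \<eta>) x = (\<Sum>y\<in>nb x. real (edge_mult T x y) * ((\<Sum>v\<in>S. \<eta> v * pot v x) - (\<Sum>v\<in>S. \<eta> v * pot v y)))"
    unfolding lap_alt using eq[OF x] eq nb_V by (intro sum.cong) auto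
  also have "\<dots> = (\<Sum>v\<in>S. \<eta> v * (\<Sum>y\<in>nb x. real (edge_mult T x y) * (pot v x - pot v y)))"
    unfolding sum_subtractf[symmetric] sum_distrib_left
    by (subst sum.swap) (simp add: right_diff_distrib mult_ac)
  also have "\<dots> = (\<Sum>v\<in>S. \<eta> v * lap (pot v) x)" by (simp add: lap_alt)
  also have "\<dots> = (\<Sum>v\<in>S. if v = x then \<eta> x else 0)"
  proof (intro sum.cong refl)
    fix v assume "v \<in> S"
    then show "\<eta> v * lap (pot v) x = (if v = x then \<eta> x else 0)"
      using pot_laplacian[OF d _ x, of v] S(2) deg_pos[OF x] by (auto simp: lap_def pmass_def)
  qed
  also have "\<dots> = \<eta> x" using S(1) S(3)[of x] x by simp
  finally show ?thesis .
qed

lemma laplacian_eq: "x \<in> verts T \<Longrightarrow> laplacian T \<xi> x = lap \<xi> x"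
proof -
  assume x: "x \<in> verts T"
  have "(\<Sum>\<^sub>\<infinity>w\<in>verts T. real (edge_mult T x w) * \<xi> w) = (\<Sum>w\<in>nb x. real (edge_mult T x w) * \<xi> w)"
  proof (rule infsum_finite_support)
    show "nb x \<subseteq> verts T" using nb_V by blast
  qed (simp_all add: nb_def finite_c[simplified])
  then show ?thesis using x by (simp add: laplacian_def lap_def right_diff_distrib deg_avg) (simp add: deg_vdeg)
qed

lemma lap_cong: "(\<And>y. y \<in> verts T \<Longrightarrow> u y = v y) \<Longrightarrow> x \<in> verts T \<Longrightarrow> lap u x = lap v x"
  using avg_cong[of u v] by (simp add: lap_def)

lemma finite_large_values:
  fixes f :: "'b \<Rightarrow> real"
  assumes f: "f summable_on A" "\<And>x. x \<in> A \<Longrightarrow> 0 \<le> f x" and \<delta>: "0 < \<delta>"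
  shows "finite {x\<in>A. \<delta> \<le> f x}"
proof (rule finite_if_finite_subsets_card_bdd[THEN conjunct1])
  fix F assume F: "F \<subseteq> {x\<in>A. \<delta> \<le> f x}" "finite F"
  have "real (card F) * \<delta> = (\<Sum>x\<in>F. \<delta>)" by simp
  also have "\<dots> \<le> sum f F" using F by (intro sum_mono) auto
  also have "\<dots> \<le> infsum f A" using F f by (intro finite_sum_le_infsum) auto
  finally have "real (card F) \<le> infsum f A / \<delta>" using \<delta> by (simp add: field_simps)
  then show "card F \<le> nat \<lceil>infsum f A / \<delta>\<rceil>" by linarith
qed

text \<open>
  Where the Laplacian is nonzero it is at least 1 in absolute value. This forces a value of \<open>\<xi>\<close> bounded below
  at the vertex or one of its neighbours, which for a square summable \<open>\<xi>\<close> happens near finitely many vertices only.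
\<close>

lemma finite_integral_laplacian:
  assumes \<xi>: "(\<lambda>x. (\<xi> x)\<^sup>2) summable_on verts T" and int: "\<And>x. x \<in> verts T \<Longrightarrow> lap \<xi> x \<in> \<int>"
  shows "finite {x\<in>verts T. lap \<xi> x \<noteq> 0}"
proof -
  obtain D where D: "\<And>x. deg x \<le> D" using deg_bounded by blast
  have D1: "1 \<le> D" using deg_ge_1[OF zero_V] D[of 0] by linarith
  \<comment> \<open>If \<open>\<bar>\<xi>\<bar> \<le> e\<close> at a vertex and its neighbours, the Laplacian there is at most \<open>2 * e * D < 1\<close>.\<close>
  define e where "e = 1 / (4 * D)"
  have e: "0 < e" using D1 by (simp add: e_def)
  let ?L = "{x\<in>verts T. e\<^sup>2 \<le> (\<xi> x)\<^sup>2}"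
  have L: "finite ?L" using e by (intro finite_large_values[OF \<xi>]) auto
  have "{x\<in>verts T. lap \<xi> x \<noteq> 0} \<subseteq> ?L \<union> (\<Union>y\<in>?L. nb y)"
  proof (rule subsetI, rule ccontr)
    fix x assume x: "x \<in> {x\<in>verts T. lap \<xi> x \<noteq> 0}" "x \<notin> ?L \<union> (\<Union>y\<in>?L. nb y)"
    have small: "\<bar>\<xi> y\<bar> \<le> e" if "y \<in> insert x (nb x)" for y
    proof -
      have "y \<in> verts T" "y \<notin> ?L" using that x nb_V nb_sym by auto
      then have "\<bar>\<xi> y\<bar>\<^sup>2 \<le> e\<^sup>2" by auto
      then show ?thesis by (rule power2_le_imp_le) (use e in simp)
    qed
    have "\<bar>lap \<xi> x\<bar> \<le> (\<Sum>y\<in>nb x. real (edge_mult T x y) * (2 * e))"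
      unfolding lap_alt
    proof (rule order_trans[OF sum_abs], rule sum_mono)
      fix y assume y: "y \<in> nb x"
      have "\<bar>\<xi> x - \<xi> y\<bar> \<le> 2 * e" using small[of x] small[of y] y by auto
      then show "\<bar>real (edge_mult T x y) * (\<xi> x - \<xi> y)\<bar> \<le> real (edge_mult T x y) * (2 * e)"
        by (simp add: abs_mult mult_left_mono)
    qed
    also have "\<dots> = deg x * (2 * e)" by (simp add: deg_def sum_distrib_right)
    also have "\<dots> \<le> D * (2 * e)" using D e by (intro mult_right_mono) auto
    also have "\<dots> < 1" using D1 by (simp add: e_def)
    finally have "\<bar>lap \<xi> x\<bar> < 1" .
    moreover have "lap \<xi> x \<in> \<int>" using int x by blast
    then obtain k where k: "lap \<xi> x = of_int k" by (rule Ints_cases)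
    ultimately have "\<bar>real_of_int k\<bar> < 1" by simp
    then have "k = 0" by linarith
    then show False using k x by simp
  qed
  moreover have "finite (?L \<union> (\<Union>y\<in>?L. nb y))" using L by (intro finite_UnI finite_UN_I finite_nb)
  ultimately show ?thesis by (rule finite_subset)
qed

lemma finite_bounded_vertices: assumes "bounded A" "A \<subseteq> verts T" shows "finite A"
proof -
  obtain B where B: "\<And>i x. x \<in> verts T \<Longrightarrow> \<bar>hcoord i x - x $ i\<bar> \<le> B" using hcoord_close by blast
  obtain b where b: "\<And>x. x \<in> A \<Longrightarrow> norm x \<le> b" using assms(1) by (auto simp: bounded_iff)
  have "A \<subseteq> {x\<in>verts T. \<forall>i. \<bar>hcoord i x\<bar> \<le> (B + b) * real 1}"
  proof
    fix x assume x: "x \<in> A"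
    have "\<bar>hcoord i x\<bar> \<le> B + b" for i
      using B[of x i] b[OF x] component_le_norm_cart[of x i] x assms(2) by (fastforce simp: abs_le_iff)
    then show "x \<in> {x\<in>verts T. \<forall>i. \<bar>hcoord i x\<bar> \<le> (B + b) * real 1}" using x assms(2) by auto
  qed
  moreover have "finite {x\<in>verts T. \<forall>i. \<bar>hcoord i x\<bar> \<le> (B + b) * real 1}" using ball_count[of "B + b"] by blast
  ultimately show ?thesis by (rule finite_subset)
qed

definition Cj :: "(real ^ 'n \<Rightarrow> int) set" where
  "Cj = (if CARD('n) = 2 then C2 T else if CARD('n) \<le> 4 then C1 T else C0 T)"

lemma C0_iff:
  "\<eta> \<in> C0 T \<longleftrightarrow> \<eta> \<in> extensional (verts T) \<and> finite {x\<in>verts T. \<eta> x \<noteq> 0}"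
proof -
  have "finite {x\<in>verts T. \<eta> x \<noteq> 0}" if "(\<lambda>x. \<bar>real_of_int (\<eta> x)\<bar>) summable_on verts T"
  proof -
    have "finite {x\<in>verts T. 1 \<le> \<bar>real_of_int (\<eta> x)\<bar>}" by (rule finite_large_values[OF that]) auto
    moreover have "{x\<in>verts T. \<eta> x \<noteq> 0} \<subseteq> {x\<in>verts T. 1 \<le> \<bar>real_of_int (\<eta> x)\<bar>}" by auto
    ultimately show ?thesis using finite_subset by blast
  qed
  moreover have "(\<lambda>x. \<bar>real_of_int (\<eta> x)\<bar>) summable_on verts T" if "finite {x\<in>verts T. \<eta> x \<noteq> 0}"
    by (rule finite_nonzero_values_imp_summable_on) (use that in simp)
  ultimately show ?thesis unfolding C0_def by blast
qed

lemma Cj_iff: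
  assumes S: "finite S" "S = {x\<in>verts T. \<eta> x \<noteq> 0}"
  shows "\<eta> \<in> Cj \<longleftrightarrow> \<eta> \<in> extensional (verts T) \<and>
    (CARD('n) \<le> 4 \<longrightarrow> (\<Sum>x\<in>S. real_of_int (\<eta> x)) = 0) \<and>
    (CARD('n) = 2 \<longrightarrow> (\<forall>i. (\<Sum>x\<in>S. real_of_int (\<eta> x) * hcoord i x) = 0))"
proof -
  have 1: "(\<Sum>\<^sub>\<infinity>x\<in>verts T. real_of_int (\<eta> x)) = (\<Sum>x\<in>S. real_of_int (\<eta> x))"
    using S by (intro infsum_finite_support) auto
  have 2: "(\<Sum>\<^sub>\<infinity>x\<in>verts T. real_of_int (\<eta> x) *\<^sub>R mean_return T x) = (\<Sum>x\<in>S. real_of_int (\<eta> x) *\<^sub>R mean_return T x)"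
    using S by (intro infsum_finite_support) auto
  have "(\<Sum>x\<in>S. real_of_int (\<eta> x) *\<^sub>R mean_return T x) $ i = (\<Sum>x\<in>S. real_of_int (\<eta> x) * hcoord i x)" for i
    unfolding sum_component vector_scaleR_component real_scaleR_def
    using S mean_return_coordinates by (intro sum.cong) auto
  then have 3: "(\<Sum>x\<in>S. real_of_int (\<eta> x) *\<^sub>R mean_return T x) = 0 \<longleftrightarrow> (\<forall>i. (\<Sum>x\<in>S. real_of_int (\<eta> x) * hcoord i x) = 0)"
    by (simp add: vec_eq_iff)
  show ?thesis
    unfolding Cj_def C2_def C1_def using C0_iff[of \<eta>] 1 2 3 S by auto
qed

text \<open>
  The vanishing moments of \<open>\<eta>\<close> are those of \<open>dens \<eta>\<close> in the degree-weighted pairing, and the renormalising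
  constants cancel: in dimension 2 because the sum of \<open>\<eta>\<close> is 0, otherwise because they vanish.
\<close>

lemma green_conv_l2:
  assumes d: "2 \<le> CARD('n)" and \<eta>: "\<eta> \<in> Cj"
  shows "green_conv T (\<lambda>x. real_of_int (\<eta> x)) \<in> l2_fun T"
proof -
  let ?e = "\<lambda>x. real_of_int (\<eta> x)"
  define S where "S = {x\<in>verts T. \<eta> x \<noteq> 0}"
  have "\<eta> \<in> C0 T" using \<eta> by (auto simp: Cj_def C1_def C2_def split: if_splits)
  then have "finite S" by (simp add: C0_iff S_def)
  then have S: "finite S" "S \<subseteq> verts T" "\<And>x. x \<in> verts T - S \<Longrightarrow> ?e x = 0" by (auto simp: S_def)
  note C = Cj_iff[OF S(1) S_def, THEN iffD1, OF \<eta>]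
  have f: "fs (dens ?e)" using S(1) by (intro fs_dens) (simp add: S_def)
  have ip1: "ip (dens ?e) (\<lambda>_. 1) = (\<Sum>x\<in>S. ?e x)" using ip_dens[OF S, where w = "\<lambda>_. 1"] by simp
  have iph: "ip (dens ?e) (hcoord i) = (\<Sum>x\<in>S. ?e x * hcoord i x)" for i by (rule ip_dens[OF S])
  have "green_l2 (dens ?e)"
  proof (cases "CARD('n) = 2")
    case True
    then show ?thesis using C d f ip1 iph by (intro green_l2_dim2) auto
  next
    case False
    then show ?thesis using C d f ip1 green_l2_dim3[OF _ f] green_l2_dim5[OF _ f] by (cases "CARD('n) \<le> 4") auto
  qed
  then obtain \<xi> where \<xi>: "(\<lambda>x. (\<xi> x)\<^sup>2) summable_on verts T" "\<And>x. x \<in> verts T \<Longrightarrow> (\<lambda>N. green_sum N (dens ?e) x) \<longlonglongrightarrow> \<xi> x"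
    unfolding green_l2_def by blast
  have zero: "sum ?e S * (\<Sum>n<N. renorm n) = 0" for N using C by (auto simp: renorm_def)
  have "green_conv T ?e x = \<xi> x" if "x \<in> verts T" for x
    using green_conv_lim[where \<eta> = ?e, OF d S that] \<xi>(2)[OF that] unfolding zero by (simp add: LIMSEQ_unique)
  then have "(\<lambda>x. (green_conv T ?e x)\<^sup>2) summable_on verts T"
    using \<xi>(1) summable_on_cong[of "verts T" "\<lambda>x. (green_conv T ?e x)\<^sup>2" "\<lambda>x. (\<xi> x)\<^sup>2"] by simp
  then show ?thesis by (simp add: l2_fun_def green_conv_def)
qed

text \<open>
  The moment conditions come from the test functions. The density of \<open>\<eta>\<close> is \<open>\<xi> - P \<xi>\<close>, so its Green sums telescope to \<open>\<xi> - P\<^sup>N \<xi>\<close>, and \<open>P\<^sup>N \<xi>\<close> tends to 0.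
\<close>

lemma l2_integer_laplacian:
  assumes d: "2 \<le> CARD('n)" and \<xi>: "(\<lambda>x. (\<xi> x)\<^sup>2) summable_on verts T"
    and \<eta>: "\<eta> \<in> extensional (verts T)" "\<And>x. x \<in> verts T \<Longrightarrow> lap \<xi> x = real_of_int (\<eta> x)"
  shows "\<eta> \<in> Cj" and "x \<in> verts T \<Longrightarrow> green_conv T (\<lambda>x. real_of_int (\<eta> x)) x = \<xi> x"
proof -
  let ?e = "\<lambda>x. real_of_int (\<eta> x)"
  define S where "S = {x\<in>verts T. \<eta> x \<noteq> 0}"
  have "finite {x\<in>verts T. lap \<xi> x \<noteq> 0}" using \<eta>(2) by (intro finite_integral_laplacian[OF \<xi>]) simp
  moreover have "{x\<in>verts T. lap \<xi> x \<noteq> 0} = S" using \<eta>(2) by (auto simp: S_def)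
  ultimately have "finite S" by simp
  then have S: "finite S" "S \<subseteq> verts T" "\<And>x. x \<in> verts T - S \<Longrightarrow> ?e x = 0" "\<And>x. x \<in> verts T - S \<Longrightarrow> lap \<xi> x = 0"
    using \<eta>(2) by (auto simp: S_def)
  have s1: "(\<Sum>x\<in>S. ?e x) = 0" if "CARD('n) \<le> 4"
    using l2_laplacian_sum_zero[OF \<xi> S(1,2,4) that] S(2) \<eta>(2) by (simp add: subset_iff cong: sum.cong)
  moreover have "(\<Sum>x\<in>S. ?e x * hcoord i x) = 0" if "CARD('n) = 2" for i
  proof -
    have "(\<Sum>x\<in>S. ?e x * hcoord i x) = (\<Sum>x\<in>S. hcoord i x * lap \<xi> x)"
      using S(2) \<eta>(2) by (intro sum.cong) auto
    then show ?thesis using l2_laplacian_moment_zero[OF \<xi> S(1,2,4) that, of i] by simp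
  qed
  ultimately show "\<eta> \<in> Cj" using Cj_iff[OF S(1) S_def] \<eta>(1) by blast
  show "green_conv T ?e x = \<xi> x" if x: "x \<in> verts T"
  proof -
    define \<zeta> where "\<zeta> y = (if y \<in> verts T then \<xi> y else 0)" for y
    have "dens ?e y = \<zeta> y - avg \<zeta> y" for y
    proof (cases "y \<in> verts T")
      case True
      have "lap \<zeta> y = lap \<xi> y" using True by (intro lap_cong) (simp_all add: \<zeta>_def)
      then show ?thesis using True \<eta>(2)[OF True] deg_pos[OF True] by (simp add: dens_def lap_def field_simps)
    qed (simp add: dens_def \<zeta>_def avg_outside)
    then have dens: "dens ?e = (\<lambda>y. \<zeta> y - avg \<zeta> y)" by (simp add: fun_eq_iff)
    have \<zeta>2: "(\<lambda>x. (\<zeta> x)\<^sup>2) summable_on verts T"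
      using \<xi> summable_on_cong[of "verts T" "\<lambda>x. (\<zeta> x)\<^sup>2" "\<lambda>x. (\<xi> x)\<^sup>2"] by (simp add: \<zeta>_def)
    have zero: "sum ?e S * (\<Sum>n<N. renorm n) = 0" for N
      by (cases "CARD('n) = 2") (use s1 in \<open>auto simp: renorm_def\<close>)
    have "(\<lambda>N. \<zeta> x - (avg ^^ N) \<zeta> x) \<longlonglongrightarrow> green_conv T ?e x"
      using green_conv_lim[where \<eta> = ?e, OF d S(1,2,3) x] unfolding zero dens green_sum_telescope by simp
    moreover have "(\<lambda>N. \<zeta> x - (avg ^^ N) \<zeta> x) \<longlonglongrightarrow> \<zeta> x - 0"
      by (intro tendsto_diff tendsto_const avg_pow_l2_null[OF \<zeta>2 x])
    ultimately have "green_conv T ?e x = \<zeta> x" using LIMSEQ_unique by fastforce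
    then show ?thesis using x by (simp add: \<zeta>_def)
  qed
qed

lemma green_conv_cong:
  "(\<And>v. v \<in> verts T \<Longrightarrow> f v = g v) \<Longrightarrow> green_conv T f = green_conv T g"
  unfolding green_conv_def by (intro restrict_ext infsum_cong) simp

lemma harmonic_mod_1_integer:
  assumes d: "2 \<le> CARD('n)" and \<xi>: "\<xi> \<in> harmonic_mod_1_l2 T"
  shows "\<exists>\<eta>\<in>Cj. \<xi> = green_conv T (\<lambda>x. real_of_int (\<eta> x)) \<and>
    green_conv T (laplacian T \<xi>) = green_conv T (\<lambda>x. real_of_int (\<eta> x))"
proof -
  have \<xi>2: "(\<lambda>x. (\<xi> x)\<^sup>2) summable_on verts T" and ext: "\<xi> \<in> extensional (verts T)"
    and int: "\<And>x. x \<in> verts T \<Longrightarrow> laplacian T \<xi> x \<in> \<int>"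
    using \<xi> by (auto simp: harmonic_mod_1_l2_def l2_fun_def)
  define \<eta> where "\<eta> = (\<lambda>x\<in>verts T. \<lfloor>laplacian T \<xi> x\<rfloor>)"
  have \<eta>: "real_of_int (\<eta> x) = laplacian T \<xi> x" if "x \<in> verts T" for x
    using int[OF that] that by (auto simp: \<eta>_def elim: Ints_cases)
  have "\<eta> \<in> extensional (verts T)" by (simp add: \<eta>_def)
  note * = l2_integer_laplacian[OF d \<xi>2 this]
  have lap: "lap \<xi> x = real_of_int (\<eta> x)" if "x \<in> verts T" for x using \<eta>[OF that] laplacian_eq[OF that] by simp
  have "\<xi> = green_conv T (\<lambda>x. real_of_int (\<eta> x))"
  proof (rule extensionalityI[OF ext])
    show "green_conv T (\<lambda>x. real_of_int (\<eta> x)) \<in> extensional (verts T)" by (simp add: green_conv_def)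
    show "\<xi> x = green_conv T (\<lambda>x. real_of_int (\<eta> x)) x" if "x \<in> verts T" for x
      using *(2)[OF lap that] by simp
  qed
  moreover have "green_conv T (laplacian T \<xi>) = green_conv T (\<lambda>x. real_of_int (\<eta> x))"
    using \<eta> by (intro green_conv_cong) simp
  ultimately show ?thesis using *(1)[OF lap] by blast
qed

end

section \<open>Square summable Green convolutions\<close>

theorem theorem7:
  fixes T :: "('n::finite) tiling" and C :: "(real ^ 'n \<Rightarrow> int) set"
  assumes tiling: "periodic_tiling T"
    and dim: "2 \<le> CARD('n)"
    and C: "C = (if CARD('n) = 2 then C2 T else if CARD('n) \<le> 4 then C1 T else C0 T)"
  shows "(\<forall>\<eta> \<in> extensional (verts T). bounded {x \<in> verts T. \<eta> x \<noteq> 0} \<longrightarrow>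
            (green_conv T (\<lambda>x. real_of_int (\<eta> x)) \<in> l2_fun T \<longleftrightarrow> \<eta> \<in> C)) \<and>
         harmonic_mod_1_l2 T = {green_conv T (\<lambda>x. real_of_int (\<eta> x)) | \<eta>. \<eta> \<in> C} \<and>
         (\<forall>\<xi> \<in> harmonic_mod_1_l2 T. \<xi> = green_conv T (laplacian T \<xi>))"
proof -
  interpret tiling_walk T by standard (rule tiling)
  have Cj: "C = Cj" unfolding C Cj_def ..
  have lapg: "lap (green_conv T (\<lambda>x. real_of_int (\<eta> x))) x = real_of_int (\<eta> x)"
    if "finite {x \<in> verts T. \<eta> x \<noteq> 0}" "x \<in> verts T" for \<eta> :: "real ^ 'n \<Rightarrow> int" and x
    by (rule lap_green_conv[OF dim that(1) _ _ that(2)]) auto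
  show ?thesis
  proof (intro conjI ballI impI)
    fix \<eta> :: "real ^ 'n \<Rightarrow> int"
    assume \<eta>: "\<eta> \<in> extensional (verts T)" "bounded {x \<in> verts T. \<eta> x \<noteq> 0}"
    have fin: "finite {x \<in> verts T. \<eta> x \<noteq> 0}" by (rule finite_bounded_vertices[OF \<eta>(2)]) auto
    show "green_conv T (\<lambda>x. real_of_int (\<eta> x)) \<in> l2_fun T \<longleftrightarrow> \<eta> \<in> C"
    proof
      assume "green_conv T (\<lambda>x. real_of_int (\<eta> x)) \<in> l2_fun T"
      then have "(\<lambda>x. (green_conv T (\<lambda>x. real_of_int (\<eta> x)) x)\<^sup>2) summable_on verts T" by (simp add: l2_fun_def)
      from l2_integer_laplacian(1)[OF dim this \<eta>(1) lapg[OF fin]] show "\<eta> \<in> C" by (simp add: Cj)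
    qed (use green_conv_l2[OF dim] Cj in blast)
  next
    show "harmonic_mod_1_l2 T = {green_conv T (\<lambda>x. real_of_int (\<eta> x)) | \<eta>. \<eta> \<in> C}"
    proof
      show "harmonic_mod_1_l2 T \<subseteq> {green_conv T (\<lambda>x. real_of_int (\<eta> x)) | \<eta>. \<eta> \<in> C}"
        using harmonic_mod_1_integer[OF dim] Cj by blast
      show "{green_conv T (\<lambda>x. real_of_int (\<eta> x)) | \<eta>. \<eta> \<in> C} \<subseteq> harmonic_mod_1_l2 T"
      proof clarify
        fix \<eta> assume \<eta>: "\<eta> \<in> C"
        then have "\<eta> \<in> C0 T" by (auto simp: C C1_def C2_def split: if_splits)
        then have "finite {x \<in> verts T. \<eta> x \<noteq> 0}" by (simp add: C0_iff)
        then have "laplacian T (green_conv T (\<lambda>x. real_of_int (\<eta> x))) x \<in> \<int>" if "x \<in> verts T" for x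
          using lapg[OF _ that, of \<eta>] laplacian_eq[OF that] by simp
        then show "green_conv T (\<lambda>x. real_of_int (\<eta> x)) \<in> harmonic_mod_1_l2 T"
          using green_conv_l2[OF dim, of \<eta>] \<eta> by (simp add: harmonic_mod_1_l2_def Cj)
      qed
    qed
  next
    fix \<xi> assume "\<xi> \<in> harmonic_mod_1_l2 T"
    then show "\<xi> = green_conv T (laplacian T \<xi>)" using harmonic_mod_1_integer[OF dim] by metis
  qed
qed


end
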